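(* For any monoid $M$, the functors $$F\colon\mathcal{R}\mathrm{SCat}(cc\text{-}SExt_M)\to com\text{-}\mathrm{XSExt}_M,\qquad G\colon com\text{-}\mathrm{XSExt}_M\to\mathcal{R}\mathrm{SCat}(cc\text{-}SExt_M)$$ (described in the context) yield an equivalence of categories $$\mathcal{R}\mathrm{SCat}(cc\text{-}SExt_M)\cong com\text{-}\mathrm{XSExt}_M$$ between the category of $\mathcal{R}$-full Schreier internal categories in $cc\text{-}SExt_M$ and the category of crossed Schreier extensions $A\xrightarrow{k}B\xrightarrow{\delta}C\xrightarrow{\pi}M$ with $B$ commutative.
   Context: Monoids are written additively with neutral element $0$ and are not assumed commutative. $\mathbf{Mon}$ is the category of monoids (its regular epimorphisms are the surjective homomorphisms). Schreier extensions. A Schreier extension is a short exact sequence $K\xrightarrow{k}X\xrightarrow{f}M$ in $\mathbf{Mon}$ ($k$ is a kernel of $f$ and $f$ is a cokernel of $k$) such that for every $m\in M$ there is $u_m\in f^{-1}(m)$, called a representative of $m$, such that every $x\in f^{-1}(m)$ can be written as $x=k(a)+u_m$ for a unique $a\in K$. One also says that $f$ is a Schreier extension. A morphism of Schreier extensions is a commutative diagram of homomorphisms between two such sequences whose middle component sends representatives to representatives. A $cc$-Schreier extension is a Schreier extension whose kernel is commutative and cancellative. For fixed $M$, $cc\text{-}SExt_M$ is the category of $cc$-Schreier extensions with codomain $M$, with morphisms of Schreier extensions that are the identity on $M$. For $\mathbb{E}: K\xrightarrow{k}X\xrightarrow{f}M$ in $cc\text{-}SExt_M$, $R_{\mathbb{E}}=\{(x,y)\in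 X\times X: y=k(a)+x \text{ for some } a\in K\}$, a submonoid of $X\times X$. $\mathcal{R}$-full Schreier internal categories. A Schreier internal category in $\mathbf{Mon}$ is an internal category in $\mathbf{Mon}$ with domain $d_X\colon X_1\to X_0$, codomain $c_X\colon X_1\to X_0$, identities $e_X\colon X_0\to X_1$ and composition $m_X$, such that every $x\in X_1$ can be written as $x=k_d(a)+e_Xd_X(x)$ for a unique $a\in K[d_X]$, where $k_d\colon K[d_X]\to X_1$ is a kernel of $d_X$. A Schreier internal category $\mathcal{E}$ in $cc\text{-}SExt_M$ consists of objects $\mathbb{E}_i: K_i\xrightarrow{k_i}X_i\xrightarrow{f_i}M$ ($i=0,1$) of $cc\text{-}SExt_M$ and a Schreier internal category in $\mathbf{Mon}$ on $X_1\rightrightarrows X_0$ such that $f_0d_X=f_1=f_0c_X$, $f_1e_X=f_0$ and $d_X,c_X,e_X$ are morphisms in $cc\text{-}SExt_M$. Then $\langle d_X,c_X\rangle\colon X_1\to R_{\mathbb{E}_0}$, $x\mapsto(d_X(x),c_X(x))$, is well defined, and $\mathcal{E}$ is called $\mathcal{R}$-full if this homomorphism is a Schreier extension. $\mathcal{R}\mathrm{SCat}(cc\text{-}SExt_M)$ has the $\mathcal{R}$-full Schreier internal categories as objects; a morphism from $\mathcal{E}$ (on $X_1\rightrightarrows X_0$) to $\mathcal{L}$ (on $Y_1\rightrightarrows Y_0$, built from $\mathbb{L}_1,\mathbb{L}_0$) is an internal functor $(h_1\colon X_1\to Y_1,\,h_0\colon X_0\to Y_0)$ in $\mathbf{Mon}$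 such that $h_i\colon\mathbb{E}_i\to\mathbb{L}_i$ is a morphism in $cc\text{-}SExt_M$ for $i=0,1$, and $h_1$ together with the restriction $R_{\mathbb{E}_0}\to R_{\mathbb{L}_0}$ of $h_0\times h_0$ is a morphism of Schreier extensions from $\langle d_X,c_X\rangle$ to $\langle d_Y,c_Y\rangle$. Crossed Schreier extensions. A crossed semimodule is a pair $(\delta\colon B\to C,\alpha)$ where $\delta$ is a homomorphism of monoids and $\alpha\colon C\to\mathrm{End}(B)$ is a monoid homomorphism (write $c\ast b=\alpha(c)(b)$) with $\delta(c\ast b)+c=c+\delta(b)$ and $\delta(b_1)\ast b_2+b_1=b_1+b_2$ for all $b,b_1,b_2\in B$, $c\in C$. A morphism $(\delta,\alpha)\to(\delta',\alpha')$ is a pair of homomorphisms $\varphi\colon B\to B'$, $\psi\colon C\to C'$ with $\delta'\varphi=\psi\delta$ and $\varphi(\alpha(c)(b))=\alpha'(\psi(c))(\varphi(b))$. A sequence $A\xrightarrow{k}B\xrightarrow{\delta}C\xrightarrow{\pi}M$ with $(\delta,\alpha)$ a crossed semimodule, $k$ a kernel and $\pi$ a cokernel of $\delta$, is a crossed Schreier extension if, for the (regular epimorphism, monomorphism) factorisation $\delta=\nu\rho$, $\rho\colon B\to N$, $\nu\colon N\to C$: ($\mathbf{CS}_r$) $N$ is right cancellative and $N\xrightarrow{\nu}C\xrightarrow{\pi}M$ is a Schreier extension; ($\mathbf{CS}_l$) $A$ is right cancellative and $A\xrightarrow{k}B\xrightarrow{\rho}N$ is a Schreier extension. $com\text{-}\mathrm{XSExt}_M$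 has as objects the crossed Schreier extensions ending in $M$ with $B$ commutative; a morphism is a morphism of crossed semimodules $(\varphi,\psi)$ with $\pi'\psi=\pi$ such that, with $\varphi^\star\colon A\to A'$ and $\psi^\star\colon N\to N'$ the induced maps, $(\varphi^\star,\varphi,\psi^\star)$ and $(\psi^\star,\psi,1_M)$ are morphisms of Schreier extensions between, respectively, $A\to B\to N$ and $A'\to B'\to N'$, and $N\to C\to M$ and $N'\to C'\to M$. The functor $F$ sends $\mathcal{E}$ to the sequence $A\xrightarrow{k}K[d_X]\xrightarrow{\delta}X_0\xrightarrow{f_0}M$ with $\delta=c_Xk_d$, $k$ a kernel of $\delta$, and action $\alpha$ of $X_0$ on $K[d_X]$ determined by $e_X(x)+k_d(a)=k_d(\alpha(x)(a))+e_X(x)$; it sends $(h_1,h_0)$ to $(h_1^\star,h_0)$, where $h_1^\star\colon K[d_X]\to K[d_Y]$ is induced by $h_1$. The functor $G$ sends $A\xrightarrow{k}B\xrightarrow{\delta}C\xrightarrow{\pi}M$ to the category with $\mathbb{E}_0: N\xrightarrow{\nu}C\xrightarrow{\pi}M$, $\mathbb{E}_1: B\times N\xrightarrow{1_B\times\nu}B\rtimes_\alpha C\xrightarrow{\pi_1}M$, where $B\rtimes_\alpha C$ is $B\times C$ with $(b,c)+(b',c')=(b+\alpha(c)(b'),c+c')$, domain $p(b,c)=c$, codomain $\lambda(b,c)=\delta(b)+c$, identities $s(c)=(0,c)$, composition of $(b_1,c)$ followed by $(b_2,\delta(b_1)+c)$ equal to $(b_2+b_1,c)$, and $\pi_1=\pi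 p=\pi\lambda$; it sends $(\varphi,\psi)$ to $(\varphi\rtimes\psi,\psi)$, where $(\varphi\rtimes\psi)(b,c)=(\varphi(b),\psi(c))$. *)

theory Defs
  imports "HOL-Algebra.Coset" "HOL-Algebra.Divisibility"
begin

text \<open>
  Monoids are records of HOL-Algebra, so the additive notation \<open>x + y\<close>, \<open>0\<close> of the mathematics
  becomes \<open>x \<otimes> y\<close>, \<open>\<one>\<close>. All monoids that are objects of the categories below are carried by
  subsets of one type \<open>'u\<close>, which plays the role of the universe; auxiliary monoids of pairs
  (pullbacks, \<open>R_E\<close>) live on \<open>'u \<times> 'u\<close>. Homomorphisms are extensional, that is, \<open>undefined\<close>
  off the carrier of their domain, so that equality of functions is equality of morphisms.
\<close>

section \<open>Categories and equivalences\<close>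

text \<open>Hom-sets need not be disjoint; composition and the arrow part of a functor therefore
  receive the objects explicitly: \<open>Comp C A B D g f\<close> is \<open>g \<circ> f : A \<rightarrow> B \<rightarrow> D\<close>.\<close>

record ('o, 'a) cat =
  Obj :: "'o set"
  Hom :: "'o \<Rightarrow> 'o \<Rightarrow> 'a set"
  Id :: "'o \<Rightarrow> 'a"
  Comp :: "'o \<Rightarrow> 'o \<Rightarrow> 'o \<Rightarrow> 'a \<Rightarrow> 'a \<Rightarrow> 'a"

definition category :: "('o, 'a) cat \<Rightarrow> bool" where
  "category C \<longleftrightarrow>
     (\<forall>A\<in>Obj C. Id C A \<in> Hom C A A) \<and>
     (\<forall>A\<in>Obj C. \<forall>B\<in>Obj C. \<forall>D\<in>Obj C. \<forall>f\<in>Hom C A B. \<forall>g\<in>Hom C B D.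
        Comp C A B D g f \<in> Hom C A D) \<and>
     (\<forall>A\<in>Obj C. \<forall>B\<in>Obj C. \<forall>f\<in>Hom C A B.
        Comp C A A B f (Id C A) = f \<and> Comp C A B B (Id C B) f = f) \<and>
     (\<forall>A\<in>Obj C. \<forall>B\<in>Obj C. \<forall>D\<in>Obj C. \<forall>E\<in>Obj C.
        \<forall>f\<in>Hom C A B. \<forall>g\<in>Hom C B D. \<forall>h\<in>Hom C D E.
        Comp C A D E h (Comp C A B D g f) = Comp C A B E (Comp C B D E h g) f)"

record ('o, 'a, 'p, 'b) funct =
  fobj :: "'o \<Rightarrow> 'p"
  farr :: "'o \<Rightarrow> 'o \<Rightarrow> 'a \<Rightarrow> 'b"

definition is_functor :: "('o, 'a) cat \<Rightarrow> ('p, 'b) cat \<Rightarrow> ('o, 'a, 'p, 'b) funct \<Rightarrow> bool" where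
  "is_functor C D F \<longleftrightarrow> category C \<and> category D \<and>
     (\<forall>A\<in>Obj C. fobj F A \<in> Obj D) \<and>
     (\<forall>A\<in>Obj C. \<forall>B\<in>Obj C. \<forall>f\<in>Hom C A B. farr F A B f \<in> Hom D (fobj F A) (fobj F B)) \<and>
     (\<forall>A\<in>Obj C. farr F A A (Id C A) = Id D (fobj F A)) \<and>
     (\<forall>A\<in>Obj C. \<forall>B\<in>Obj C. \<forall>E\<in>Obj C. \<forall>f\<in>Hom C A B. \<forall>g\<in>Hom C B E.
        farr F A E (Comp C A B E g f) =
          Comp D (fobj F A) (fobj F B) (fobj F E) (farr F B E g) (farr F A B f))"

definition id_funct :: "('o, 'a, 'o, 'a) funct" where
  "id_funct = \<lparr>fobj = (\<lambda>A. A), farr = (\<lambda>A B f. f)\<rparr>"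

definition comp_funct ::
  "('p, 'b, 'q, 'c) funct \<Rightarrow> ('o, 'a, 'p, 'b) funct \<Rightarrow> ('o, 'a, 'q, 'c) funct" where
  "comp_funct G F =
     \<lparr>fobj = (\<lambda>A. fobj G (fobj F A)),
      farr = (\<lambda>A B f. farr G (fobj F A) (fobj F B) (farr F A B f))\<rparr>"

definition iso_arr :: "('o, 'a) cat \<Rightarrow> 'o \<Rightarrow> 'o \<Rightarrow> 'a \<Rightarrow> bool" where
  "iso_arr C A B f \<longleftrightarrow> f \<in> Hom C A B \<and>
     (\<exists>g\<in>Hom C B A. Comp C A B A g f = Id C A \<and> Comp C B A B f g = Id C B)"

definition natural_iso :: "('o, 'a) cat \<Rightarrow> ('p, 'b) cat \<Rightarrow>
    ('o, 'a, 'p, 'b) funct \<Rightarrow> ('o, 'a, 'p, 'b) funct \<Rightarrow> ('o \<Rightarrow> 'b) \<Rightarrow> bool" where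
  "natural_iso C D F G \<eta> \<longleftrightarrow>
     (\<forall>A\<in>Obj C. iso_arr D (fobj F A) (fobj G A) (\<eta> A)) \<and>
     (\<forall>A\<in>Obj C. \<forall>B\<in>Obj C. \<forall>f\<in>Hom C A B.
        Comp D (fobj F A) (fobj F B) (fobj G B) (\<eta> B) (farr F A B f) =
        Comp D (fobj F A) (fobj G A) (fobj G B) (farr G A B f) (\<eta> A))"

definition equivalence_of_categories :: "('o, 'a) cat \<Rightarrow> ('p, 'b) cat \<Rightarrow>
    ('o, 'a, 'p, 'b) funct \<Rightarrow> ('p, 'b, 'o, 'a) funct \<Rightarrow> bool" where
  "equivalence_of_categories C D F G \<longleftrightarrow>
     is_functor C D F \<and> is_functor D C G \<and>
     (\<exists>\<eta>. natural_iso C C id_funct (comp_funct G F) \<eta>) \<and>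
     (\<exists>\<epsilon>. natural_iso D D (comp_funct F G) id_funct \<epsilon>)"

section \<open>Monoids, kernels and cokernels\<close>

definition mon_hom :: "('a, 'm) monoid_scheme \<Rightarrow> ('b, 'n) monoid_scheme \<Rightarrow> ('a \<Rightarrow> 'b) set" where
  "mon_hom A B = {f \<in> hom A B. f \<one>\<^bsub>A\<^esub> = \<one>\<^bsub>B\<^esub>} \<inter> extensional (carrier A)"

definition mon_id :: "('a, 'm) monoid_scheme \<Rightarrow> 'a \<Rightarrow> 'a" where
  "mon_id A = (\<lambda>x\<in>carrier A. x)"

definition zero_hom :: "('a, 'm) monoid_scheme \<Rightarrow> ('b, 'n) monoid_scheme \<Rightarrow> 'a \<Rightarrow> 'b" where
  "zero_hom A B = (\<lambda>x\<in>carrier A. \<one>\<^bsub>B\<^esub>)"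

definition End_monoid :: "'a monoid \<Rightarrow> ('a \<Rightarrow> 'a) monoid" where
  "End_monoid B = \<lparr>carrier = mon_hom B B, mult = compose (carrier B), one = mon_id B\<rparr>"

definition right_cancellative :: "'a monoid \<Rightarrow> bool" where
  "right_cancellative A \<longleftrightarrow> (\<forall>a\<in>carrier A. \<forall>b\<in>carrier A. \<forall>c\<in>carrier A.
     a \<otimes>\<^bsub>A\<^esub> c = b \<otimes>\<^bsub>A\<^esub> c \<longrightarrow> a = b)"

text \<open>Universal properties in the category of monoids. The test monoids are those carried by
  the type of the middle object \<open>X\<close>. Below this type is always \<open>'u\<close>, so these are exactly the
  objects of the universe.\<close>

definition is_kernel ::
  "'k monoid \<Rightarrow> ('k \<Rightarrow> 'x) \<Rightarrow> 'x monoid \<Rightarrow> ('x \<Rightarrow> 'm) \<Rightarrow> 'm monoid \<Rightarrow> bool" where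
  "is_kernel K k X f M \<longleftrightarrow>
     k \<in> mon_hom K X \<and> compose (carrier K) f k = zero_hom K M \<and>
     (\<forall>(Z :: 'x monoid) g. monoid Z \<and> g \<in> mon_hom Z X \<and>
          compose (carrier Z) f g = zero_hom Z M \<longrightarrow>
        (\<exists>!h. h \<in> mon_hom Z K \<and> compose (carrier Z) k h = g))"

definition is_cokernel ::
  "'k monoid \<Rightarrow> ('k \<Rightarrow> 'x) \<Rightarrow> 'x monoid \<Rightarrow> ('x \<Rightarrow> 'm) \<Rightarrow> 'm monoid \<Rightarrow> bool" where
  "is_cokernel K k X f M \<longleftrightarrow>
     f \<in> mon_hom X M \<and> compose (carrier K) f k = zero_hom K M \<and>
     (\<forall>(Z :: 'x monoid) g. monoid Z \<and> g \<in> mon_hom X Z \<and>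
          compose (carrier K) g k = zero_hom K Z \<longrightarrow>
        (\<exists>!h. h \<in> mon_hom M Z \<and> compose (carrier X) h f = g))"

text \<open>The canonical kernel of \<open>f : X \<rightarrow> M\<close>, a submonoid of \<open>X\<close> with the inclusion.\<close>

definition kernel_obj :: "'x monoid \<Rightarrow> ('x \<Rightarrow> 'm) \<Rightarrow> 'm monoid \<Rightarrow> 'x monoid" where
  "kernel_obj X f M = X\<lparr>carrier := kernel X M f\<rparr>"

section \<open>Schreier extensions\<close>

record ('k, 'x, 'm) extn =
  kern :: "'k monoid"
  kmap :: "'k \<Rightarrow> 'x"
  total :: "'x monoid"
  proj :: "'x \<Rightarrow> 'm"
  base :: "'m monoid"

definition short_exact :: "('k, 'x, 'm) extn \<Rightarrow> bool" where
  "short_exact E \<longleftrightarrow> monoid (kern E) \<and> monoid (total E) \<and> monoid (base E) \<and>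
     kmap E \<in> mon_hom (kern E) (total E) \<and> proj E \<in> mon_hom (total E) (base E) \<and>
     is_kernel (kern E) (kmap E) (total E) (proj E) (base E) \<and>
     is_cokernel (kern E) (kmap E) (total E) (proj E) (base E)"

definition representative :: "('k, 'x, 'm) extn \<Rightarrow> 'm \<Rightarrow> 'x \<Rightarrow> bool" where
  "representative E m u \<longleftrightarrow> u \<in> carrier (total E) \<and> proj E u = m \<and>
     (\<forall>x\<in>carrier (total E). proj E x = m \<longrightarrow>
        (\<exists>!a. a \<in> carrier (kern E) \<and> x = kmap E a \<otimes>\<^bsub>total E\<^esub> u))"

definition schreier_extension :: "('k, 'x, 'm) extn \<Rightarrow> bool" where
  "schreier_extension E \<longleftrightarrow>
     short_exact E \<and> (\<forall>m\<in>carrier (base E). \<exists>u. representative E m u)"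

definition schreier_morphism :: "('k, 'x, 'm) extn \<Rightarrow> ('l, 'y, 'n) extn \<Rightarrow>
    ('k \<Rightarrow> 'l) \<Rightarrow> ('x \<Rightarrow> 'y) \<Rightarrow> ('m \<Rightarrow> 'n) \<Rightarrow> bool" where
  "schreier_morphism E L g h l \<longleftrightarrow>
     g \<in> mon_hom (kern E) (kern L) \<and> h \<in> mon_hom (total E) (total L) \<and>
     l \<in> mon_hom (base E) (base L) \<and>
     compose (carrier (kern E)) h (kmap E) = compose (carrier (kern E)) (kmap L) g \<and>
     compose (carrier (total E)) (proj L) h = compose (carrier (total E)) l (proj E) \<and>
     (\<forall>m\<in>carrier (base E). \<forall>u. representative E m u \<longrightarrow> representative L (l m) (h u))"

definition cc_SExt :: "'m monoid \<Rightarrow> ('k, 'x, 'm) extn set" where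
  "cc_SExt M = {E. schreier_extension E \<and> base E = M \<and> comm_monoid_cancel (kern E)}"

text \<open>A morphism over the base is given by its middle component; the kernel component is
  uniquely determined by it.\<close>

definition cc_morphism :: "('k, 'x, 'm) extn \<Rightarrow> ('l, 'y, 'm) extn \<Rightarrow> ('x \<Rightarrow> 'y) \<Rightarrow> bool" where
  "cc_morphism E L h \<longleftrightarrow> base E = base L \<and> (\<exists>g. schreier_morphism E L g h (mon_id (base E)))"

definition rel_monoid :: "('k, 'x, 'm) extn \<Rightarrow> ('x \<times> 'x) monoid" where
  "rel_monoid E = (total E \<times>\<times> total E)
     \<lparr>carrier := {(x, y). x \<in> carrier (total E) \<and> y \<in> carrier (total E) \<and>
        (\<exists>a\<in>carrier (kern E). y = kmap E a \<otimes>\<^bsub>total E\<^esub> x)}\<rparr>"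

text \<open>The sequence \<open>K[f] \<rightarrow> X \<rightarrow> M\<close> attached to a homomorphism \<open>f\<close>.\<close>

definition hom_extn :: "'x monoid \<Rightarrow> ('x \<Rightarrow> 'm) \<Rightarrow> 'm monoid \<Rightarrow> ('x, 'x, 'm) extn" where
  "hom_extn X f M =
     \<lparr>kern = kernel_obj X f M, kmap = mon_id (kernel_obj X f M), total = X, proj = f, base = M\<rparr>"

section \<open>Full Schreier internal categories\<close>

text \<open>\<open>(x, y)\<close> is composable if \<open>x\<close> is followed by \<open>y\<close>.\<close>

definition composables :: "'x monoid \<Rightarrow> ('x \<Rightarrow> 'y) \<Rightarrow> ('x \<Rightarrow> 'y) \<Rightarrow> ('x \<times> 'x) monoid" where
  "composables X1 d c = (X1 \<times>\<times> X1)
     \<lparr>carrier := {(x, y). x \<in> carrier X1 \<and> y \<in> carrier X1 \<and> c x = d y}\<rparr>"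

definition internal_category :: "'x monoid \<Rightarrow> 'y monoid \<Rightarrow> ('x \<Rightarrow> 'y) \<Rightarrow> ('x \<Rightarrow> 'y) \<Rightarrow>
    ('y \<Rightarrow> 'x) \<Rightarrow> ('x \<times> 'x \<Rightarrow> 'x) \<Rightarrow> bool" where
  "internal_category X1 X0 d c e m \<longleftrightarrow> monoid X1 \<and> monoid X0 \<and>
     d \<in> mon_hom X1 X0 \<and> c \<in> mon_hom X1 X0 \<and> e \<in> mon_hom X0 X1 \<and>
     m \<in> mon_hom (composables X1 d c) X1 \<and>
     (\<forall>x\<in>carrier X0. d (e x) = x \<and> c (e x) = x) \<and>
     (\<forall>(x, y)\<in>carrier (composables X1 d c). d (m (x, y)) = d x \<and> c (m (x, y)) = c y) \<and>
     (\<forall>x\<in>carrier X1. m (e (d x), x) = x \<and> m (x, e (c x)) = x) \<and>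
     (\<forall>x\<in>carrier X1. \<forall>y\<in>carrier X1. \<forall>z\<in>carrier X1. c x = d y \<and> c y = d z \<longrightarrow>
        m (m (x, y), z) = m (x, m (y, z)))"

definition schreier_internal_category :: "'x monoid \<Rightarrow> 'y monoid \<Rightarrow> ('x \<Rightarrow> 'y) \<Rightarrow> ('x \<Rightarrow> 'y) \<Rightarrow>
    ('y \<Rightarrow> 'x) \<Rightarrow> ('x \<times> 'x \<Rightarrow> 'x) \<Rightarrow> bool" where
  "schreier_internal_category X1 X0 d c e m \<longleftrightarrow> internal_category X1 X0 d c e m \<and>
     (\<forall>x\<in>carrier X1. \<exists>!a. a \<in> carrier (kernel_obj X1 d X0) \<and> x = a \<otimes>\<^bsub>X1\<^esub> e (d x))"

record 'u scat =
  ext1 :: "('u, 'u, 'u) extn"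
  ext0 :: "('u, 'u, 'u) extn"
  src :: "'u \<Rightarrow> 'u"
  tgt :: "'u \<Rightarrow> 'u"
  idn :: "'u \<Rightarrow> 'u"
  cmp :: "'u \<times> 'u \<Rightarrow> 'u"

abbreviation arrs :: "'u scat \<Rightarrow> 'u monoid" where
  "arrs E \<equiv> total (ext1 E)"

abbreviation objs :: "'u scat \<Rightarrow> 'u monoid" where
  "objs E \<equiv> total (ext0 E)"

text \<open>The equations \<open>f\<^sub>0 d = f\<^sub>1 = f\<^sub>0 c\<close> and \<open>f\<^sub>1 e = f\<^sub>0\<close> are part of \<^const>\<open>cc_morphism\<close>.\<close>

definition schreier_cat_in_cc :: "'u monoid \<Rightarrow> 'u scat \<Rightarrow> bool" where
  "schreier_cat_in_cc M E \<longleftrightarrow> ext1 E \<in> cc_SExt M \<and> ext0 E \<in> cc_SExt M \<and>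
     schreier_internal_category (arrs E) (objs E) (src E) (tgt E) (idn E) (cmp E) \<and>
     cc_morphism (ext1 E) (ext0 E) (src E) \<and> cc_morphism (ext1 E) (ext0 E) (tgt E) \<and>
     cc_morphism (ext0 E) (ext1 E) (idn E)"

text \<open>The sequence with cokernel part \<open>\<langle>d, c\<rangle> : X\<^sub>1 \<rightarrow> R_E\<close>, where \<open>E\<close> is \<open>ext0\<close>.\<close>

definition dc_extn :: "'u scat \<Rightarrow> ('u, 'u, 'u \<times> 'u) extn" where
  "dc_extn E = hom_extn (arrs E) (\<lambda>x\<in>carrier (arrs E). (src E x, tgt E x)) (rel_monoid (ext0 E))"

definition R_full :: "'u scat \<Rightarrow> bool" where
  "R_full E \<longleftrightarrow> schreier_extension (dc_extn E)"

definition internal_functor :: "'u scat \<Rightarrow> 'u scat \<Rightarrow> ('u \<Rightarrow> 'u) \<Rightarrow> ('u \<Rightarrow> 'u) \<Rightarrow> bool" where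
  "internal_functor E L h1 h0 \<longleftrightarrow>
     h1 \<in> mon_hom (arrs E) (arrs L) \<and> h0 \<in> mon_hom (objs E) (objs L) \<and>
     (\<forall>x\<in>carrier (arrs E). src L (h1 x) = h0 (src E x) \<and> tgt L (h1 x) = h0 (tgt E x)) \<and>
     (\<forall>x\<in>carrier (objs E). h1 (idn E x) = idn L (h0 x)) \<and>
     (\<forall>(x, y)\<in>carrier (composables (arrs E) (src E) (tgt E)).
        h1 (cmp E (x, y)) = cmp L (h1 x, h1 y))"

definition rel_map :: "'u scat \<Rightarrow> ('u \<Rightarrow> 'u) \<Rightarrow> 'u \<times> 'u \<Rightarrow> 'u \<times> 'u" where
  "rel_map E h0 = (\<lambda>(x, y)\<in>carrier (rel_monoid (ext0 E)). (h0 x, h0 y))"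

definition RSCat_hom :: "'u scat \<Rightarrow> 'u scat \<Rightarrow> (('u \<Rightarrow> 'u) \<times> ('u \<Rightarrow> 'u)) set" where
  "RSCat_hom E L = {(h1, h0). internal_functor E L h1 h0 \<and>
     cc_morphism (ext1 E) (ext1 L) h1 \<and> cc_morphism (ext0 E) (ext0 L) h0 \<and>
     (\<exists>g. schreier_morphism (dc_extn E) (dc_extn L) g h1 (rel_map E h0))}"

definition RSCat :: "'u monoid \<Rightarrow> ('u scat, ('u \<Rightarrow> 'u) \<times> ('u \<Rightarrow> 'u)) cat" where
  "RSCat M =
     \<lparr>Obj = {E. schreier_cat_in_cc M E \<and> R_full E},
      Hom = RSCat_hom,
      Id = (\<lambda>E. (mon_id (arrs E), mon_id (objs E))),
      Comp = (\<lambda>E L P (g1, g0) (h1, h0).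
        (compose (carrier (arrs E)) g1 h1, compose (carrier (objs E)) g0 h0))\<rparr>"

section \<open>Crossed Schreier extensions\<close>

definition crossed_semimodule ::
  "'b monoid \<Rightarrow> 'c monoid \<Rightarrow> ('b \<Rightarrow> 'c) \<Rightarrow> ('c \<Rightarrow> 'b \<Rightarrow> 'b) \<Rightarrow> bool" where
  "crossed_semimodule B C \<delta> \<alpha> \<longleftrightarrow> monoid B \<and> monoid C \<and>
     \<delta> \<in> mon_hom B C \<and> \<alpha> \<in> mon_hom C (End_monoid B) \<and>
     (\<forall>c\<in>carrier C. \<forall>b\<in>carrier B. \<delta> (\<alpha> c b) \<otimes>\<^bsub>C\<^esub> c = c \<otimes>\<^bsub>C\<^esub> \<delta> b) \<and>
     (\<forall>b1\<in>carrier B. \<forall>b2\<in>carrier B. \<alpha> (\<delta> b1) b2 \<otimes>\<^bsub>B\<^esub> b1 = b1 \<otimes>\<^bsub>B\<^esub> b2)"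

definition crossed_morphism ::
  "'b monoid \<Rightarrow> 'c monoid \<Rightarrow> ('b \<Rightarrow> 'c) \<Rightarrow> ('c \<Rightarrow> 'b \<Rightarrow> 'b) \<Rightarrow>
   'd monoid \<Rightarrow> 'e monoid \<Rightarrow> ('d \<Rightarrow> 'e) \<Rightarrow> ('e \<Rightarrow> 'd \<Rightarrow> 'd) \<Rightarrow> ('b \<Rightarrow> 'd) \<Rightarrow> ('c \<Rightarrow> 'e) \<Rightarrow> bool" where
  "crossed_morphism B C \<delta> \<alpha> B' C' \<delta>' \<alpha>' \<phi> \<psi> \<longleftrightarrow>
     \<phi> \<in> mon_hom B B' \<and> \<psi> \<in> mon_hom C C' \<and>
     (\<forall>b\<in>carrier B. \<delta>' (\<phi> b) = \<psi> (\<delta> b)) \<and>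
     (\<forall>c\<in>carrier C. \<forall>b\<in>carrier B. \<phi> (\<alpha> c b) = \<alpha>' (\<psi> c) (\<phi> b))"

text \<open>The sequence \<open>A \<rightarrow> B \<rightarrow> C \<rightarrow> M\<close> (maps \<open>k\<close>, \<open>\<delta>\<close>, \<open>\<pi>\<close>) with its action; \<open>M\<close> is fixed.\<close>

record 'u xext =
  objA :: "'u monoid"
  mapk :: "'u \<Rightarrow> 'u"
  objB :: "'u monoid"
  delta :: "'u \<Rightarrow> 'u"
  objC :: "'u monoid"
  mappi :: "'u \<Rightarrow> 'u"
  act :: "'u \<Rightarrow> 'u \<Rightarrow> 'u"

text \<open>The factorisation of \<open>\<delta>\<close> is taken through its image \<open>N \<subseteq> C\<close>: \<open>\<nu>\<close> is the inclusion, and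
  \<open>\<rho>\<close> is \<open>\<delta>\<close> regarded as a map to \<open>N\<close>.\<close>

definition objN :: "'u xext \<Rightarrow> 'u monoid" where
  "objN X = (objC X)\<lparr>carrier := delta X ` carrier (objB X)\<rparr>"

definition right_extn :: "'u monoid \<Rightarrow> 'u xext \<Rightarrow> ('u, 'u, 'u) extn" where
  "right_extn M X =
     \<lparr>kern = objN X, kmap = mon_id (objN X), total = objC X, proj = mappi X, base = M\<rparr>"

definition left_extn :: "'u xext \<Rightarrow> ('u, 'u, 'u) extn" where
  "left_extn X =
     \<lparr>kern = objA X, kmap = mapk X, total = objB X, proj = delta X, base = objN X\<rparr>"

definition crossed_schreier_extension :: "'u monoid \<Rightarrow> 'u xext \<Rightarrow> bool" where
  "crossed_schreier_extension M X \<longleftrightarrow>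
     monoid (objA X) \<and> monoid M \<and>
     crossed_semimodule (objB X) (objC X) (delta X) (act X) \<and>
     is_kernel (objA X) (mapk X) (objB X) (delta X) (objC X) \<and>
     is_cokernel (objB X) (delta X) (objC X) (mappi X) M \<and>
     right_cancellative (objN X) \<and> schreier_extension (right_extn M X) \<and>
     right_cancellative (objA X) \<and> schreier_extension (left_extn X)"

text \<open>The kernel component in the left square is the map induced by \<open>\<phi>\<close>, since it is uniquely
  determined by commutativity; the map induced by \<open>\<psi>\<close> on \<open>N\<close> is its restriction.\<close>

definition XSExt_hom :: "'u monoid \<Rightarrow> 'u xext \<Rightarrow> 'u xext \<Rightarrow> (('u \<Rightarrow> 'u) \<times> ('u \<Rightarrow> 'u)) set" where
  "XSExt_hom M X Y = {(\<phi>, \<psi>).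
     crossed_morphism (objB X) (objC X) (delta X) (act X)
       (objB Y) (objC Y) (delta Y) (act Y) \<phi> \<psi> \<and>
     compose (carrier (objC X)) (mappi Y) \<psi> = mappi X \<and>
     (\<exists>\<phi>s. schreier_morphism (left_extn X) (left_extn Y) \<phi>s \<phi>
              (restrict \<psi> (carrier (objN X)))) \<and>
     schreier_morphism (right_extn M X) (right_extn M Y)
       (restrict \<psi> (carrier (objN X))) \<psi> (mon_id M)}"

definition com_XSExt :: "'u monoid \<Rightarrow> ('u xext, ('u \<Rightarrow> 'u) \<times> ('u \<Rightarrow> 'u)) cat" where
  "com_XSExt M =
     \<lparr>Obj = {X. crossed_schreier_extension M X \<and> comm_monoid (objB X)},
      Hom = XSExt_hom M,
      Id = (\<lambda>X. (mon_id (objB X), mon_id (objC X))),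
      Comp = (\<lambda>X Y Z (\<phi>', \<psi>') (\<phi>, \<psi>).
        (compose (carrier (objB X)) \<phi>' \<phi>, compose (carrier (objC X)) \<psi>' \<psi>))\<rparr>"

section \<open>The functor F\<close>

definition F_B :: "'u scat \<Rightarrow> 'u monoid" where
  "F_B E = kernel_obj (arrs E) (src E) (objs E)"

definition F_delta :: "'u scat \<Rightarrow> 'u \<Rightarrow> 'u" where
  "F_delta E = restrict (tgt E) (carrier (F_B E))"

definition F_act :: "'u scat \<Rightarrow> 'u \<Rightarrow> 'u \<Rightarrow> 'u" where
  "F_act E = (\<lambda>x\<in>carrier (objs E). \<lambda>a\<in>carrier (F_B E).
     THE a'. a' \<in> carrier (F_B E) \<and> idn E x \<otimes>\<^bsub>arrs E\<^esub> a = a' \<otimes>\<^bsub>arrs E\<^esub> idn E x)"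

definition F_obj :: "'u scat \<Rightarrow> 'u xext" where
  "F_obj E =
     \<lparr>objA = kernel_obj (F_B E) (F_delta E) (objs E),
      mapk = mon_id (kernel_obj (F_B E) (F_delta E) (objs E)),
      objB = F_B E, delta = F_delta E, objC = objs E, mappi = proj (ext0 E), act = F_act E\<rparr>"

definition F_funct ::
  "('u scat, ('u \<Rightarrow> 'u) \<times> ('u \<Rightarrow> 'u), 'u xext, ('u \<Rightarrow> 'u) \<times> ('u \<Rightarrow> 'u)) funct" where
  "F_funct = \<lparr>fobj = F_obj, farr = (\<lambda>E L (h1, h0). (restrict h1 (carrier (F_B E)), h0))\<rparr>"

section \<open>The functor G\<close>

text \<open>The functor \<open>G\<close> forms monoids on sets of pairs, and the universe \<open>'u\<close> has to be closed
  under this. So \<open>G\<close> depends on an injection \<open>pr : 'u \<times> 'u \<rightarrow> 'u\<close>, along which monoids of pairs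
  are transported.\<close>

abbreviation decode :: "('u \<times> 'u \<Rightarrow> 'u) \<Rightarrow> 'u \<Rightarrow> 'u \<times> 'u" where
  "decode pr \<equiv> inv_into UNIV pr"

definition encode :: "('u \<times> 'u \<Rightarrow> 'u) \<Rightarrow> ('u \<times> 'u) monoid \<Rightarrow> 'u monoid" where
  "encode pr S =
     \<lparr>carrier = pr ` carrier S, mult = (\<lambda>x y. pr (decode pr x \<otimes>\<^bsub>S\<^esub> decode pr y)), one = pr \<one>\<^bsub>S\<^esub>\<rparr>"

definition semidirect :: "'b monoid \<Rightarrow> 'c monoid \<Rightarrow> ('c \<Rightarrow> 'b \<Rightarrow> 'b) \<Rightarrow> ('b \<times> 'c) monoid" where
  "semidirect B C \<alpha> =
     \<lparr>carrier = carrier B \<times> carrier C,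
      mult = (\<lambda>(b, c) (b', c'). (b \<otimes>\<^bsub>B\<^esub> \<alpha> c b', c \<otimes>\<^bsub>C\<^esub> c')),
      one = (\<one>\<^bsub>B\<^esub>, \<one>\<^bsub>C\<^esub>)\<rparr>"

definition G_arrs :: "('u \<times> 'u \<Rightarrow> 'u) \<Rightarrow> 'u xext \<Rightarrow> 'u monoid" where
  "G_arrs pr X = encode pr (semidirect (objB X) (objC X) (act X))"

definition G_src :: "('u \<times> 'u \<Rightarrow> 'u) \<Rightarrow> 'u xext \<Rightarrow> 'u \<Rightarrow> 'u" where
  "G_src pr X = (\<lambda>x\<in>carrier (G_arrs pr X). case decode pr x of (b, c) \<Rightarrow> c)"

definition G_tgt :: "('u \<times> 'u \<Rightarrow> 'u) \<Rightarrow> 'u xext \<Rightarrow> 'u \<Rightarrow> 'u" where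
  "G_tgt pr X = (\<lambda>x\<in>carrier (G_arrs pr X). case decode pr x of (b, c) \<Rightarrow> delta X b \<otimes>\<^bsub>objC X\<^esub> c)"

definition G_idn :: "('u \<times> 'u \<Rightarrow> 'u) \<Rightarrow> 'u xext \<Rightarrow> 'u \<Rightarrow> 'u" where
  "G_idn pr X = (\<lambda>c\<in>carrier (objC X). pr (\<one>\<^bsub>objB X\<^esub>, c))"

definition G_cmp :: "('u \<times> 'u \<Rightarrow> 'u) \<Rightarrow> 'u xext \<Rightarrow> 'u \<times> 'u \<Rightarrow> 'u" where
  "G_cmp pr X = (\<lambda>(x, y)\<in>carrier (composables (G_arrs pr X) (G_src pr X) (G_tgt pr X)).
     case (decode pr x, decode pr y) of ((b1, c), (b2, c')) \<Rightarrow> pr (b2 \<otimes>\<^bsub>objB X\<^esub> b1, c))"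

definition G_ext1 :: "('u \<times> 'u \<Rightarrow> 'u) \<Rightarrow> 'u monoid \<Rightarrow> 'u xext \<Rightarrow> ('u, 'u, 'u) extn" where
  "G_ext1 pr M X =
     \<lparr>kern = encode pr (objB X \<times>\<times> objN X),
      kmap = (\<lambda>x\<in>carrier (encode pr (objB X \<times>\<times> objN X)).
        case decode pr x of (b, n) \<Rightarrow> pr (b, mon_id (objN X) n)),
      total = G_arrs pr X,
      proj = compose (carrier (G_arrs pr X)) (mappi X) (G_src pr X),
      base = M\<rparr>"

definition G_obj :: "('u \<times> 'u \<Rightarrow> 'u) \<Rightarrow> 'u monoid \<Rightarrow> 'u xext \<Rightarrow> 'u scat" where
  "G_obj pr M X =
     \<lparr>ext1 = G_ext1 pr M X, ext0 = right_extn M X,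
      src = G_src pr X, tgt = G_tgt pr X, idn = G_idn pr X, cmp = G_cmp pr X\<rparr>"

definition G_funct :: "('u \<times> 'u \<Rightarrow> 'u) \<Rightarrow> 'u monoid \<Rightarrow>
    ('u xext, ('u \<Rightarrow> 'u) \<times> ('u \<Rightarrow> 'u), 'u scat, ('u \<Rightarrow> 'u) \<times> ('u \<Rightarrow> 'u)) funct" where
  "G_funct pr M =
     \<lparr>fobj = G_obj pr M,
      farr = (\<lambda>X Y (\<phi>, \<psi>).
        ((\<lambda>x\<in>carrier (G_arrs pr X). case decode pr x of (b, c) \<Rightarrow> pr (\<phi> b, \<psi> c)), \<psi>))\<rparr>"

end

theory Submission
  imports Defs
begin

text \<open>
  In a Schreier extension the kernel object is identified with the set-theoretic kernel, so a
  morphism of such extensions is just a commutative square that preserves representatives; the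
  kernel component comes for free. Since two representatives of one element differ by a unit of the
  kernel, preservation need only be tested on one representative per fibre, and it is automatic
  for bijective homomorphisms.

  For \<open>F\<close>, every element of \<open>K[d]\<close> lies in the kernel of \<open>f\<^sub>1\<close>, hence \<open>B\<close> is commutative and
  cancellative; the Peiffer identity is the interchange law, and fullness over pairs \<open>(0, n)\<close> makes
  the image of \<open>\<delta>\<close> the whole kernel of \<open>f\<^sub>0\<close>. For \<open>G\<close>, the extension \<open>A \<rightarrow> B \<rightarrow> N\<close> makes \<open>B\<close>
  cancellative, so that \<open>N\<close> acts trivially on \<open>B\<close> and \<open>B \<times> N\<close> is the kernel of the projection to
  \<open>M\<close>. The unit sends \<open>a + e(y)\<close> to \<open>(a, y)\<close>, and the counit sends \<open>(b, 0)\<close> to \<open>b\<close>.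
\<close>

section \<open>Representatives and Schreier extensions\<close>

text \<open>Commuting squares transport easily in both directions. The obstacle is that morphisms
  must also send representatives to representatives, for three extensions on the categorical side
  (over \<open>f1\<close>, \<open>f0\<close> and <d, c>) but for two on the crossed side (over
  \<open>\<delta>\<close> and \<open>\<pi>\<close>). The two lists agree for two reasons. The
  representatives for \<open>\<delta>\<close> in \<open>K[d]\<close> are exactly the representatives
  for <d, c> with domain 0. And in the semidirect product every fibre over M contains a
  representative (0, r), while every fibre of <d, c> contains a representative (v, c) with v a
  representative for \<open>\<delta>\<close>, so preservation is tested on these elements only. A
  second obstacle is that elements of C need not be cancellable. Cancellation is obtained by
  splitting off a representative: what is left lies in a cancellative kernel, and uniqueness of the
  decomposition does the rest. The universal properties are tested only against monoids on the type
  of the middle object. This is enough because the set-theoretic kernel is such a monoid, and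
  because the cokernel property follows from the existence of representatives.\<close>

lemma mon_hom_iff:
  "f \<in> mon_hom A B \<longleftrightarrow> (\<forall>x\<in>carrier A. f x \<in> carrier B) \<and>
     (\<forall>x\<in>carrier A. \<forall>y\<in>carrier A. f (x \<otimes>\<^bsub>A\<^esub> y) = f x \<otimes>\<^bsub>B\<^esub> f y) \<and> f \<one>\<^bsub>A\<^esub> = \<one>\<^bsub>B\<^esub> \<and>
     f \<in> extensional (carrier A)"
  by (auto simp: mon_hom_def hom_def)

lemma mon_homI:
  assumes "\<And>x. x \<in> carrier A \<Longrightarrow> f x \<in> carrier B"
    and "\<And>x y. x \<in> carrier A \<Longrightarrow> y \<in> carrier A \<Longrightarrow> f (x \<otimes>\<^bsub>A\<^esub> y) = f x \<otimes>\<^bsub>B\<^esub> f y"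
    and "f \<one>\<^bsub>A\<^esub> = \<one>\<^bsub>B\<^esub>" and "f \<in> extensional (carrier A)"
  shows "f \<in> mon_hom A B"
  using assms by (simp add: mon_hom_iff)

lemma mon_homD:
  assumes "f \<in> mon_hom A B"
  shows "x \<in> carrier A \<Longrightarrow> f x \<in> carrier B"
    and "x \<in> carrier A \<Longrightarrow> y \<in> carrier A \<Longrightarrow> f (x \<otimes>\<^bsub>A\<^esub> y) = f x \<otimes>\<^bsub>B\<^esub> f y"
    and "f \<one>\<^bsub>A\<^esub> = \<one>\<^bsub>B\<^esub>" and "f \<in> extensional (carrier A)"
  using assms by (auto simp: mon_hom_iff)

lemma mon_hom_imp_hom: "f \<in> mon_hom A B \<Longrightarrow> f \<in> hom A B"
  by (simp add: mon_hom_def)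

lemma mon_hom_eqI:
  assumes "f \<in> mon_hom A B" and "g \<in> extensional (carrier A)"
    and "\<And>x. x \<in> carrier A \<Longrightarrow> f x = g x"
  shows "f = g"
  using assms by (intro extensionalityI[of f "carrier A" g]) (auto simp: mon_hom_iff)

lemma mon_id_apply [simp]: "x \<in> carrier A \<Longrightarrow> mon_id A x = x"
  by (simp add: mon_id_def)

lemma mon_id_hom: "monoid A \<Longrightarrow> mon_id A \<in> mon_hom A A"
  by (rule mon_homI) (auto simp: mon_id_def monoid.m_closed monoid.one_closed)

lemma mon_hom_compose:
  assumes "f \<in> mon_hom A B" and "g \<in> mon_hom B D" and "monoid A"
  shows "compose (carrier A) g f \<in> mon_hom A D"
  using assms
  by (intro mon_homI)
    (auto simp: compose_def mon_hom_iff monoid.m_closed monoid.one_closed)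

lemma compose_mon_id_right:
  "f \<in> mon_hom A B \<Longrightarrow> compose (carrier A) f (mon_id A) = f"
  by (rule sym, rule mon_hom_eqI) (auto simp: compose_def)

lemma compose_mon_id_left:
  "f \<in> mon_hom A B \<Longrightarrow> compose (carrier A) (mon_id B) f = f"
  by (rule sym, rule mon_hom_eqI) (auto simp: compose_def mon_homD)

lemma compose_assoc_mon_hom:
  "f \<in> mon_hom A B \<Longrightarrow>
    compose (carrier A) h (compose (carrier A) g f) = compose (carrier A) (compose (carrier B) h g) f"
  by (auto simp: compose_def mon_homD fun_eq_iff)

text \<open>\<open>inv_into\<close> is defined on the whole type, so the inverse is cut down to the
  carrier; only then is it a morphism in the extensional sense.\<close>

lemma mon_hom_inv:
  assumes f: "f \<in> mon_hom A B" and bij: "bij_betw f (carrier A) (carrier B)"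
    and A: "monoid A" and B: "monoid B"
  defines "g \<equiv> \<lambda>y\<in>carrier B. inv_into (carrier A) f y"
  shows "g \<in> mon_hom B A"
    and "bij_betw g (carrier B) (carrier A)"
    and "\<And>x. x \<in> carrier A \<Longrightarrow> g (f x) = x"
    and "\<And>y. y \<in> carrier B \<Longrightarrow> f (g y) = y"
proof -
  show gf: "\<And>x. x \<in> carrier A \<Longrightarrow> g (f x) = x"
    using bij f by (auto simp: g_def bij_betw_def mon_homD)
  show fg: "\<And>y. y \<in> carrier B \<Longrightarrow> f (g y) = y"
    using bij by (auto simp: g_def bij_betw_inv_into_right)
  have gc: "\<And>y. y \<in> carrier B \<Longrightarrow> g y \<in> carrier A"
    using bij by (auto simp: g_def bij_betw_def inv_into_into)
  show "g \<in> mon_hom B A"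
  proof (rule mon_homI)
    fix x y assume xy: "x \<in> carrier B" "y \<in> carrier B"
    have "g (x \<otimes>\<^bsub>B\<^esub> y) = g (f (g x) \<otimes>\<^bsub>B\<^esub> f (g y))" using xy fg by simp
    also have "\<dots> = g (f (g x \<otimes>\<^bsub>A\<^esub> g y))" using xy gc f by (simp add: mon_homD)
    also have "\<dots> = g x \<otimes>\<^bsub>A\<^esub> g y" using xy gc gf A by (simp add: monoid.m_closed)
    finally show "g (x \<otimes>\<^bsub>B\<^esub> y) = g x \<otimes>\<^bsub>A\<^esub> g y" .
  next
    show "g \<one>\<^bsub>B\<^esub> = \<one>\<^bsub>A\<^esub>"
      using gf[of "\<one>\<^bsub>A\<^esub>"] f A by (simp add: mon_homD monoid.one_closed)
  qed (auto simp: gc, simp add: g_def)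
  show "bij_betw g (carrier B) (carrier A)"
    by (rule bij_betw_byWitness[where f' = f]) (use gf fg gc f in \<open>auto simp: mon_homD\<close>)
qed

text \<open>\<open>srep X f u\<close> says that \<open>u\<close> is a representative of \<open>f u\<close>, with the kernel read off from \<open>X\<close>
  and \<open>f\<close> alone. Unlike \<^const>\<open>representative\<close> it does not mention the kernel map, so it depends only
  on the cokernel part of a sequence.\<close>

definition srep :: "('x, 'z) monoid_scheme \<Rightarrow> ('x \<Rightarrow> 'm) \<Rightarrow> 'x \<Rightarrow> bool" where
  "srep X f u \<longleftrightarrow> u \<in> carrier X \<and> (\<forall>x\<in>carrier X. f x = f u \<longrightarrow>
     (\<exists>!b. b \<in> carrier X \<and> f b = f \<one>\<^bsub>X\<^esub> \<and> x = b \<otimes>\<^bsub>X\<^esub> u))"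

lemma srep_closed: "srep X f u \<Longrightarrow> u \<in> carrier X"
  by (simp add: srep_def)

text \<open>The pairing <d, c> occurs both restricted to the carrier, as the projection of
  \<open>dc_extn\<close>, and unrestricted; this passes between the two forms.\<close>

lemma srep_cong:
  assumes "monoid X" and "\<And>x. x \<in> carrier X \<Longrightarrow> f x = g x"
  shows "srep X f u \<longleftrightarrow> srep X g u"
proof -
  have "f \<one>\<^bsub>X\<^esub> = g \<one>\<^bsub>X\<^esub>" using assms by (simp add: monoid.one_closed)
  then show ?thesis unfolding srep_def by (simp add: assms(2) cong: conj_cong)
qed

text \<open>Representatives of the same element differ by a unit of the kernel, so it suffices
  to test one of them in each fibre.\<close>

lemma srep_transfer:
  fixes X :: "('x, 'z) monoid_scheme" and Y :: "('y, 'w) monoid_scheme"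
  assumes X: "monoid X" and Y: "monoid Y"
    and f': "f' \<in> hom Y M'"
    and h: "h \<in> mon_hom X Y" and comm: "\<And>x. x \<in> carrier X \<Longrightarrow> f' (h x) = l (f x)"
    and f: "f \<in> hom X M"
    and u: "srep X f u" and v: "srep X f v" "f v = f u" and hv: "srep Y f' (h v)"
  shows "srep Y f' (h u)"
proof -
  interpret X: monoid X by fact
  interpret Y: monoid Y by fact
  have cu: "u \<in> carrier X" and cv: "v \<in> carrier X" using u v by (auto simp: srep_def)
  obtain a where a: "a \<in> carrier X" "f a = f \<one>\<^bsub>X\<^esub>" "u = a \<otimes>\<^bsub>X\<^esub> v"
    using v cu unfolding srep_def by metis
  obtain b where b: "b \<in> carrier X" "f b = f \<one>\<^bsub>X\<^esub>" "v = b \<otimes>\<^bsub>X\<^esub> u"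
    using u v cv unfolding srep_def by metis
  have f1: "f (a \<otimes>\<^bsub>X\<^esub> b) = f \<one>\<^bsub>X\<^esub>" "f (b \<otimes>\<^bsub>X\<^esub> a) = f \<one>\<^bsub>X\<^esub>"
    using a b hom_mult[OF f] by (metis X.one_closed X.r_one)+
  \<comment> \<open>Both b + a and 0 translate \<open>v\<close> to itself, so uniqueness at
    \<open>v\<close> identifies them; \<open>ab\<close> is the same argument at \<open>u\<close>.
    Hence \<open>a\<close> and \<open>b\<close> are mutually inverse.\<close>
  have ba: "b \<otimes>\<^bsub>X\<^esub> a = \<one>\<^bsub>X\<^esub>"
  proof -
    have "v = (b \<otimes>\<^bsub>X\<^esub> a) \<otimes>\<^bsub>X\<^esub> v" using a b cv by (metis X.m_assoc)
    moreover have "v = \<one>\<^bsub>X\<^esub> \<otimes>\<^bsub>X\<^esub> v" using cv by simp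
    ultimately show ?thesis using v(1) f1 a b cv unfolding srep_def by (metis X.m_closed X.one_closed)
  qed
  have ab: "a \<otimes>\<^bsub>X\<^esub> b = \<one>\<^bsub>X\<^esub>"
  proof -
    have "u = (a \<otimes>\<^bsub>X\<^esub> b) \<otimes>\<^bsub>X\<^esub> u" using a b cu by (metis X.m_assoc)
    moreover have "u = \<one>\<^bsub>X\<^esub> \<otimes>\<^bsub>X\<^esub> u" using cu by simp
    ultimately show ?thesis using u f1 a b cu unfolding srep_def by (metis X.m_closed X.one_closed)
  qed
  \<comment> \<open>From here on only \<open>Y\<close> matters: \<open>A\<close> and
    \<open>B\<close> are mutually inverse elements over \<open>f'\<close> of the neutral element,
    and they carry \<open>V\<close> to \<open>U\<close> and back.\<close>
  define A B U V where "A = h a" and "B = h b" and "U = h u" and "V = h v"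
  have c: "A \<in> carrier Y" "B \<in> carrier Y" "U \<in> carrier Y" "V \<in> carrier Y"
    using a b cu cv h by (auto simp: A_def B_def U_def V_def mon_homD)
  have AB: "A \<otimes>\<^bsub>Y\<^esub> B = \<one>\<^bsub>Y\<^esub>" "B \<otimes>\<^bsub>Y\<^esub> A = \<one>\<^bsub>Y\<^esub>"
    using ab ba a b h unfolding A_def B_def by (metis mon_homD(2,3))+
  have UV: "U = A \<otimes>\<^bsub>Y\<^esub> V" "V = B \<otimes>\<^bsub>Y\<^esub> U"
    using a b cu cv h unfolding A_def B_def U_def V_def by (metis mon_homD(2))+
  have fA: "f' A = f' \<one>\<^bsub>Y\<^esub>" "f' B = f' \<one>\<^bsub>Y\<^esub>"
    using a b comm h unfolding A_def B_def by (metis X.one_closed mon_homD(3))+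
  have fU: "f' U = f' V" using v comm cu cv by (simp add: U_def V_def)
  have *: "f' (p \<otimes>\<^bsub>Y\<^esub> A) = f' \<one>\<^bsub>Y\<^esub>" "f' (p \<otimes>\<^bsub>Y\<^esub> B) = f' \<one>\<^bsub>Y\<^esub>"
    if "p \<in> carrier Y" "f' p = f' \<one>\<^bsub>Y\<^esub>" for p
    using that c fA hom_mult[OF f'] by (metis Y.one_closed Y.r_one)+
  have "srep Y f' U" unfolding srep_def
  proof (intro conjI ballI impI)
    fix x assume x: "x \<in> carrier Y" "f' x = f' U"
    obtain p where p: "p \<in> carrier Y" "f' p = f' \<one>\<^bsub>Y\<^esub>" "x = p \<otimes>\<^bsub>Y\<^esub> V"
      using hv x fU unfolding srep_def V_def by metis
    show "\<exists>!b. b \<in> carrier Y \<and> f' b = f' \<one>\<^bsub>Y\<^esub> \<and> x = b \<otimes>\<^bsub>Y\<^esub> U"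
    proof (rule ex1I[of _ "p \<otimes>\<^bsub>Y\<^esub> B"])
      show "p \<otimes>\<^bsub>Y\<^esub> B \<in> carrier Y \<and> f' (p \<otimes>\<^bsub>Y\<^esub> B) = f' \<one>\<^bsub>Y\<^esub> \<and> x = (p \<otimes>\<^bsub>Y\<^esub> B) \<otimes>\<^bsub>Y\<^esub> U"
        using p c * UV by (metis Y.m_assoc Y.m_closed)
    next
      fix q assume q: "q \<in> carrier Y \<and> f' q = f' \<one>\<^bsub>Y\<^esub> \<and> x = q \<otimes>\<^bsub>Y\<^esub> U"
      then have "x = (q \<otimes>\<^bsub>Y\<^esub> A) \<otimes>\<^bsub>Y\<^esub> V" using c UV by (metis Y.m_assoc)
      then have "q \<otimes>\<^bsub>Y\<^esub> A = p" using hv p q x fU c * unfolding srep_def V_def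
        by (metis V_def Y.m_closed)
      then show "q = p \<otimes>\<^bsub>Y\<^esub> B" using q c AB by (metis Y.m_assoc Y.r_one)
    qed
  qed (use c in auto)
  then show ?thesis by (simp add: U_def)
qed

text \<open>\<open>srep\<close> is built from the carrier, the addition and the relation of having
  equal values under \<open>f\<close>, so a bijective homomorphism that respects fibres in both
  directions transports it. The map \<open>l\<close> of bases need only separate values that
  \<open>f\<close> attains.\<close>

lemma srep_bij:
  assumes X: "monoid X" and h: "h \<in> mon_hom X Y" and bij: "bij_betw h (carrier X) (carrier Y)"
    and comm: "\<And>x. x \<in> carrier X \<Longrightarrow> f' (h x) = l (f x)"
    and inj: "\<And>x y. x \<in> carrier X \<Longrightarrow> y \<in> carrier X \<Longrightarrow> l (f x) = l (f y) \<Longrightarrow> f x = f y"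
    and u: "srep X f u"
  shows "srep Y f' (h u)"
proof -
  interpret X: monoid X by fact
  have cu: "u \<in> carrier X" using u by (simp add: srep_def)
  have one: "h \<one>\<^bsub>X\<^esub> = \<one>\<^bsub>Y\<^esub>" using h by (simp add: mon_homD)
  have eq: "f' (h x) = f' (h y) \<longleftrightarrow> f x = f y" if "x \<in> carrier X" "y \<in> carrier X" for x y
    using comm inj that by metis
  have sur: "\<exists>x\<in>carrier X. y = h x" if "y \<in> carrier Y" for y
    using bij that by (auto simp: bij_betw_def)
  have inj': "h x = h y \<longleftrightarrow> x = y" if "x \<in> carrier X" "y \<in> carrier X" for x y
    using bij that by (auto simp: bij_betw_def inj_on_def)
  show ?thesis unfolding srep_def
  proof (intro conjI ballI impI)
    show "h u \<in> carrier Y" using cu h by (simp add: mon_homD)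
    fix y assume "y \<in> carrier Y" and fy: "f' y = f' (h u)"
    then obtain x where x: "x \<in> carrier X" "y = h x" using sur by metis
    then have "f x = f u" using eq fy cu by simp
    then obtain b where b: "b \<in> carrier X" "f b = f \<one>\<^bsub>X\<^esub>" "x = b \<otimes>\<^bsub>X\<^esub> u"
      and b_unique: "\<And>b'. b' \<in> carrier X \<Longrightarrow> f b' = f \<one>\<^bsub>X\<^esub> \<Longrightarrow> x = b' \<otimes>\<^bsub>X\<^esub> u \<Longrightarrow> b' = b"
      using u x unfolding srep_def by metis
    show "\<exists>!b. b \<in> carrier Y \<and> f' b = f' \<one>\<^bsub>Y\<^esub> \<and> y = b \<otimes>\<^bsub>Y\<^esub> h u"
    proof (rule ex1I[of _ "h b"])
      show "h b \<in> carrier Y \<and> f' (h b) = f' \<one>\<^bsub>Y\<^esub> \<and> y = h b \<otimes>\<^bsub>Y\<^esub> h u"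
        using b cu h x eq one by (metis X.one_closed mon_homD(1,2))
    next
      fix c assume c: "c \<in> carrier Y \<and> f' c = f' \<one>\<^bsub>Y\<^esub> \<and> y = c \<otimes>\<^bsub>Y\<^esub> h u"
      then obtain b' where b': "b' \<in> carrier X" "c = h b'" using sur by metis
      have "h x = h (b' \<otimes>\<^bsub>X\<^esub> u)" using c b' x h cu by (simp add: mon_homD)
      then have "x = b' \<otimes>\<^bsub>X\<^esub> u" using inj' x b' cu by simp
      moreover have "f b' = f \<one>\<^bsub>X\<^esub>" using c b' eq one by (metis X.one_closed)
      ultimately show "c = h b" using b_unique b' by simp
    qed
  qed
qed

section \<open>Kernels and cokernels in terms of elements\<close>

lemma is_kernelI:
  fixes k :: "'k \<Rightarrow> 'x" and M :: "'m monoid"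
  assumes K: "monoid K" and X: "monoid X"
    and k: "k \<in> mon_hom K X" and f: "f \<in> mon_hom X M"
    and bij: "bij_betw k (carrier K) {x\<in>carrier X. f x = \<one>\<^bsub>M\<^esub>}"
  shows "is_kernel K k X f M"
  unfolding is_kernel_def
proof (intro conjI allI impI)
  have inj: "\<And>a b. a \<in> carrier K \<Longrightarrow> b \<in> carrier K \<Longrightarrow> k a = k b \<Longrightarrow> a = b"
    using bij by (auto simp: bij_betw_def inj_on_def)
  have im: "k ` carrier K = {x\<in>carrier X. f x = \<one>\<^bsub>M\<^esub>}" using bij by (simp add: bij_betw_def)
  show "k \<in> mon_hom K X" by fact
  show "compose (carrier K) f k = zero_hom K M"
    using im by (auto simp: compose_def zero_hom_def fun_eq_iff)
  fix Z :: "'x monoid" and g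
  assume "monoid Z \<and> g \<in> mon_hom Z X \<and> compose (carrier Z) f g = zero_hom Z M"
  then have Z: "monoid Z" and g: "g \<in> mon_hom Z X" and z: "compose (carrier Z) f g = zero_hom Z M"
    by auto
  interpret Z: monoid Z by fact
  interpret K: monoid K by fact
  have "f (g z) = \<one>\<^bsub>M\<^esub>" if "z \<in> carrier Z" for z
    using fun_cong[OF z, of z] that by (simp add: compose_def zero_hom_def)
  then have gk: "g z \<in> k ` carrier K" if "z \<in> carrier Z" for z
    using that g im by (auto simp: mon_homD)
  \<comment> \<open>The only possible factorisation: undo the injection \<open>k\<close> on the
    values of \<open>g\<close>. The homomorphism laws are then checked after applying
    \<open>k\<close>.\<close>
  define h where "h = (\<lambda>z\<in>carrier Z. inv_into (carrier K) k (g z))"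
  have hK: "h z \<in> carrier K" and kh: "k (h z) = g z" if "z \<in> carrier Z" for z
    using gk[OF that] that by (auto simp: h_def inv_into_into f_inv_into_f)
  have "h \<in> mon_hom Z K"
  proof (rule mon_homI)
    fix x y assume "x \<in> carrier Z" "y \<in> carrier Z"
    then show "h (x \<otimes>\<^bsub>Z\<^esub> y) = h x \<otimes>\<^bsub>K\<^esub> h y"
      by (intro inj) (auto simp: hK kh mon_homD[OF g] mon_homD[OF k])
  next
    show "h \<one>\<^bsub>Z\<^esub> = \<one>\<^bsub>K\<^esub>"
      by (intro inj) (auto simp: hK kh mon_homD[OF g] mon_homD[OF k])
  qed (auto simp: hK, simp add: h_def)
  moreover have "compose (carrier Z) k h = g"
    by (rule sym, rule mon_hom_eqI[OF g]) (auto simp: compose_def kh)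
  moreover have "h' = h" if "h' \<in> mon_hom Z K" "compose (carrier Z) k h' = g" for h'
  proof (rule mon_hom_eqI[OF that(1)])
    fix z assume z: "z \<in> carrier Z"
    then have "k (h' z) = k (h z)" using fun_cong[OF that(2), of z] by (simp add: compose_def kh)
    then show "h' z = h z" using inj z hK that(1) by (simp add: mon_homD)
  qed (simp add: h_def)
  ultimately show "\<exists>!h. h \<in> mon_hom Z K \<and> compose (carrier Z) k h = g" by blast
qed

text \<open>The set-theoretic kernel is carried by the type of \<open>X\<close>, hence is itself a
  test monoid, and its inclusion must factor through \<open>k\<close>. Injectivity of
  \<open>k\<close> is obtained separately, from representatives.\<close>

lemma is_kernelD:
  fixes k :: "'k \<Rightarrow> 'x" and M :: "'m monoid"
  assumes "is_kernel K k X f M" and X: "monoid X" and f: "f \<in> mon_hom X M" and M: "monoid M"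
  shows "k ` carrier K = {x\<in>carrier X. f x = \<one>\<^bsub>M\<^esub>}"
proof
  interpret X: monoid X by fact
  have k: "k \<in> mon_hom K X" and z: "compose (carrier K) f k = zero_hom K M"
    using assms by (auto simp: is_kernel_def)
  show "k ` carrier K \<subseteq> {x\<in>carrier X. f x = \<one>\<^bsub>M\<^esub>}"
  proof clarify
    fix a assume a: "a \<in> carrier K"
    then show "k a \<in> carrier X \<and> f (k a) = \<one>\<^bsub>M\<^esub>"
      using fun_cong[OF z, of a] k by (simp add: compose_def zero_hom_def mon_homD)
  qed
  define Z where "Z = X\<lparr>carrier := {x\<in>carrier X. f x = \<one>\<^bsub>M\<^esub>}\<rparr>"
  have "monoid Z" unfolding Z_def
    by (rule monoidI) (auto simp: X.m_assoc mon_homD[OF f] monoid.l_one[OF M] monoid.one_closed[OF M])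
  moreover have "mon_id Z \<in> mon_hom Z X"
    by (rule mon_homI) (auto simp: Z_def mon_id_def mon_homD[OF f] monoid.l_one[OF M] monoid.one_closed[OF M])
  moreover have "compose (carrier Z) f (mon_id Z) = zero_hom Z M"
    by (auto simp: compose_def Z_def mon_id_def zero_hom_def fun_eq_iff)
  ultimately obtain h where h: "h \<in> mon_hom Z K" "compose (carrier Z) k h = mon_id Z"
    using assms(1) unfolding is_kernel_def by metis
  show "{x\<in>carrier X. f x = \<one>\<^bsub>M\<^esub>} \<subseteq> k ` carrier K"
  proof
    fix x assume "x \<in> {x\<in>carrier X. f x = \<one>\<^bsub>M\<^esub>}"
    then have x: "x \<in> carrier Z" by (simp add: Z_def)
    then have "k (h x) = x" using fun_cong[OF h(2), of x] by (simp add: compose_def)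
    then show "x \<in> k ` carrier K" using mon_homD(1)[OF h(1) x] by force
  qed
qed

text \<open>Each x is an element over 0 plus the chosen representative of \<open>f x\<close>, and
  \<open>g\<close> kills the former. So \<open>g x\<close> depends on \<open>f x\<close> alone,
  whatever representatives \<open>r\<close> selects, and this value defines the
  factorisation.\<close>

lemma is_cokernelI:
  fixes k :: "'k \<Rightarrow> 'x" and M :: "'m monoid"
  assumes X: "monoid X" and M: "monoid M" and f: "f \<in> mon_hom X M"
    and im: "k ` carrier K = {x\<in>carrier X. f x = \<one>\<^bsub>M\<^esub>}"
    and sur: "\<And>m. m \<in> carrier M \<Longrightarrow> \<exists>u. srep X f u \<and> f u = m"
  shows "is_cokernel K k X f M"
  unfolding is_cokernel_def
proof (intro conjI allI impI)
  interpret X: monoid X by fact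
  interpret M: monoid M by fact
  show "f \<in> mon_hom X M" by fact
  show "compose (carrier K) f k = zero_hom K M"
    using im by (auto simp: compose_def zero_hom_def fun_eq_iff)
  fix Z :: "'x monoid" and g
  assume "monoid Z \<and> g \<in> mon_hom X Z \<and> compose (carrier K) g k = zero_hom K Z"
  then have Z: "monoid Z" and g: "g \<in> mon_hom X Z" and z: "compose (carrier K) g k = zero_hom K Z"
    by auto
  interpret Z: monoid Z by fact
  have "g (k a) = \<one>\<^bsub>Z\<^esub>" if "a \<in> carrier K" for a
    using fun_cong[OF z, of a] that by (simp add: compose_def zero_hom_def)
  then have g1: "g b = \<one>\<^bsub>Z\<^esub>" if "b \<in> carrier X" "f b = \<one>\<^bsub>M\<^esub>" for b
  proof -
    have "b \<in> k ` carrier K" using that im by auto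
    then show ?thesis using \<open>\<And>a. a \<in> carrier K \<Longrightarrow> g (k a) = \<one>\<^bsub>Z\<^esub>\<close> by auto
  qed
  define r where "r m = (SOME u. srep X f u \<and> f u = m)" for m
  have r: "srep X f (r m)" "f (r m) = m" if "m \<in> carrier M" for m
    using someI_ex[OF sur[OF that]] by (auto simp: r_def)
  have rX: "r m \<in> carrier X" if "m \<in> carrier M" for m using r(1)[OF that] by (simp add: srep_def)
  have gr: "g x = g (r (f x))" if x: "x \<in> carrier X" for x
  proof -
    have m: "f x \<in> carrier M" using x f by (simp add: mon_homD)
    then obtain b where b: "b \<in> carrier X" "f b = f \<one>\<^bsub>X\<^esub>" "x = b \<otimes>\<^bsub>X\<^esub> r (f x)"
      using r[OF m] x unfolding srep_def by metis
    then have "g x = g b \<otimes>\<^bsub>Z\<^esub> g (r (f x))" using rX[OF m] g by (metis mon_homD(2))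
    then show ?thesis using g1[OF b(1)] b rX[OF m] f g by (simp add: mon_homD)
  qed
  define h where "h = (\<lambda>m\<in>carrier M. g (r m))"
  have "h \<in> mon_hom M Z"
  proof (rule mon_homI)
    fix x y assume "x \<in> carrier M" "y \<in> carrier M"
    then show "h (x \<otimes>\<^bsub>M\<^esub> y) = h x \<otimes>\<^bsub>Z\<^esub> h y"
      using gr[of "r x \<otimes>\<^bsub>X\<^esub> r y"] rX f g r by (simp add: h_def mon_homD)
  next
    show "h \<one>\<^bsub>M\<^esub> = \<one>\<^bsub>Z\<^esub>" using gr[of "\<one>\<^bsub>X\<^esub>"] f g by (simp add: h_def mon_homD)
  qed (auto simp: h_def rX mon_homD[OF g])
  moreover have "compose (carrier X) h f = g"
    by (rule sym, rule mon_hom_eqI[OF g]) (auto simp: compose_def h_def mon_homD[OF f] gr[symmetric])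
  moreover have "h' = h" if "h' \<in> mon_hom M Z" "compose (carrier X) h' f = g" for h'
  proof (rule mon_hom_eqI[OF that(1)])
    fix m assume m: "m \<in> carrier M"
    show "h' m = h m" using fun_cong[OF that(2), of "r m"] rX[OF m] r[OF m] m
      by (simp add: compose_def h_def)
  qed (simp add: h_def)
  ultimately show "\<exists>!h. h \<in> mon_hom M Z \<and> compose (carrier X) h f = g" by blast
qed

section \<open>Schreier extensions and their morphisms in terms of representatives\<close>

lemma representative_iff:
  assumes k: "bij_betw (kmap E) (carrier (kern E)) {x\<in>carrier (total E). proj E x = \<one>\<^bsub>base E\<^esub>}"
    and f: "proj E \<in> mon_hom (total E) (base E)"
  shows "representative E m u \<longleftrightarrow> srep (total E) (proj E) u \<and> proj E u = m"
proof -
  have inj: "\<And>a b. a \<in> carrier (kern E) \<Longrightarrow> b \<in> carrier (kern E) \<Longrightarrow> kmap E a = kmap E b \<Longrightarrow> a = b"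
    using k by (auto simp: bij_betw_def inj_on_def)
  have im: "b \<in> carrier (total E) \<and> proj E b = \<one>\<^bsub>base E\<^esub> \<longleftrightarrow> (\<exists>a\<in>carrier (kern E). b = kmap E a)" for b
    using k by (auto simp: bij_betw_def set_eq_iff image_iff)
  have "(\<exists>!a. a \<in> carrier (kern E) \<and> x = kmap E a \<otimes>\<^bsub>total E\<^esub> u) \<longleftrightarrow>
     (\<exists>!b. b \<in> carrier (total E) \<and> proj E b = \<one>\<^bsub>base E\<^esub> \<and> x = b \<otimes>\<^bsub>total E\<^esub> u)" for x
    using inj im by (smt (verit, ccfv_threshold))
  then show ?thesis unfolding representative_def srep_def mon_homD(3)[OF f] by auto
qed

text \<open>Trades both universal properties for elementwise conditions: the kernel property becomes
  a bijection onto the set-theoretic kernel, and the cokernel property is a consequence of the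
  representatives.\<close>

lemma schreier_extension_iff:
  fixes E :: "('k, 'x, 'm) extn"
  shows "schreier_extension E \<longleftrightarrow> monoid (kern E) \<and> monoid (total E) \<and> monoid (base E) \<and>
     kmap E \<in> mon_hom (kern E) (total E) \<and> proj E \<in> mon_hom (total E) (base E) \<and>
     bij_betw (kmap E) (carrier (kern E)) {x\<in>carrier (total E). proj E x = \<one>\<^bsub>base E\<^esub>} \<and>
     (\<forall>m\<in>carrier (base E). \<exists>u. srep (total E) (proj E) u \<and> proj E u = m)" (is "_ \<longleftrightarrow> ?r")
proof
  assume s: "schreier_extension E"
  then have 1: "monoid (kern E)" "monoid (total E)" "monoid (base E)"
     "kmap E \<in> mon_hom (kern E) (total E)" "proj E \<in> mon_hom (total E) (base E)"
     "is_kernel (kern E) (kmap E) (total E) (proj E) (base E)"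
     and rep: "\<And>m. m \<in> carrier (base E) \<Longrightarrow> \<exists>u. representative E m u"
    by (auto simp: schreier_extension_def short_exact_def)
  have im: "kmap E ` carrier (kern E) = {x\<in>carrier (total E). proj E x = \<one>\<^bsub>base E\<^esub>}"
    by (rule is_kernelD) (use 1 in auto)
  have "inj_on (kmap E) (carrier (kern E))"
  proof (rule inj_onI)
    fix a b assume ab: "a \<in> carrier (kern E)" "b \<in> carrier (kern E)" "kmap E a = kmap E b"
    \<comment> \<open>A representative over 0 makes \<open>a\<close> recoverable from the sum of
      \<open>kmap E a\<close> and \<open>u\<close>, hence from \<open>kmap E a\<close>.\<close>
    obtain u where u: "representative E \<one>\<^bsub>base E\<^esub> u" using rep 1 by (meson monoid.one_closed)
    then have cu: "u \<in> carrier (total E)" "proj E u = \<one>\<^bsub>base E\<^esub>" by (auto simp: representative_def)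
    let ?x = "kmap E a \<otimes>\<^bsub>total E\<^esub> u"
    have ka: "kmap E a \<in> carrier (total E)" "proj E (kmap E a) = \<one>\<^bsub>base E\<^esub>" using ab im by auto
    then have "?x \<in> carrier (total E)" "proj E ?x = \<one>\<^bsub>base E\<^esub>"
      using cu 1 by (auto simp: mon_homD monoid.m_closed monoid.l_one monoid.one_closed)
    then have "\<exists>!a. a \<in> carrier (kern E) \<and> ?x = kmap E a \<otimes>\<^bsub>total E\<^esub> u"
      using u by (simp add: representative_def)
    then show "a = b" using ab by metis
  qed
  then have bij: "bij_betw (kmap E) (carrier (kern E)) {x\<in>carrier (total E). proj E x = \<one>\<^bsub>base E\<^esub>}"
    using im by (simp add: bij_betw_def)
  show ?r using 1 bij rep representative_iff[OF bij 1(5)] by auto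
next
  assume r: ?r
  then have "is_kernel (kern E) (kmap E) (total E) (proj E) (base E)"
    by (intro is_kernelI) auto
  moreover have "is_cokernel (kern E) (kmap E) (total E) (proj E) (base E)"
    using r by (intro is_cokernelI) (auto simp: bij_betw_def)
  ultimately show "schreier_extension E"
    using r representative_iff[of E] by (auto simp: schreier_extension_def short_exact_def)
qed

text \<open>The kernel component is forced: \<open>l\<close> preserves 0, so \<open>h\<close> sends
  elements over 0 to elements over 0, and \<open>kmap L\<close> is a bijection onto the latter.
  Everything else in the definition is a condition on \<open>h\<close> and \<open>l\<close>.\<close>

lemma schreier_morphism_iff:
  assumes E: "schreier_extension E" and L: "schreier_extension L"
  shows "(\<exists>g. schreier_morphism E L g h l) \<longleftrightarrow>
     h \<in> mon_hom (total E) (total L) \<and> l \<in> mon_hom (base E) (base L) \<and>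
     (\<forall>x\<in>carrier (total E). proj L (h x) = l (proj E x)) \<and>
     (\<forall>u. srep (total E) (proj E) u \<longrightarrow> srep (total L) (proj L) (h u))" (is "_ \<longleftrightarrow> ?r")
proof
  note e = E[unfolded schreier_extension_iff]
  note l = L[unfolded schreier_extension_iff]
  have E': "monoid (kern E)" "monoid (total E)" "monoid (base E)"
    and pE: "proj E \<in> mon_hom (total E) (base E)"
    using e by simp_all
  have repE: "representative E m u \<longleftrightarrow> srep (total E) (proj E) u \<and> proj E u = m" for m u
    using e by (intro representative_iff) auto
  have repL: "representative L m u \<longleftrightarrow> srep (total L) (proj L) u \<and> proj L u = m" for m u
    using l by (intro representative_iff) auto
  {
    assume "\<exists>g. schreier_morphism E L g h l"
    then obtain g where g: "schreier_morphism E L g h l" by auto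
    then have "compose (carrier (total E)) (proj L) h = compose (carrier (total E)) l (proj E)"
      by (simp add: schreier_morphism_def)
    then have "\<forall>x\<in>carrier (total E). proj L (h x) = l (proj E x)"
      by (metis compose_eq)
    moreover have "srep (total L) (proj L) (h u)" if u: "srep (total E) (proj E) u" for u
    proof -
      have "proj E u \<in> carrier (base E)" using u by (intro mon_homD(1)[OF pE]) (simp add: srep_def)
      then show ?thesis using g u repE repL unfolding schreier_morphism_def by blast
    qed
    ultimately show ?r using g by (simp add: schreier_morphism_def)
  }
  {
    assume r: ?r
    then have h: "h \<in> mon_hom (total E) (total L)" and l': "l \<in> mon_hom (base E) (base L)"
      and hl: "\<And>x. x \<in> carrier (total E) \<Longrightarrow> proj L (h x) = l (proj E x)"
      and sr: "\<And>u. srep (total E) (proj E) u \<Longrightarrow> srep (total L) (proj L) (h u)"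
      by simp_all
    define k k' where "k = kmap E" and "k' = kmap L"
    have k: "k \<in> mon_hom (kern E) (total E)" and k': "k' \<in> mon_hom (kern L) (total L)"
      using e l by (auto simp: k_def k'_def)
    have bij: "bij_betw k (carrier (kern E)) {x\<in>carrier (total E). proj E x = \<one>\<^bsub>base E\<^esub>}"
      using e by (simp add: k_def)
    have bij': "bij_betw k' (carrier (kern L)) {x\<in>carrier (total L). proj L x = \<one>\<^bsub>base L\<^esub>}"
      using l by (simp add: k'_def)
    define g where "g = (\<lambda>a\<in>carrier (kern E). inv_into (carrier (kern L)) k' (h (k a)))"
    have "h (k a) \<in> k' ` carrier (kern L)" if a: "a \<in> carrier (kern E)" for a
    proof -
      have "k a \<in> carrier (total E)" "proj E (k a) = \<one>\<^bsub>base E\<^esub>" using a bij by (auto simp: bij_betw_def)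
      then have "h (k a) \<in> carrier (total L)" "proj L (h (k a)) = \<one>\<^bsub>base L\<^esub>"
        using hl mon_homD(3)[OF l'] by (simp_all add: mon_homD(1)[OF h])
      then show ?thesis using bij' by (auto simp: bij_betw_def)
    qed
    then have gK: "g a \<in> carrier (kern L)" and kg: "k' (g a) = h (k a)" if "a \<in> carrier (kern E)" for a
      using that by (auto simp: g_def inv_into_into f_inv_into_f)
    have inj: "\<And>a b. a \<in> carrier (kern L) \<Longrightarrow> b \<in> carrier (kern L) \<Longrightarrow> k' a = k' b \<Longrightarrow> a = b"
      using bij' by (auto simp: bij_betw_def inj_on_def)
    have "g \<in> mon_hom (kern E) (kern L)"
    proof (rule mon_homI)
      fix x y assume "x \<in> carrier (kern E)" "y \<in> carrier (kern E)"
      then show "g (x \<otimes>\<^bsub>kern E\<^esub> y) = g x \<otimes>\<^bsub>kern L\<^esub> g y"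
        using E' l by (intro inj)
          (simp_all add: gK kg mon_homD[OF k] mon_homD[OF k'] mon_homD[OF h] monoid.m_closed)
    next
      show "g \<one>\<^bsub>kern E\<^esub> = \<one>\<^bsub>kern L\<^esub>"
        using E' l by (intro inj)
          (simp_all add: gK kg mon_homD[OF k] mon_homD[OF k'] mon_homD[OF h] monoid.one_closed)
    qed (auto simp: gK, simp add: g_def)
    moreover have "compose (carrier (kern E)) h (kmap E) = compose (carrier (kern E)) (kmap L) g"
      by (auto simp: compose_def fun_eq_iff kg[unfolded k_def k'_def])
    moreover have "compose (carrier (total E)) (proj L) h = compose (carrier (total E)) l (proj E)"
      using hl by (auto simp: compose_def fun_eq_iff)
    ultimately have "schreier_morphism E L g h l"
      unfolding schreier_morphism_def repE repL using h l' hl sr by (auto simp: srep_def)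
    then show "\<exists>g. schreier_morphism E L g h l" by blast
  }
qed

section \<open>Crossed Schreier extensions\<close>

lemma cc_SExt_iff:
  "E \<in> cc_SExt M \<longleftrightarrow> schreier_extension E \<and> base E = M \<and> comm_monoid_cancel (kern E)"
  by (simp add: cc_SExt_def)

lemma cc_morphism_iff:
  assumes E: "E \<in> cc_SExt M" and L: "L \<in> cc_SExt M"
  shows "cc_morphism E L h \<longleftrightarrow> h \<in> mon_hom (total E) (total L) \<and>
     (\<forall>x\<in>carrier (total E). proj L (h x) = proj E x) \<and>
     (\<forall>u. srep (total E) (proj E) u \<longrightarrow> srep (total L) (proj L) (h u))"
proof -
  have s: "schreier_extension E" "schreier_extension L" and b: "base E = M" "base L = M"
    using E L by (auto simp: cc_SExt_def)
  then have M: "monoid M" and p: "proj E \<in> mon_hom (total E) M"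
    by (auto simp: schreier_extension_iff)
  show ?thesis unfolding cc_morphism_def schreier_morphism_iff[OF s]
    using mon_id_hom[OF M] by (auto simp: b mon_homD(1)[OF p])
qed

section \<open>Cancellation and triviality of the action in a crossed Schreier extension\<close>

locale crossed_schreier =
  fixes M :: "'u monoid" and X :: "'u xext"
  assumes X: "crossed_schreier_extension M X" and B_comm: "comm_monoid (objB X)"
begin

abbreviation "B \<equiv> objB X"
abbreviation "C \<equiv> objC X"
abbreviation "N \<equiv> objN X"
abbreviation "\<delta> \<equiv> delta X"
abbreviation "\<pi> \<equiv> mappi X"
abbreviation "\<alpha> \<equiv> act X"

lemma left: "schreier_extension (left_extn X)" and right: "schreier_extension (right_extn M X)"
  using X by (simp_all add: crossed_schreier_extension_def)

lemma monoids: "monoid (objA X)" "monoid B" "monoid C" "monoid M" "monoid N"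
  using X left by (auto simp: crossed_schreier_extension_def crossed_semimodule_def
      schreier_extension_iff left_extn_def)

sublocale B: comm_monoid B by (rule B_comm)
sublocale C: monoid C by (rule monoids)
sublocale M: monoid M by (rule monoids)
sublocale N: monoid N by (rule monoids)

lemma N_simps [simp]: "carrier N = \<delta> ` carrier B" "\<one>\<^bsub>N\<^esub> = \<one>\<^bsub>C\<^esub>" "x \<otimes>\<^bsub>N\<^esub> y = x \<otimes>\<^bsub>C\<^esub> y"
  by (simp_all add: objN_def)

lemma delta_hom: "\<delta> \<in> mon_hom B C" and pi_hom: "\<pi> \<in> mon_hom C M"
  using X right by (auto simp: crossed_schreier_extension_def crossed_semimodule_def
      schreier_extension_iff right_extn_def)

lemmas delta_simps [simp] = mon_homD(1-3)[OF delta_hom]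
lemmas pi_simps [simp] = mon_homD(1-3)[OF pi_hom]

lemma crossed: "c \<in> carrier C \<Longrightarrow> b \<in> carrier B \<Longrightarrow> \<delta> (\<alpha> c b) \<otimes>\<^bsub>C\<^esub> c = c \<otimes>\<^bsub>C\<^esub> \<delta> b"
  and peiffer: "b \<in> carrier B \<Longrightarrow> b' \<in> carrier B \<Longrightarrow> \<alpha> (\<delta> b) b' \<otimes>\<^bsub>B\<^esub> b = b \<otimes>\<^bsub>B\<^esub> b'"
  and act_hom: "\<alpha> \<in> mon_hom C (End_monoid B)"
  using X by (auto simp: crossed_schreier_extension_def crossed_semimodule_def)

lemma act_apply_hom: "c \<in> carrier C \<Longrightarrow> \<alpha> c \<in> mon_hom B B"
  using mon_homD(1)[OF act_hom] by (simp add: End_monoid_def)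

lemma act_simps [simp]:
  "c \<in> carrier C \<Longrightarrow> b \<in> carrier B \<Longrightarrow> \<alpha> c b \<in> carrier B"
  "c \<in> carrier C \<Longrightarrow> b \<in> carrier B \<Longrightarrow> b' \<in> carrier B \<Longrightarrow> \<alpha> c (b \<otimes>\<^bsub>B\<^esub> b') = \<alpha> c b \<otimes>\<^bsub>B\<^esub> \<alpha> c b'"
  "c \<in> carrier C \<Longrightarrow> \<alpha> c \<one>\<^bsub>B\<^esub> = \<one>\<^bsub>B\<^esub>"
  "c \<in> carrier C \<Longrightarrow> c' \<in> carrier C \<Longrightarrow> b \<in> carrier B \<Longrightarrow> \<alpha> (c \<otimes>\<^bsub>C\<^esub> c') b = \<alpha> c (\<alpha> c' b)"
  "b \<in> carrier B \<Longrightarrow> \<alpha> \<one>\<^bsub>C\<^esub> b = b"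
  using act_apply_hom mon_homD(2,3)[OF act_hom]
  by (auto simp: mon_hom_iff End_monoid_def compose_def)

text \<open>Exactness at C: the kernel map of the right extension is the inclusion of
  \<open>N\<close>, so its image is \<open>N\<close> itself.\<close>

lemma pi_kernel: "c \<in> carrier C \<Longrightarrow> \<pi> c = \<one>\<^bsub>M\<^esub> \<longleftrightarrow> c \<in> \<delta> ` carrier B"
proof -
  have "mon_id N ` carrier N = {x\<in>carrier C. \<pi> x = \<one>\<^bsub>M\<^esub>}"
    using right by (auto simp: schreier_extension_iff right_extn_def bij_betw_def)
  moreover have "mon_id N ` carrier N = carrier N" by (simp add: mon_id_def)
  ultimately show "c \<in> carrier C \<Longrightarrow> \<pi> c = \<one>\<^bsub>M\<^esub> \<longleftrightarrow> c \<in> \<delta> ` carrier B" by auto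
qed

lemma pi_delta [simp]: "b \<in> carrier B \<Longrightarrow> \<pi> (\<delta> b) = \<one>\<^bsub>M\<^esub>"
  by (simp add: pi_kernel)

lemma pi_srep: "m \<in> carrier M \<Longrightarrow> \<exists>u. srep C \<pi> u \<and> \<pi> u = m"
  using right by (auto simp: schreier_extension_iff right_extn_def)

lemma delta_srep: "b \<in> carrier B \<Longrightarrow> \<exists>u. srep B \<delta> u \<and> \<delta> u = \<delta> b"
  using left by (auto simp: schreier_extension_iff left_extn_def)

lemma delta_comm: "b \<in> carrier B \<Longrightarrow> b' \<in> carrier B \<Longrightarrow> \<delta> b \<otimes>\<^bsub>C\<^esub> \<delta> b' = \<delta> b' \<otimes>\<^bsub>C\<^esub> \<delta> b"
  by (metis B.m_comm delta_simps(2))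

lemma delta_cancel:
  assumes "b1 \<in> carrier B" "b2 \<in> carrier B" "b \<in> carrier B" "\<delta> b1 \<otimes>\<^bsub>C\<^esub> \<delta> b = \<delta> b2 \<otimes>\<^bsub>C\<^esub> \<delta> b"
  shows "\<delta> b1 = \<delta> b2"
  using X assms by (auto simp: crossed_schreier_extension_def right_cancellative_def)

text \<open>Right cancellation in \<open>A\<close>, carried along the bijection
  \<open>mapk X\<close> onto the elements of \<open>B\<close> over 0.\<close>

lemma kernel_cancel:
  assumes "a \<in> carrier B" "\<delta> a = \<one>\<^bsub>C\<^esub>" "b \<in> carrier B" "\<delta> b = \<one>\<^bsub>C\<^esub>" "c \<in> carrier B" "\<delta> c = \<one>\<^bsub>C\<^esub>"
    and eq: "a \<otimes>\<^bsub>B\<^esub> c = b \<otimes>\<^bsub>B\<^esub> c"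
  shows "a = b"
proof -
  define k where "k = mapk X"
  have k: "k \<in> mon_hom (objA X) B" "bij_betw k (carrier (objA X)) {x \<in> carrier B. \<delta> x = \<one>\<^bsub>C\<^esub>}"
    using left by (auto simp: schreier_extension_iff left_extn_def k_def)
  then have "a \<in> k ` carrier (objA X)" "b \<in> k ` carrier (objA X)" "c \<in> k ` carrier (objA X)"
    using assms by (simp_all add: bij_betw_def)
  then obtain a' b' c' where k': "a = k a'" "b = k b'" "c = k c'"
    and c: "a' \<in> carrier (objA X)" "b' \<in> carrier (objA X)" "c' \<in> carrier (objA X)"
    by blast
  have "k (a' \<otimes>\<^bsub>objA X\<^esub> c') = k (b' \<otimes>\<^bsub>objA X\<^esub> c')"
    using eq c by (simp add: k' mon_homD[OF k(1)])
  then have "a' \<otimes>\<^bsub>objA X\<^esub> c' = b' \<otimes>\<^bsub>objA X\<^esub> c'"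
    using k(2) c monoids(1) by (auto simp: bij_betw_def inj_on_def monoid.m_closed)
  moreover have "right_cancellative (objA X)" using X by (simp add: crossed_schreier_extension_def)
  ultimately show ?thesis using c k' unfolding right_cancellative_def by blast
qed

text \<open>Cancellation in \<open>N\<close> puts \<open>b1\<close> and \<open>b2\<close> in one
  fibre of \<open>\<delta>\<close>, so they are a1 + u and a2 + u for a common representative u. It
  remains to compare a1 and a2, which lie in the cancellative kernel.\<close>

lemma B_cancel:
  assumes b1: "b1 \<in> carrier B" and b2: "b2 \<in> carrier B" and b: "b \<in> carrier B"
    and eq: "b1 \<otimes>\<^bsub>B\<^esub> b = b2 \<otimes>\<^bsub>B\<^esub> b"
  shows "b1 = b2"
proof -
  have d: "\<delta> b1 = \<delta> b2" using eq delta_cancel[OF b1 b2 b] b1 b2 b by (metis delta_simps(2))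
  obtain u where u: "srep B \<delta> u" "\<delta> u = \<delta> b1" using delta_srep b1 by metis
  then have cu: "u \<in> carrier B" by (simp add: srep_def)
  obtain a1 where a1: "a1 \<in> carrier B" "\<delta> a1 = \<one>\<^bsub>C\<^esub>" "b1 = a1 \<otimes>\<^bsub>B\<^esub> u"
    using u b1 delta_simps(3) unfolding srep_def by metis
  obtain a2 where a2: "a2 \<in> carrier B" "\<delta> a2 = \<one>\<^bsub>C\<^esub>" "b2 = a2 \<otimes>\<^bsub>B\<^esub> u"
    using u b2 d delta_simps(3) unfolding srep_def by metis
  \<comment> \<open>The sum u + b need not be a representative, so uniqueness cannot be applied to
    it directly. It is rewritten as a3 + v with \<open>v\<close> a representative, and the extra
    kernel element a3 is cancelled at the end.\<close>
  obtain v where v: "srep B \<delta> v" "\<delta> v = \<delta> (u \<otimes>\<^bsub>B\<^esub> b)" using delta_srep cu b by blast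
  then have cv: "v \<in> carrier B" by (simp add: srep_def)
  obtain a3 where a3: "a3 \<in> carrier B" "\<delta> a3 = \<one>\<^bsub>C\<^esub>" "u \<otimes>\<^bsub>B\<^esub> b = a3 \<otimes>\<^bsub>B\<^esub> v"
    using v cu b delta_simps(3) unfolding srep_def by (metis B.m_closed)
  have *: "(a1 \<otimes>\<^bsub>B\<^esub> a3) \<otimes>\<^bsub>B\<^esub> v = (a2 \<otimes>\<^bsub>B\<^esub> a3) \<otimes>\<^bsub>B\<^esub> v"
    using eq a1 a2 a3 cu cv b by (simp add: B.m_assoc)
  have d13: "\<delta> (a1 \<otimes>\<^bsub>B\<^esub> a3) = \<one>\<^bsub>C\<^esub>" "\<delta> (a2 \<otimes>\<^bsub>B\<^esub> a3) = \<one>\<^bsub>C\<^esub>" using a1 a2 a3 by simp_all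
  then have "\<delta> ((a1 \<otimes>\<^bsub>B\<^esub> a3) \<otimes>\<^bsub>B\<^esub> v) = \<delta> v" using a1 a2 a3 cv by simp
  then have "\<exists>!b. b \<in> carrier B \<and> \<delta> b = \<one>\<^bsub>C\<^esub> \<and> (a1 \<otimes>\<^bsub>B\<^esub> a3) \<otimes>\<^bsub>B\<^esub> v = b \<otimes>\<^bsub>B\<^esub> v"
    using v(1)[unfolded srep_def, THEN conjunct2, THEN bspec, of "(a1 \<otimes>\<^bsub>B\<^esub> a3) \<otimes>\<^bsub>B\<^esub> v"] a1 a3 cv
    by simp
  then have "a1 \<otimes>\<^bsub>B\<^esub> a3 = a2 \<otimes>\<^bsub>B\<^esub> a3" using * d13 a1 a2 a3 by blast
  then have "a1 = a2" using kernel_cancel a1 a2 a3 by blast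
  then show ?thesis using a1 a2 by simp
qed

text \<open>Commutativity turns the Peiffer identity into an equation from which \<open>b\<close>
  cancels.\<close>

lemma act_delta [simp]:
  assumes "b \<in> carrier B" "b' \<in> carrier B" shows "\<alpha> (\<delta> b) b' = b'"
  using peiffer[OF assms] B_cancel[of "\<alpha> (\<delta> b) b'" b' b] assms by (simp add: B.m_comm)

end

section \<open>The category of crossed Schreier extensions over M\<close>

lemma com_XSExt_Obj: "X \<in> Obj (com_XSExt M) \<longleftrightarrow> crossed_schreier M X"
  by (simp add: com_XSExt_def crossed_schreier_def)

text \<open>Both induced maps are determined by \<open>\<phi>\<close> and \<open>\<psi>\<close>, so
  a morphism amounts to equations and two preservation conditions. The condition on the left
  extension involves \<open>\<delta>\<close> only, because its base is the image of
  \<open>\<delta>\<close>.\<close>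

lemma XSExt_hom_iff:
  assumes "crossed_schreier M X" and "crossed_schreier M Y"
  shows "(\<phi>, \<psi>) \<in> XSExt_hom M X Y \<longleftrightarrow>
     \<phi> \<in> mon_hom (objB X) (objB Y) \<and> \<psi> \<in> mon_hom (objC X) (objC Y) \<and>
     (\<forall>b\<in>carrier (objB X). delta Y (\<phi> b) = \<psi> (delta X b)) \<and>
     (\<forall>c\<in>carrier (objC X). \<forall>b\<in>carrier (objB X). \<phi> (act X c b) = act Y (\<psi> c) (\<phi> b)) \<and>
     (\<forall>c\<in>carrier (objC X). mappi Y (\<psi> c) = mappi X c) \<and>
     (\<forall>u. srep (objB X) (delta X) u \<longrightarrow> srep (objB Y) (delta Y) (\<phi> u)) \<and>
     (\<forall>u. srep (objC X) (mappi X) u \<longrightarrow> srep (objC Y) (mappi Y) (\<psi> u))" (is "_ \<longleftrightarrow> ?r")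
proof -
  interpret X: crossed_schreier M X by fact
  interpret Y: crossed_schreier M Y by fact
  define \<psi>N where "\<psi>N = restrict \<psi> (carrier (objN X))"
  have pi: "compose (carrier (objC X)) (mappi Y) \<psi> = mappi X \<longleftrightarrow>
      (\<forall>c\<in>carrier (objC X). mappi Y (\<psi> c) = mappi X c)"
    using mon_homD(4)[OF X.pi_hom] by (auto simp: compose_def fun_eq_iff extensional_def)
  have l: "(\<exists>\<phi>s. schreier_morphism (left_extn X) (left_extn Y) \<phi>s \<phi> \<psi>N) \<longleftrightarrow>
      \<phi> \<in> mon_hom (objB X) (objB Y) \<and> \<psi>N \<in> mon_hom (objN X) (objN Y) \<and>
      (\<forall>b\<in>carrier (objB X). delta Y (\<phi> b) = \<psi> (delta X b)) \<and>
      (\<forall>u. srep (objB X) (delta X) u \<longrightarrow> srep (objB Y) (delta Y) (\<phi> u))"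
    unfolding schreier_morphism_iff[OF X.left Y.left] by (auto simp: left_extn_def \<psi>N_def)
  have r: "(\<exists>g. schreier_morphism (right_extn M X) (right_extn M Y) g \<psi> (mon_id M)) \<longleftrightarrow>
      \<psi> \<in> mon_hom (objC X) (objC Y) \<and>
      (\<forall>c\<in>carrier (objC X). mappi Y (\<psi> c) = mappi X c) \<and>
      (\<forall>u. srep (objC X) (mappi X) u \<longrightarrow> srep (objC Y) (mappi Y) (\<psi> u))"
    unfolding schreier_morphism_iff[OF X.right Y.right]
    using mon_id_hom[of M] X.monoids by (auto simp: right_extn_def)
  \<comment> \<open>Both kernel maps are inclusions, so any kernel component equals the restriction
    of \<open>\<psi>\<close>. This replaces the unnamed component of the general criterion by the
    prescribed one.\<close>
  have r': "schreier_morphism (right_extn M X) (right_extn M Y) \<psi>N \<psi> (mon_id M)"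
    if g: "schreier_morphism (right_extn M X) (right_extn M Y) g \<psi> (mon_id M)" for g
  proof -
    have gh: "g \<in> mon_hom (objN X) (objN Y)"
      and c: "compose (carrier (objN X)) \<psi> (mon_id (objN X)) = compose (carrier (objN X)) (mon_id (objN Y)) g"
      using g by (auto simp: schreier_morphism_def right_extn_def)
    have "g = \<psi>N"
    proof (rule mon_hom_eqI[OF gh])
      fix n assume n: "n \<in> carrier (objN X)"
      then show "g n = \<psi>N n" using fun_cong[OF c, of n] mon_homD(1)[OF gh n]
        by (simp add: compose_def \<psi>N_def del: X.N_simps Y.N_simps)
    qed (simp add: \<psi>N_def)
    then show ?thesis using g by simp
  qed
  \<comment> \<open>\<open>\<psi>\<close> maps the image of \<open>\<delta>\<close> into the image
    of the other \<open>\<delta>\<close>, because it intertwines the two through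
    \<open>\<phi>\<close>.\<close>
  have N: "\<psi>N \<in> mon_hom (objN X) (objN Y)"
    if "\<phi> \<in> mon_hom (objB X) (objB Y)" and \<psi>: "\<psi> \<in> mon_hom (objC X) (objC Y)"
      and eq: "\<forall>b\<in>carrier (objB X). delta Y (\<phi> b) = \<psi> (delta X b)"
  proof (rule mon_homI)
    fix n assume "n \<in> carrier (objN X)"
    then obtain b where b: "b \<in> carrier (objB X)" "n = delta X b" by auto
    then have "\<psi>N n = delta Y (\<phi> b)" using eq by (simp add: \<psi>N_def)
    moreover have "\<phi> b \<in> carrier (objB Y)" using b that(1) by (simp add: mon_homD)
    ultimately show "\<psi>N n \<in> carrier (objN Y)" by simp
  next
    fix x y assume xy: "x \<in> carrier (objN X)" "y \<in> carrier (objN X)"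
    then have "x \<in> carrier (objC X)" "y \<in> carrier (objC X)" by auto
    then show "\<psi>N (x \<otimes>\<^bsub>objN X\<^esub> y) = \<psi>N x \<otimes>\<^bsub>objN Y\<^esub> \<psi>N y"
      using xy X.N.m_closed[OF xy] by (simp add: \<psi>N_def mon_homD[OF \<psi>])
  next
    show "\<psi>N \<one>\<^bsub>objN X\<^esub> = \<one>\<^bsub>objN Y\<^esub>"
      using X.N.one_closed by (simp add: \<psi>N_def mon_homD[OF \<psi>])
  qed (simp add: \<psi>N_def)
  show ?thesis
    unfolding XSExt_hom_def crossed_morphism_def pi \<psi>N_def[symmetric] mem_Collect_eq prod.case l
    using r r' N by blast
qed

lemma XSExt_hom_id:
  assumes "crossed_schreier M X"
  shows "(mon_id (objB X), mon_id (objC X)) \<in> XSExt_hom M X X"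
proof -
  interpret X: crossed_schreier M X by fact
  show ?thesis unfolding XSExt_hom_iff[OF assms assms]
    by (auto simp: mon_id_hom X.monoids srep_def)
qed

lemma XSExt_hom_comp:
  assumes X: "crossed_schreier M X" and Y: "crossed_schreier M Y" and Z: "crossed_schreier M Z"
    and f: "(\<phi>, \<psi>) \<in> XSExt_hom M X Y" and g: "(\<phi>', \<psi>') \<in> XSExt_hom M Y Z"
  shows "(compose (carrier (objB X)) \<phi>' \<phi>, compose (carrier (objC X)) \<psi>' \<psi>) \<in> XSExt_hom M X Z"
proof -
  interpret X: crossed_schreier M X by fact
  note f = f[unfolded XSExt_hom_iff[OF X Y]] and g = g[unfolded XSExt_hom_iff[OF Y Z]]
  have h: "\<phi> \<in> mon_hom (objB X) (objB Y)" "\<psi> \<in> mon_hom (objC X) (objC Y)"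
     "\<phi>' \<in> mon_hom (objB Y) (objB Z)" "\<psi>' \<in> mon_hom (objC Y) (objC Z)"
    using f g by simp_all
  show ?thesis unfolding XSExt_hom_iff[OF X Z]
  proof (intro conjI)
    show "compose (carrier (objB X)) \<phi>' \<phi> \<in> mon_hom (objB X) (objB Z)"
      "compose (carrier (objC X)) \<psi>' \<psi> \<in> mon_hom (objC X) (objC Z)"
      using mon_hom_compose h X.monoids by blast+
  qed (use f g in \<open>auto simp: compose_def mon_homD[OF h(1)] mon_homD[OF h(2)] srep_def[of "objB X"] srep_def[of "objC X"]\<close>)
qed

lemma category_com_XSExt: "category (com_XSExt M)"
proof -
  have H: "Hom (com_XSExt M) = XSExt_hom M"
    "Id (com_XSExt M) = (\<lambda>X. (mon_id (objB X), mon_id (objC X)))"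
    "\<And>X Y Z p q r s. Comp (com_XSExt M) X Y Z (p, q) (r, s) =
      (compose (carrier (objB X)) p r, compose (carrier (objC X)) q s)"
    by (simp_all add: com_XSExt_def)
  have h: "\<phi> \<in> mon_hom (objB X) (objB Y) \<and> \<psi> \<in> mon_hom (objC X) (objC Y)"
    if "(\<phi>, \<psi>) \<in> XSExt_hom M X Y" for X Y \<phi> \<psi>
    using that by (auto simp: XSExt_hom_def crossed_morphism_def)
  show ?thesis
    unfolding category_def com_XSExt_Obj H
  proof (intro conjI ballI)
    fix X Y Z f g
    assume "X \<in> Obj (com_XSExt M)" "Y \<in> Obj (com_XSExt M)" "Z \<in> Obj (com_XSExt M)"
      and "f \<in> XSExt_hom M X Y" "g \<in> XSExt_hom M Y Z"
    then show "Comp (com_XSExt M) X Y Z g f \<in> XSExt_hom M X Z"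
      by (cases f, cases g) (simp add: H com_XSExt_Obj XSExt_hom_comp)
  qed (auto simp: H com_XSExt_Obj XSExt_hom_id dest!: h
      intro: compose_mon_id_left compose_mon_id_right compose_assoc_mon_hom)
qed

text \<open>For \<open>\<delta>\<close> the comparison of bases is \<open>\<psi>\<close>, whose
  injectivity supplies the separation condition of \<open>srep_bij\<close>; for \<open>\<pi>\<close>
  it is the identity. The equations of the inverse pair for \<open>\<delta>\<close> and for the
  action are checked after applying the injections \<open>\<psi>\<close> and
  \<open>\<phi>\<close>.\<close>

lemma iso_arr_com_XSExt:
  assumes X: "crossed_schreier M X" and Y: "crossed_schreier M Y"
    and \<phi>: "\<phi> \<in> mon_hom (objB X) (objB Y)" "bij_betw \<phi> (carrier (objB X)) (carrier (objB Y))"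
    and \<psi>: "\<psi> \<in> mon_hom (objC X) (objC Y)" "bij_betw \<psi> (carrier (objC X)) (carrier (objC Y))"
    and d: "\<And>b. b \<in> carrier (objB X) \<Longrightarrow> delta Y (\<phi> b) = \<psi> (delta X b)"
    and a: "\<And>c b. c \<in> carrier (objC X) \<Longrightarrow> b \<in> carrier (objB X) \<Longrightarrow> \<phi> (act X c b) = act Y (\<psi> c) (\<phi> b)"
    and p: "\<And>c. c \<in> carrier (objC X) \<Longrightarrow> mappi Y (\<psi> c) = mappi X c"
  shows "iso_arr (com_XSExt M) X Y (\<phi>, \<psi>)"
proof -
  interpret X: crossed_schreier M X by fact
  interpret Y: crossed_schreier M Y by fact
  define \<phi>' where "\<phi>' = (\<lambda>y\<in>carrier (objB Y). inv_into (carrier (objB X)) \<phi> y)"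
  define \<psi>' where "\<psi>' = (\<lambda>y\<in>carrier (objC Y). inv_into (carrier (objC X)) \<psi> y)"
  note i = mon_hom_inv[OF \<phi> X.monoids(2) Y.monoids(2), folded \<phi>'_def]
  note j = mon_hom_inv[OF \<psi> X.monoids(3) Y.monoids(3), folded \<psi>'_def]
  note [simp] = i(3,4) j(3,4) mon_homD(1)[OF i(1)] mon_homD(1)[OF j(1)]
  have inj: "\<And>x y. x \<in> carrier (objC X) \<Longrightarrow> y \<in> carrier (objC X) \<Longrightarrow> \<psi> x = \<psi> y \<Longrightarrow> x = y"
    using j(3) by metis
  have inj': "\<And>x y. x \<in> carrier (objB X) \<Longrightarrow> y \<in> carrier (objB X) \<Longrightarrow> \<phi> x = \<phi> y \<Longrightarrow> x = y"
    using i(3) by metis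
  have d': "delta X (\<phi>' b) = \<psi>' (delta Y b)" if "b \<in> carrier (objB Y)" for b
    by (rule inj) (use that d[of "\<phi>' b"] in auto)
  have a': "\<phi>' (act Y c b) = act X (\<psi>' c) (\<phi>' b)"
    if "c \<in> carrier (objC Y)" "b \<in> carrier (objB Y)" for c b
    by (rule inj') (use that a[of "\<psi>' c" "\<phi>' b"] in auto)
  have p': "mappi X (\<psi>' c) = mappi Y c" if "c \<in> carrier (objC Y)" for c
    using p[of "\<psi>' c"] that by simp
  have 1: "(\<phi>, \<psi>) \<in> XSExt_hom M X Y"
    unfolding XSExt_hom_iff[OF X Y]
  proof (intro conjI allI impI)
    fix u assume "srep (objB X) (delta X) u"
    then show "srep (objB Y) (delta Y) (\<phi> u)"
      by - (rule srep_bij[where l = \<psi> and f = "delta X" and f' = "delta Y", OF X.monoids(2) \<phi>],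
        (use d inj X.delta_simps(1) in blast)+)
  next
    fix u assume "srep (objC X) (mappi X) u"
    then show "srep (objC Y) (mappi Y) (\<psi> u)"
      by - (rule srep_bij[where l = "\<lambda>m. m" and f = "mappi X" and f' = "mappi Y", OF X.monoids(3) \<psi>],
        simp_all add: p)
  qed (use \<phi>(1) \<psi>(1) d a p in simp_all)
  have 2: "(\<phi>', \<psi>') \<in> XSExt_hom M Y X"
    unfolding XSExt_hom_iff[OF Y X]
  proof (intro conjI allI impI)
    fix u assume "srep (objB Y) (delta Y) u"
    then show "srep (objB X) (delta X) (\<phi>' u)"
      by - (rule srep_bij[where l = \<psi>' and f = "delta Y" and f' = "delta X", OF Y.monoids(2) i(1,2)],
        simp add: d', metis j(4) Y.delta_simps(1))
  next
    fix u assume "srep (objC Y) (mappi Y) u"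
    then show "srep (objC X) (mappi X) (\<psi>' u)"
      by - (rule srep_bij[where l = "\<lambda>m. m" and f = "mappi Y" and f' = "mappi X", OF Y.monoids(3) j(1,2)],
        simp_all add: p')
  qed (use i(1) j(1) d' a' p' in simp_all)
  have "compose (carrier (objB X)) \<phi>' \<phi> = mon_id (objB X)" "compose (carrier (objC X)) \<psi>' \<psi> = mon_id (objC X)"
    "compose (carrier (objB Y)) \<phi> \<phi>' = mon_id (objB Y)" "compose (carrier (objC Y)) \<psi> \<psi>' = mon_id (objC Y)"
    by (auto simp: compose_def mon_id_def fun_eq_iff)
  then show ?thesis using 1 2 by (auto simp: iso_arr_def com_XSExt_def intro!: bexI[of _ "(\<phi>', \<psi>')"])
qed

section \<open>Full Schreier internal categories\<close>

abbreviation dc :: "'u scat \<Rightarrow> 'u \<Rightarrow> 'u \<times> 'u" where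
  "dc E \<equiv> \<lambda>x. (src E x, tgt E x)"

section \<open>Elementwise calculus in a full Schreier internal category\<close>

locale full_schreier_cat =
  fixes M :: "'u monoid" and E :: "'u scat"
  assumes E: "schreier_cat_in_cc M E" and full: "R_full E"
begin

abbreviation "X1 \<equiv> arrs E"
abbreviation "X0 \<equiv> objs E"
abbreviation "d \<equiv> src E"
abbreviation "c \<equiv> tgt E"
abbreviation "e \<equiv> idn E"
abbreviation "m \<equiv> cmp E"
abbreviation "f1 \<equiv> proj (ext1 E)"
abbreviation "f0 \<equiv> proj (ext0 E)"

lemma ext: "ext1 E \<in> cc_SExt M" "ext0 E \<in> cc_SExt M"
  using E by (simp_all add: schreier_cat_in_cc_def)

lemma ext_schreier: "schreier_extension (ext1 E)" "schreier_extension (ext0 E)"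
    and base [simp]: "base (ext1 E) = M" "base (ext0 E) = M"
  using ext by (simp_all add: cc_SExt_def)

lemma monoids: "monoid X1" "monoid X0" "monoid M"
  using ext by (auto simp: cc_SExt_def schreier_extension_iff)

sublocale X1: monoid X1 by (rule monoids)
sublocale X0: monoid X0 by (rule monoids)
sublocale M: monoid M by (rule monoids)

lemma f1_hom: "f1 \<in> mon_hom X1 M" and f0_hom: "f0 \<in> mon_hom X0 M"
  using ext by (auto simp: cc_SExt_def schreier_extension_iff)

lemma internal: "internal_category X1 X0 d c e m"
  using E by (auto simp: schreier_cat_in_cc_def schreier_internal_category_def)

lemma d_hom: "d \<in> mon_hom X1 X0" and c_hom: "c \<in> mon_hom X1 X0" and e_hom: "e \<in> mon_hom X0 X1"
  and m_hom: "m \<in> mon_hom (composables X1 d c) X1"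
  using internal by (simp_all add: internal_category_def)

lemmas f1_simps [simp] = mon_homD(1-3)[OF f1_hom]
lemmas f0_simps [simp] = mon_homD(1-3)[OF f0_hom]
lemmas d_simps [simp] = mon_homD(1-3)[OF d_hom]
lemmas c_simps [simp] = mon_homD(1-3)[OF c_hom]
lemmas e_simps [simp] = mon_homD(1-3)[OF e_hom]

lemma de [simp]: "x \<in> carrier X0 \<Longrightarrow> d (e x) = x" and ce [simp]: "x \<in> carrier X0 \<Longrightarrow> c (e x) = x"
  using internal by (simp_all add: internal_category_def)

text \<open>The endpoint is a separate variable with an equation as premise, so that rewriting still
  applies once \<open>d x\<close> or \<open>c x\<close> has been simplified.\<close>

lemma m_unit [simp]:
  "x \<in> carrier X1 \<Longrightarrow> d x = y \<Longrightarrow> m (e y, x) = x" "x \<in> carrier X1 \<Longrightarrow> c x = y \<Longrightarrow> m (x, e y) = x"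
  using internal by (auto simp: internal_category_def)

text \<open>The interchange law: composition is a homomorphism on the monoid of composable
  pairs.\<close>

lemma m_mult:
  assumes "x \<in> carrier X1" "y \<in> carrier X1" "c x = d y" "x' \<in> carrier X1" "y' \<in> carrier X1" "c x' = d y'"
  shows "m (x \<otimes>\<^bsub>X1\<^esub> x', y \<otimes>\<^bsub>X1\<^esub> y') = m (x, y) \<otimes>\<^bsub>X1\<^esub> m (x', y')"
  using mon_homD(2)[OF m_hom, of "(x, y)" "(x', y')"] assms by (simp add: composables_def)

lemma f_over [simp]:
  "x \<in> carrier X1 \<Longrightarrow> f0 (d x) = f1 x" "x \<in> carrier X1 \<Longrightarrow> f0 (c x) = f1 x"
  "y \<in> carrier X0 \<Longrightarrow> f1 (e y) = f0 y"
  using E cc_morphism_iff[OF ext] cc_morphism_iff[OF ext(2,1)] by (auto simp: schreier_cat_in_cc_def)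

lemma decompose:
  "x \<in> carrier X1 \<Longrightarrow> \<exists>!a. a \<in> carrier X1 \<and> d a = \<one>\<^bsub>X0\<^esub> \<and> x = a \<otimes>\<^bsub>X1\<^esub> e (d x)"
  using E by (auto simp: schreier_cat_in_cc_def schreier_internal_category_def kernel_obj_def
      kernel_def)

lemma decompose_unique:
  assumes "a \<in> carrier X1" "d a = \<one>\<^bsub>X0\<^esub>" "b \<in> carrier X1" "d b = \<one>\<^bsub>X0\<^esub>" "x \<in> carrier X0"
    and "a \<otimes>\<^bsub>X1\<^esub> e x = b \<otimes>\<^bsub>X1\<^esub> e x"
  shows "a = b"
proof -
  have "d (a \<otimes>\<^bsub>X1\<^esub> e x) = x" "a \<otimes>\<^bsub>X1\<^esub> e x \<in> carrier X1" using assms(1,2,5) by simp_all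
  then show ?thesis using decompose[of "a \<otimes>\<^bsub>X1\<^esub> e x"] assms(1-4,6) by metis
qed

text \<open>Commutativity and cancellation of the kernel object, read on elements over 0 of the
  middle object. \<open>L\<close> is arbitrary because both extensions are needed:
  \<open>ext1 E\<close> gives the properties of \<open>B\<close>, and \<open>ext0 E\<close> those of
  \<open>N\<close>.\<close>

lemma kernel_ext:
  assumes L: "L \<in> cc_SExt M" and xyz: "x \<in> carrier (total L)" "proj L x = \<one>\<^bsub>M\<^esub>"
    "y \<in> carrier (total L)" "proj L y = \<one>\<^bsub>M\<^esub>"
  shows "x \<otimes>\<^bsub>total L\<^esub> y = y \<otimes>\<^bsub>total L\<^esub> x"
    and "z \<in> carrier (total L) \<Longrightarrow> proj L z = \<one>\<^bsub>M\<^esub> \<Longrightarrow> x \<otimes>\<^bsub>total L\<^esub> z = y \<otimes>\<^bsub>total L\<^esub> z \<Longrightarrow> x = y"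
proof -
  define k where "k = kmap L"
  have k: "k \<in> mon_hom (kern L) (total L)" and b: "base L = M"
    and bij: "bij_betw k (carrier (kern L)) {x\<in>carrier (total L). proj L x = \<one>\<^bsub>M\<^esub>}"
    using L by (auto simp: cc_SExt_iff schreier_extension_iff k_def)
  interpret K: comm_monoid_cancel "kern L" using L by (simp add: cc_SExt_iff)
  have im: "k ` carrier (kern L) = {x\<in>carrier (total L). proj L x = \<one>\<^bsub>M\<^esub>}"
    using bij by (simp add: bij_betw_def)
  then have "x \<in> k ` carrier (kern L)" "y \<in> k ` carrier (kern L)" using xyz by auto
  then obtain x' y' where xy: "x' \<in> carrier (kern L)" "y' \<in> carrier (kern L)" "x = k x'" "y = k y'"
    by blast
  then show "x \<otimes>\<^bsub>total L\<^esub> y = y \<otimes>\<^bsub>total L\<^esub> x" using mon_homD(2)[OF k] K.m_comm by metis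
  assume z: "z \<in> carrier (total L)" "proj L z = \<one>\<^bsub>M\<^esub>" "x \<otimes>\<^bsub>total L\<^esub> z = y \<otimes>\<^bsub>total L\<^esub> z"
  then have "z \<in> k ` carrier (kern L)" using im by auto
  then obtain z' where z': "z' \<in> carrier (kern L)" "z = k z'" by blast
  have "k (x' \<otimes>\<^bsub>kern L\<^esub> z') = k (y' \<otimes>\<^bsub>kern L\<^esub> z')"
    using xy z z' by (simp add: mon_homD[OF k])
  then have "x' \<otimes>\<^bsub>kern L\<^esub> z' = y' \<otimes>\<^bsub>kern L\<^esub> z'"
    using bij xy z' by (auto simp: bij_betw_def inj_on_def)
  then show "x = y" using xy z' K.r_cancel by blast
qed

lemma f0_srep: "x \<in> carrier M \<Longrightarrow> \<exists>u. srep X0 f0 u \<and> f0 u = x"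
  using ext_schreier(2) by (auto simp: schreier_extension_iff)

lemma rel_monoid_simps [simp]:
  "carrier (rel_monoid (ext0 E)) = {(x, y). x \<in> carrier X0 \<and> y \<in> carrier X0 \<and>
     (\<exists>a\<in>carrier X0. f0 a = \<one>\<^bsub>M\<^esub> \<and> y = a \<otimes>\<^bsub>X0\<^esub> x)}"
  "\<one>\<^bsub>rel_monoid (ext0 E)\<^esub> = (\<one>\<^bsub>X0\<^esub>, \<one>\<^bsub>X0\<^esub>)"
  "(x, y) \<otimes>\<^bsub>rel_monoid (ext0 E)\<^esub> (x', y') = (x \<otimes>\<^bsub>X0\<^esub> x', y \<otimes>\<^bsub>X0\<^esub> y')"
proof -
  have "kmap (ext0 E) ` carrier (kern (ext0 E)) = {x\<in>carrier X0. f0 x = \<one>\<^bsub>M\<^esub>}"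
    using ext_schreier(2) by (auto simp: schreier_extension_iff bij_betw_def)
  then have "(\<exists>a\<in>carrier (kern (ext0 E)). y = kmap (ext0 E) a \<otimes>\<^bsub>X0\<^esub> x) \<longleftrightarrow>
    (\<exists>a\<in>carrier X0. f0 a = \<one>\<^bsub>M\<^esub> \<and> y = a \<otimes>\<^bsub>X0\<^esub> x)" for x y
    by (smt (verit) image_iff mem_Collect_eq)
  then show "carrier (rel_monoid (ext0 E)) = {(x, y). x \<in> carrier X0 \<and> y \<in> carrier X0 \<and>
     (\<exists>a\<in>carrier X0. f0 a = \<one>\<^bsub>M\<^esub> \<and> y = a \<otimes>\<^bsub>X0\<^esub> x)}"
    by (simp add: rel_monoid_def)
qed (simp_all add: rel_monoid_def)

lemma dc_srep_iff: "srep (total (dc_extn E)) (proj (dc_extn E)) u \<longleftrightarrow> srep X1 (dc E) u"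
  unfolding dc_extn_def hom_extn_def by (simp, rule srep_cong[OF monoids(1)], simp)

lemma dc_schreier: "schreier_extension (dc_extn E)"
  using full by (simp add: R_full_def)

lemma dc_srep:
  assumes "x \<in> carrier X0" "a \<in> carrier X0" "f0 a = \<one>\<^bsub>M\<^esub>"
  shows "\<exists>u. srep X1 (dc E) u \<and> d u = x \<and> c u = a \<otimes>\<^bsub>X0\<^esub> x"
proof -
  have "(x, a \<otimes>\<^bsub>X0\<^esub> x) \<in> carrier (base (dc_extn E))"
    using assms by (auto simp: dc_extn_def hom_extn_def)
  then obtain u where u: "srep (total (dc_extn E)) (proj (dc_extn E)) u" "proj (dc_extn E) u = (x, a \<otimes>\<^bsub>X0\<^esub> x)"
    using dc_schreier unfolding schreier_extension_iff by blast
  then have "srep X1 (dc E) u" using dc_srep_iff by blast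
  moreover from this have "u \<in> carrier X1" by (simp add: srep_def)
  ultimately show ?thesis using u by (auto simp: dc_extn_def hom_extn_def)
qed

end

section \<open>Functors over M and the category they form\<close>

lemma RSCat_Obj: "E \<in> Obj (RSCat M) \<longleftrightarrow> full_schreier_cat M E"
  by (simp add: RSCat_def full_schreier_cat_def)

text \<open>The equational part of a morphism, kept apart from the preservation of representatives:
  for an invertible pair only this part has to be verified.\<close>

definition functor_over :: "'u scat \<Rightarrow> 'u scat \<Rightarrow> ('u \<Rightarrow> 'u) \<Rightarrow> ('u \<Rightarrow> 'u) \<Rightarrow> bool" where
  "functor_over E L h1 h0 \<longleftrightarrow> internal_functor E L h1 h0 \<and>
     (\<forall>x\<in>carrier (arrs E). proj (ext1 L) (h1 x) = proj (ext1 E) x) \<and>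
     (\<forall>x\<in>carrier (objs E). proj (ext0 L) (h0 x) = proj (ext0 E) x)"

lemma functor_over_iff:
  "functor_over E L h1 h0 \<longleftrightarrow>
     h1 \<in> mon_hom (arrs E) (arrs L) \<and> h0 \<in> mon_hom (objs E) (objs L) \<and>
     (\<forall>x\<in>carrier (arrs E). src L (h1 x) = h0 (src E x) \<and> tgt L (h1 x) = h0 (tgt E x)) \<and>
     (\<forall>x\<in>carrier (objs E). h1 (idn E x) = idn L (h0 x)) \<and>
     (\<forall>x\<in>carrier (arrs E). \<forall>y\<in>carrier (arrs E). tgt E x = src E y \<longrightarrow>
        h1 (cmp E (x, y)) = cmp L (h1 x, h1 y)) \<and>
     (\<forall>x\<in>carrier (arrs E). proj (ext1 L) (h1 x) = proj (ext1 E) x) \<and>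
     (\<forall>x\<in>carrier (objs E). proj (ext0 L) (h0 x) = proj (ext0 E) x)"
proof -
  have "(\<forall>(x, y)\<in>carrier (composables (arrs E) (src E) (tgt E)). h1 (cmp E (x, y)) = cmp L (h1 x, h1 y)) \<longleftrightarrow>
     (\<forall>x\<in>carrier (arrs E). \<forall>y\<in>carrier (arrs E). tgt E x = src E y \<longrightarrow>
        h1 (cmp E (x, y)) = cmp L (h1 x, h1 y))"
    by (auto simp: composables_def)
  then show ?thesis unfolding functor_over_def internal_functor_def by argo
qed

lemma functor_overD:
  assumes "functor_over E L h1 h0"
  shows "h1 \<in> mon_hom (arrs E) (arrs L)" "h0 \<in> mon_hom (objs E) (objs L)"
    and "\<And>x. x \<in> carrier (arrs E) \<Longrightarrow> src L (h1 x) = h0 (src E x)"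
    and "\<And>x. x \<in> carrier (arrs E) \<Longrightarrow> tgt L (h1 x) = h0 (tgt E x)"
    and "\<And>x. x \<in> carrier (objs E) \<Longrightarrow> h1 (idn E x) = idn L (h0 x)"
    and "\<And>x y. x \<in> carrier (arrs E) \<Longrightarrow> y \<in> carrier (arrs E) \<Longrightarrow> tgt E x = src E y \<Longrightarrow>
      h1 (cmp E (x, y)) = cmp L (h1 x, h1 y)"
    and "\<And>x. x \<in> carrier (arrs E) \<Longrightarrow> proj (ext1 L) (h1 x) = proj (ext1 E) x"
    and "\<And>x. x \<in> carrier (objs E) \<Longrightarrow> proj (ext0 L) (h0 x) = proj (ext0 E) x"
  using assms unfolding functor_over_iff by blast+

lemma functor_overI:
  assumes "h1 \<in> mon_hom (arrs E) (arrs L)" "h0 \<in> mon_hom (objs E) (objs L)"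
    and "\<And>x. x \<in> carrier (arrs E) \<Longrightarrow> src L (h1 x) = h0 (src E x)"
    and "\<And>x. x \<in> carrier (arrs E) \<Longrightarrow> tgt L (h1 x) = h0 (tgt E x)"
    and "\<And>x. x \<in> carrier (objs E) \<Longrightarrow> h1 (idn E x) = idn L (h0 x)"
    and "\<And>x y. x \<in> carrier (arrs E) \<Longrightarrow> y \<in> carrier (arrs E) \<Longrightarrow> tgt E x = src E y \<Longrightarrow>
      h1 (cmp E (x, y)) = cmp L (h1 x, h1 y)"
    and "\<And>x. x \<in> carrier (arrs E) \<Longrightarrow> proj (ext1 L) (h1 x) = proj (ext1 E) x"
    and "\<And>x. x \<in> carrier (objs E) \<Longrightarrow> proj (ext0 L) (h0 x) = proj (ext0 E) x"
  shows "functor_over E L h1 h0"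
  using assms unfolding functor_over_iff by blast

text \<open>If a lies over 0 then so does \<open>h0 a\<close>, hence a pair (x, a + x) goes to a
  pair of the same form with \<open>h0 a\<close> as the difference.\<close>

lemma rel_map_hom:
  assumes E: "full_schreier_cat M E" and L: "full_schreier_cat M L"
    and h: "h0 \<in> mon_hom (objs E) (objs L)"
    and f: "\<And>x. x \<in> carrier (objs E) \<Longrightarrow> proj (ext0 L) (h0 x) = proj (ext0 E) x"
  shows "rel_map E h0 \<in> mon_hom (rel_monoid (ext0 E)) (rel_monoid (ext0 L))"
proof -
  interpret E: full_schreier_cat M E by fact
  interpret L: full_schreier_cat M L by fact
  \<comment> \<open>That \<open>R_E\<close> is closed under addition is read off from fullness,
    where it is the base of a Schreier extension.\<close>
  have mon: "monoid (rel_monoid (ext0 E))"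
    using E.dc_schreier by (simp add: schreier_extension_iff dc_extn_def hom_extn_def)
  have ap: "rel_map E h0 p = (h0 (fst p), h0 (snd p))" if "p \<in> carrier (rel_monoid (ext0 E))" for p
    using that by (auto simp: rel_map_def)
  have cl: "fst p \<in> carrier (objs E) \<and> snd p \<in> carrier (objs E)"
    if "p \<in> carrier (rel_monoid (ext0 E))" for p
    using that by auto
  show ?thesis
  proof (rule mon_homI)
    fix p assume p: "p \<in> carrier (rel_monoid (ext0 E))"
    then obtain x a where "p = (x, a \<otimes>\<^bsub>objs E\<^esub> x)" and xa: "x \<in> carrier (objs E)" "a \<in> carrier (objs E)"
        "proj (ext0 E) a = \<one>\<^bsub>M\<^esub>" by auto
    then have "rel_map E h0 p = (h0 x, h0 a \<otimes>\<^bsub>objs L\<^esub> h0 x)" using p by (simp add: ap mon_homD[OF h])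
    then show "rel_map E h0 p \<in> carrier (rel_monoid (ext0 L))"
      using xa f by (auto simp: mon_homD[OF h] intro!: bexI[of _ "h0 a"])
  next
    fix p q assume pq: "p \<in> carrier (rel_monoid (ext0 E))" "q \<in> carrier (rel_monoid (ext0 E))"
    moreover have "p \<otimes>\<^bsub>rel_monoid (ext0 E)\<^esub> q \<in> carrier (rel_monoid (ext0 E))"
      using mon pq by (rule monoid.m_closed)
    ultimately show "rel_map E h0 (p \<otimes>\<^bsub>rel_monoid (ext0 E)\<^esub> q) =
        rel_map E h0 p \<otimes>\<^bsub>rel_monoid (ext0 L)\<^esub> rel_map E h0 q"
      using cl[OF pq(1)] cl[OF pq(2)]
      by (cases p; cases q) (auto simp: ap mon_homD[OF h] simp del: E.rel_monoid_simps(1))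
  next
    have "\<one>\<^bsub>rel_monoid (ext0 E)\<^esub> \<in> carrier (rel_monoid (ext0 E))" by (rule monoid.one_closed[OF mon])
    then show "rel_map E h0 \<one>\<^bsub>rel_monoid (ext0 E)\<^esub> = \<one>\<^bsub>rel_monoid (ext0 L)\<^esub>"
      by (simp add: ap mon_homD[OF h] del: E.rel_monoid_simps(1))
  qed (simp add: rel_map_def)
qed

text \<open>The square over \<open>R_E\<close> commutes because a functor preserves domain and
  codomain, and its base map is a homomorphism by \<open>rel_map_hom\<close>. What fullness adds to
  the conditions on a functor over M is therefore only the preservation of representatives for <d,
  c>.\<close>

lemma RSCat_hom_iff:
  assumes E: "full_schreier_cat M E" and L: "full_schreier_cat M L"
  shows "(h1, h0) \<in> RSCat_hom E L \<longleftrightarrow> functor_over E L h1 h0 \<and>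
     (\<forall>u. srep (arrs E) (proj (ext1 E)) u \<longrightarrow> srep (arrs L) (proj (ext1 L)) (h1 u)) \<and>
     (\<forall>u. srep (objs E) (proj (ext0 E)) u \<longrightarrow> srep (objs L) (proj (ext0 L)) (h0 u)) \<and>
     (\<forall>u. srep (arrs E) (dc E) u \<longrightarrow> srep (arrs L) (dc L) (h1 u))"
proof -
  interpret E: full_schreier_cat M E by fact
  interpret L: full_schreier_cat M L by fact
  have dc: "(\<exists>g. schreier_morphism (dc_extn E) (dc_extn L) g h1 (rel_map E h0)) \<longleftrightarrow>
    (\<forall>u. srep (arrs E) (dc E) u \<longrightarrow> srep (arrs L) (dc L) (h1 u))" if f: "functor_over E L h1 h0"
  proof -
    note f = functor_overD[OF f]
    have "rel_map E h0 \<in> mon_hom (base (dc_extn E)) (base (dc_extn L))"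
      using rel_map_hom[OF E L] f by (simp add: dc_extn_def hom_extn_def)
    moreover have "h1 \<in> mon_hom (total (dc_extn E)) (total (dc_extn L))"
      using f by (simp add: dc_extn_def hom_extn_def)
    moreover have "proj (dc_extn L) (h1 x) = rel_map E h0 (proj (dc_extn E) x)"
      if "x \<in> carrier (total (dc_extn E))" for x
    proof -
      have x: "x \<in> carrier (arrs E)" using that by (simp add: dc_extn_def hom_extn_def)
      \<comment> \<open>\<open>rel_map\<close> can be evaluated only on \<open>R_E\<close>; that the
        pair of endpoints lies there is part of \<open>dc_extn E\<close> being an extension.\<close>
      have "proj (dc_extn E) \<in> mon_hom (total (dc_extn E)) (base (dc_extn E))"
        using E.dc_schreier by (simp add: schreier_extension_iff)
      then have "(src E x, tgt E x) \<in> carrier (rel_monoid (ext0 E))"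
        using mon_homD(1) that x by (fastforce simp add: dc_extn_def hom_extn_def)
      then show ?thesis using x f
        by (simp add: dc_extn_def hom_extn_def mon_homD[OF f(1)] rel_map_def del: E.rel_monoid_simps)
    qed
    ultimately show ?thesis
      unfolding schreier_morphism_iff[OF E.dc_schreier L.dc_schreier] E.dc_srep_iff L.dc_srep_iff by blast
  qed
  show ?thesis
    unfolding RSCat_hom_def mem_Collect_eq prod.case cc_morphism_iff[OF E.ext(1) L.ext(1)]
      cc_morphism_iff[OF E.ext(2) L.ext(2)]
    using dc[unfolded functor_over_def] by (auto simp: functor_over_def internal_functor_def)
qed

lemma functor_over_id: "full_schreier_cat M E \<Longrightarrow> functor_over E E (mon_id (arrs E)) (mon_id (objs E))"
proof -
  assume "full_schreier_cat M E"
  then interpret E: full_schreier_cat M E .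
  show ?thesis
  proof (rule functor_overI)
    fix x y assume "x \<in> carrier E.X1" "y \<in> carrier E.X1" "E.c x = E.d y"
    moreover from this have "E.m (x, y) \<in> carrier E.X1"
      by (intro mon_homD(1)[OF E.m_hom]) (simp add: composables_def)
    ultimately show "mon_id E.X1 (E.m (x, y)) = E.m (mon_id E.X1 x, mon_id E.X1 y)" by simp
  qed (auto simp: mon_id_hom E.monoids)
qed

lemma functor_over_comp:
  assumes E: "full_schreier_cat M E"
    and f: "functor_over E L h1 h0" and g: "functor_over L P g1 g0"
  shows "functor_over E P (compose (carrier (arrs E)) g1 h1) (compose (carrier (objs E)) g0 h0)"
proof -
  interpret E: full_schreier_cat M E by fact
  note f = functor_overD[OF f] and g = functor_overD[OF g]
  note [simp] = mon_homD(1)[OF f(1)] mon_homD(1)[OF f(2)]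
  show ?thesis
  proof (rule functor_overI)
    fix x y assume xy: "x \<in> carrier E.X1" "y \<in> carrier E.X1" "E.c x = E.d y"
    moreover from this have "E.m (x, y) \<in> carrier E.X1"
      by (intro mon_homD(1)[OF E.m_hom]) (simp add: composables_def)
    ultimately show "compose (carrier E.X1) g1 h1 (E.m (x, y)) =
       cmp P (compose (carrier E.X1) g1 h1 x, compose (carrier E.X1) g1 h1 y)"
      using f(6)[OF xy] g(6)[of "h1 x" "h1 y"] f(3,4) by (simp add: compose_def)
  qed (use mon_hom_compose E.monoids f g in \<open>auto simp: compose_def\<close>)
qed

lemma RSCat_hom_id:
  assumes E: "full_schreier_cat M E"
  shows "(mon_id (arrs E), mon_id (objs E)) \<in> RSCat_hom E E"
  unfolding RSCat_hom_iff[OF E E] using functor_over_id[OF E] by (auto simp: srep_def)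

lemma RSCat_hom_comp:
  assumes E: "full_schreier_cat M E" and L: "full_schreier_cat M L" and P: "full_schreier_cat M P"
    and f: "(h1, h0) \<in> RSCat_hom E L" and g: "(g1, g0) \<in> RSCat_hom L P"
  shows "(compose (carrier (arrs E)) g1 h1, compose (carrier (objs E)) g0 h0) \<in> RSCat_hom E P"
proof -
  show ?thesis
    using f g functor_over_comp[OF E, of L h1 h0 P g1 g0]
    unfolding RSCat_hom_iff[OF E P] RSCat_hom_iff[OF E L] RSCat_hom_iff[OF L P]
    by (auto simp: compose_eq[OF srep_closed])
qed

lemma category_RSCat: "category (RSCat M)"
proof -
  have H: "Hom (RSCat M) = RSCat_hom"
    "Id (RSCat M) = (\<lambda>E. (mon_id (arrs E), mon_id (objs E)))"
    "\<And>X Y Z p q r s. Comp (RSCat M) X Y Z (p, q) (r, s) =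
      (compose (carrier (arrs X)) p r, compose (carrier (objs X)) q s)"
    by (simp_all add: RSCat_def)
  have h: "h1 \<in> mon_hom (arrs E) (arrs L) \<and> h0 \<in> mon_hom (objs E) (objs L)"
    if "(h1, h0) \<in> RSCat_hom E L" for E L :: "'a scat" and h1 h0
    using that by (auto simp: RSCat_hom_def internal_functor_def)
  show ?thesis
    unfolding category_def RSCat_Obj H
  proof (intro conjI ballI)
    fix X Y Z f g
    assume "X \<in> Obj (RSCat M)" "Y \<in> Obj (RSCat M)" "Z \<in> Obj (RSCat M)"
      and "f \<in> RSCat_hom X Y" "g \<in> RSCat_hom Y Z"
    then show "Comp (RSCat M) X Y Z g f \<in> RSCat_hom X Z"
      by (cases f, cases g) (simp add: H RSCat_Obj RSCat_hom_comp)
  qed (auto simp: H RSCat_Obj RSCat_hom_id dest!: h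
      intro: compose_mon_id_left compose_mon_id_right compose_assoc_mon_hom)
qed

text \<open>\<open>srep_bij\<close> handles all three extensions: the comparison of bases is the
  identity over M, and the square of \<open>h0\<close> for <d, c>, where injectivity of
  \<open>h0\<close> separates pairs of endpoints.\<close>

lemma bij_functor_over_hom:
  assumes E: "full_schreier_cat M E" and L: "full_schreier_cat M L"
    and f: "functor_over E L h1 h0"
    and b: "bij_betw h1 (carrier (arrs E)) (carrier (arrs L))" "inj_on h0 (carrier (objs E))"
      "bij_betw h0 (carrier (objs E)) (carrier (objs L))"
  shows "(h1, h0) \<in> RSCat_hom E L"
proof -
  interpret E: full_schreier_cat M E by fact
  interpret L: full_schreier_cat M L by fact
  note F = functor_overD[OF f]
  show ?thesis unfolding RSCat_hom_iff[OF E L]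
  proof (intro conjI allI impI)
    fix u assume "srep (arrs E) (proj (ext1 E)) u"
    then show "srep (arrs L) (proj (ext1 L)) (h1 u)"
      by - (rule srep_bij[where l = "\<lambda>m. m" and f = "E.f1" and f' = "L.f1", OF E.monoids(1) F(1) b(1)],
        simp_all add: F(7))
  next
    fix u assume "srep (objs E) (proj (ext0 E)) u"
    then show "srep (objs L) (proj (ext0 L)) (h0 u)"
      by - (rule srep_bij[where l = "\<lambda>m. m" and f = "E.f0" and f' = "L.f0", OF E.monoids(2) F(2) b(3)],
        simp_all add: F(8))
  next
    fix u assume "srep (arrs E) (dc E) u"
    then show "srep (arrs L) (dc L) (h1 u)"
      by - (rule srep_bij[where l = "\<lambda>(x, y). (h0 x, h0 y)" and f = "dc E" and f' = "dc L", OF E.monoids(1) F(1) b(1)],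
        use F(3,4) b(2) in \<open>auto simp: inj_on_def\<close>)
  qed (rule f)
qed

text \<open>The inverse functions again form a functor over M; compatibility with identities and
  composition is checked after applying the injection \<open>h1\<close>. Both directions are then
  morphisms by \<open>bij_functor_over_hom\<close>.\<close>

lemma iso_arr_RSCat:
  assumes E: "full_schreier_cat M E" and L: "full_schreier_cat M L"
    and f: "functor_over E L h1 h0"
    and b1: "bij_betw h1 (carrier (arrs E)) (carrier (arrs L))"
    and b0: "bij_betw h0 (carrier (objs E)) (carrier (objs L))"
  shows "iso_arr (RSCat M) E L (h1, h0)"
proof -
  interpret E: full_schreier_cat M E by fact
  interpret L: full_schreier_cat M L by fact
  note F = functor_overD[OF f]
  define g1 where "g1 = (\<lambda>y\<in>carrier (arrs L). inv_into (carrier (arrs E)) h1 y)"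
  define g0 where "g0 = (\<lambda>y\<in>carrier (objs L). inv_into (carrier (objs E)) h0 y)"
  note i = mon_hom_inv[OF F(1) b1 E.monoids(1) L.monoids(1), folded g1_def]
  note j = mon_hom_inv[OF F(2) b0 E.monoids(2) L.monoids(2), folded g0_def]
  note [simp] = i(3,4) j(3,4) mon_homD(1)[OF i(1)] mon_homD(1)[OF j(1)]
  have inj0: "\<And>x y. x \<in> carrier E.X0 \<Longrightarrow> y \<in> carrier E.X0 \<Longrightarrow> h0 x = h0 y \<Longrightarrow> x = y"
    using j(3) by metis
  have inj1: "\<And>x y. x \<in> carrier E.X1 \<Longrightarrow> y \<in> carrier E.X1 \<Longrightarrow> h1 x = h1 y \<Longrightarrow> x = y"
    using i(3) by metis
  have s: "E.d (g1 x) = g0 (L.d x)" "E.c (g1 x) = g0 (L.c x)" if "x \<in> carrier L.X1" for x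
  proof -
    have "h0 (E.d (g1 x)) = L.d x" "h0 (E.c (g1 x)) = L.c x" using F(3,4)[of "g1 x"] that by simp_all
    moreover have "E.d (g1 x) = g0 (h0 (E.d (g1 x)))" "E.c (g1 x) = g0 (h0 (E.c (g1 x)))"
      using that by simp_all
    ultimately show "E.d (g1 x) = g0 (L.d x)" "E.c (g1 x) = g0 (L.c x)" by simp_all
  qed
  have "functor_over L E g1 g0"
  proof (rule functor_overI)
    fix x assume "x \<in> carrier L.X0"
    then show "g1 (L.e x) = E.e (g0 x)" using F(5)[of "g0 x"] by (intro inj1[of "g1 (L.e x)"]) simp_all
  next
    fix x y assume xy: "x \<in> carrier L.X1" "y \<in> carrier L.X1" "L.c x = L.d y"
    then have *: "L.m (x, y) \<in> carrier L.X1" "E.m (g1 x, g1 y) \<in> carrier E.X1"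
      by (auto intro!: mon_homD(1)[OF L.m_hom] mon_homD(1)[OF E.m_hom] simp: composables_def s)
    have "h1 (E.m (g1 x, g1 y)) = L.m (x, y)" using F(6)[of "g1 x" "g1 y"] xy s by simp
    then show "g1 (L.m (x, y)) = E.m (g1 x, g1 y)" using * by (intro inj1[of "g1 (L.m (x, y))"]) simp_all
  next
    fix x assume x: "x \<in> carrier L.X1"
    show "E.f1 (g1 x) = L.f1 x" using F(7)[of "g1 x"] x by simp
  next
    fix x assume x: "x \<in> carrier L.X0"
    show "E.f0 (g0 x) = L.f0 x" using F(8)[of "g0 x"] x by simp
  qed (use i j s in auto)
  then have "(g1, g0) \<in> RSCat_hom L E"
    using bij_functor_over_hom[OF L E] i j by (auto simp: bij_betw_def)
  moreover have "(h1, h0) \<in> RSCat_hom E L"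
    using bij_functor_over_hom[OF E L f b1 _ b0] b0 by (auto simp: bij_betw_def)
  moreover have "compose (carrier E.X1) g1 h1 = mon_id E.X1" "compose (carrier E.X0) g0 h0 = mon_id E.X0"
    "compose (carrier L.X1) h1 g1 = mon_id L.X1" "compose (carrier L.X0) h0 g0 = mon_id L.X0"
    by (auto simp: compose_def mon_id_def fun_eq_iff)
  ultimately show ?thesis by (auto simp: iso_arr_def RSCat_def intro!: bexI[of _ "(g1, g0)"])
qed

section \<open>From internal categories to crossed extensions\<close>

lemma kernel_obj_simps [simp]:
  "carrier (kernel_obj X f M) = {x \<in> carrier X. f x = \<one>\<^bsub>M\<^esub>}"
  "\<one>\<^bsub>kernel_obj X f M\<^esub> = \<one>\<^bsub>X\<^esub>" "x \<otimes>\<^bsub>kernel_obj X f M\<^esub> y = x \<otimes>\<^bsub>X\<^esub> y"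
  by (simp_all add: kernel_obj_def kernel_def)

lemma monoid_kernel_obj:
  assumes X: "monoid X" and M: "monoid M" and f: "f \<in> mon_hom X M"
  shows "monoid (kernel_obj X f M)"
proof -
  interpret X: monoid X by fact
  interpret M: monoid M by fact
  show ?thesis by (rule monoidI) (auto simp: mon_homD[OF f] X.m_assoc)
qed

lemma mon_id_kernel_obj:
  assumes X: "monoid X" and M: "monoid M" and f: "f \<in> mon_hom X M"
  shows "mon_id (kernel_obj X f M) \<in> mon_hom (kernel_obj X f M) X"
    and "bij_betw (mon_id (kernel_obj X f M)) (carrier (kernel_obj X f M)) {x \<in> carrier X. f x = \<one>\<^bsub>M\<^esub>}"
proof -
  interpret X: monoid X by fact
  interpret M: monoid M by fact
  show "mon_id (kernel_obj X f M) \<in> mon_hom (kernel_obj X f M) X"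
    by (rule mon_homI) (auto simp: mon_id_def mon_homD[OF f])
  show "bij_betw (mon_id (kernel_obj X f M)) (carrier (kernel_obj X f M)) {x \<in> carrier X. f x = \<one>\<^bsub>M\<^esub>}"
    by (auto simp: mon_id_def bij_betw_def inj_on_def)
qed

section \<open>Action, Peiffer identity and exactness for the image of an object under F\<close>

context full_schreier_cat
begin

lemma F_B_simps [simp]:
  "carrier (F_B E) = {a \<in> carrier X1. d a = \<one>\<^bsub>X0\<^esub>}"
  "\<one>\<^bsub>F_B E\<^esub> = \<one>\<^bsub>X1\<^esub>" "x \<otimes>\<^bsub>F_B E\<^esub> y = x \<otimes>\<^bsub>X1\<^esub> y"
  by (simp_all add: F_B_def)

lemma F_delta_apply [simp]: "a \<in> carrier X1 \<Longrightarrow> d a = \<one>\<^bsub>X0\<^esub> \<Longrightarrow> F_delta E a = c a"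
  by (simp add: F_delta_def)

lemma f1_B [simp]: "a \<in> carrier X1 \<Longrightarrow> d a = \<one>\<^bsub>X0\<^esub> \<Longrightarrow> f1 a = \<one>\<^bsub>M\<^esub>"
  using f_over(1)[of a] by simp

lemma F_B_comm:
  assumes "a \<in> carrier X1" "d a = \<one>\<^bsub>X0\<^esub>" "b \<in> carrier X1" "d b = \<one>\<^bsub>X0\<^esub>"
  shows "a \<otimes>\<^bsub>X1\<^esub> b = b \<otimes>\<^bsub>X1\<^esub> a"
  by (rule kernel_ext(1)[OF ext(1)]) (use assms in simp_all)

lemma F_B_cancel:
  assumes "a \<in> carrier X1" "d a = \<one>\<^bsub>X0\<^esub>" "b \<in> carrier X1" "d b = \<one>\<^bsub>X0\<^esub>"
    "c' \<in> carrier X1" "d c' = \<one>\<^bsub>X0\<^esub>" "a \<otimes>\<^bsub>X1\<^esub> c' = b \<otimes>\<^bsub>X1\<^esub> c'"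
  shows "a = b"
  by (rule kernel_ext(2)[OF ext(1), where z = c']) (use assms in simp_all)

lemma F_B_comm_monoid: "comm_monoid (F_B E)"
proof -
  have "monoid (F_B E)" unfolding F_B_def by (rule monoid_kernel_obj[OF monoids(1,2) d_hom])
  then show ?thesis by (rule monoid.monoid_comm_monoidI) (auto intro: F_B_comm)
qed

text \<open>The arrow e x + a has domain x, so its Schreier decomposition ends in e x; the action is
  its kernel part. The uniqueness clause is the instrument for every later identity about the
  action.\<close>

lemma F_act_spec:
  assumes x: "x \<in> carrier X0" and a: "a \<in> carrier X1" "d a = \<one>\<^bsub>X0\<^esub>"
  shows F_act_closed: "F_act E x a \<in> carrier X1" "d (F_act E x a) = \<one>\<^bsub>X0\<^esub>"
    and F_act_eq: "e x \<otimes>\<^bsub>X1\<^esub> a = F_act E x a \<otimes>\<^bsub>X1\<^esub> e x"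
    and F_act_unique: "a' \<in> carrier X1 \<Longrightarrow> d a' = \<one>\<^bsub>X0\<^esub> \<Longrightarrow> e x \<otimes>\<^bsub>X1\<^esub> a = a' \<otimes>\<^bsub>X1\<^esub> e x \<Longrightarrow> F_act E x a = a'"
proof -
  have "d (e x \<otimes>\<^bsub>X1\<^esub> a) = x" "e x \<otimes>\<^bsub>X1\<^esub> a \<in> carrier X1" using x a by simp_all
  then have ex: "\<exists>!a'. a' \<in> carrier (F_B E) \<and> e x \<otimes>\<^bsub>X1\<^esub> a = a' \<otimes>\<^bsub>X1\<^esub> e x"
    using decompose[of "e x \<otimes>\<^bsub>X1\<^esub> a"] by simp
  have F: "F_act E x a = (THE a'. a' \<in> carrier (F_B E) \<and> e x \<otimes>\<^bsub>X1\<^esub> a = a' \<otimes>\<^bsub>X1\<^esub> e x)"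
    using x a by (simp add: F_act_def)
  have t: "F_act E x a \<in> carrier (F_B E) \<and> e x \<otimes>\<^bsub>X1\<^esub> a = F_act E x a \<otimes>\<^bsub>X1\<^esub> e x"
    unfolding F by (rule theI'[OF ex])
  then show "F_act E x a \<in> carrier X1" "d (F_act E x a) = \<one>\<^bsub>X0\<^esub>"
    "e x \<otimes>\<^bsub>X1\<^esub> a = F_act E x a \<otimes>\<^bsub>X1\<^esub> e x" by simp_all
  show "F_act E x a = a'" if "a' \<in> carrier X1" "d a' = \<one>\<^bsub>X0\<^esub>" "e x \<otimes>\<^bsub>X1\<^esub> a = a' \<otimes>\<^bsub>X1\<^esub> e x"
  proof -
    have "a' \<in> carrier (F_B E)" using that by simp
    then show ?thesis using ex t that(3) by blast
  qed
qed

lemma F_act_ext: "F_act E \<in> extensional (carrier X0)" "x \<in> carrier X0 \<Longrightarrow> F_act E x \<in> extensional (carrier (F_B E))"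
  by (simp_all add: F_act_def)

text \<open>Moving an identity arrow past a sum, or two identity arrows past one element, one
  summand at a time produces a kernel element in front of the identity; \<open>F_act_unique\<close>
  names it.\<close>

lemma F_act_hom: "F_act E \<in> mon_hom X0 (End_monoid (F_B E))"
proof (rule mon_homI)
  fix x assume x: "x \<in> carrier X0"
  have "F_act E x \<in> mon_hom (F_B E) (F_B E)"
  proof (rule mon_homI)
    fix a b assume "a \<in> carrier (F_B E)" "b \<in> carrier (F_B E)"
    then have a: "a \<in> carrier X1" "d a = \<one>\<^bsub>X0\<^esub>" and b: "b \<in> carrier X1" "d b = \<one>\<^bsub>X0\<^esub>" by simp_all
    note A = F_act_spec(1-3)[OF x a] and B = F_act_spec(1-3)[OF x b]
    have "e x \<otimes>\<^bsub>X1\<^esub> (a \<otimes>\<^bsub>X1\<^esub> b) = F_act E x a \<otimes>\<^bsub>X1\<^esub> (e x \<otimes>\<^bsub>X1\<^esub> b)"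
      using x a b A by (metis X1.m_assoc e_simps(1))
    also have "\<dots> = (F_act E x a \<otimes>\<^bsub>X1\<^esub> F_act E x b) \<otimes>\<^bsub>X1\<^esub> e x"
      using x A B by (simp add: X1.m_assoc)
    finally have "F_act E x (a \<otimes>\<^bsub>X1\<^esub> b) = F_act E x a \<otimes>\<^bsub>X1\<^esub> F_act E x b"
      by (intro F_act_unique) (use x a b A B in simp_all)
    then show "F_act E x (a \<otimes>\<^bsub>F_B E\<^esub> b) = F_act E x a \<otimes>\<^bsub>F_B E\<^esub> F_act E x b" by simp
  next
    show "F_act E x \<one>\<^bsub>F_B E\<^esub> = \<one>\<^bsub>F_B E\<^esub>"
      using x by (simp add: F_act_unique)
  qed (use F_act_closed[OF x] F_act_ext(2)[OF x] in simp_all)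
  then show "F_act E x \<in> carrier (End_monoid (F_B E))" by (simp add: End_monoid_def)
next
  fix x y assume x: "x \<in> carrier X0" and y: "y \<in> carrier X0"
  show "F_act E (x \<otimes>\<^bsub>X0\<^esub> y) = F_act E x \<otimes>\<^bsub>End_monoid (F_B E)\<^esub> F_act E y"
  proof (rule extensionalityI)
    fix a assume "a \<in> carrier (F_B E)"
    then have a: "a \<in> carrier X1" "d a = \<one>\<^bsub>X0\<^esub>" by simp_all
    note Y = F_act_spec(1-3)[OF y a]
    note X = F_act_spec(1-3)[OF x Y(1,2)]
    have "e (x \<otimes>\<^bsub>X0\<^esub> y) \<otimes>\<^bsub>X1\<^esub> a = (e x \<otimes>\<^bsub>X1\<^esub> F_act E y a) \<otimes>\<^bsub>X1\<^esub> e y"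
      using x y a Y by (simp add: X1.m_assoc)
    also have "\<dots> = F_act E x (F_act E y a) \<otimes>\<^bsub>X1\<^esub> e (x \<otimes>\<^bsub>X0\<^esub> y)"
      using x y X by (simp add: X1.m_assoc)
    finally have "F_act E (x \<otimes>\<^bsub>X0\<^esub> y) a = F_act E x (F_act E y a)"
      by (intro F_act_unique) (use x y a X Y in simp_all)
    then show "F_act E (x \<otimes>\<^bsub>X0\<^esub> y) a = (F_act E x \<otimes>\<^bsub>End_monoid (F_B E)\<^esub> F_act E y) a"
      using a by (simp add: End_monoid_def compose_def)
  qed (use F_act_ext(2) x y in \<open>auto simp: End_monoid_def\<close>)
next
  show "F_act E \<one>\<^bsub>X0\<^esub> = \<one>\<^bsub>End_monoid (F_B E)\<^esub>"
  proof (rule extensionalityI)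
    fix a assume "a \<in> carrier (F_B E)"
    then have a: "a \<in> carrier X1" "d a = \<one>\<^bsub>X0\<^esub>" by simp_all
    then have "F_act E \<one>\<^bsub>X0\<^esub> a = a" by (intro F_act_unique) simp_all
    then show "F_act E \<one>\<^bsub>X0\<^esub> a = \<one>\<^bsub>End_monoid (F_B E)\<^esub> a" using a by (simp add: End_monoid_def)
  qed (use F_act_ext(2) in \<open>auto simp: End_monoid_def mon_id_def\<close>)
qed (rule F_act_ext)

text \<open>The interchange law applied to \<open>(b, e (c b)) + (0, b')\<close>, evaluated in two ways.\<close>

lemma F_peiffer:
  assumes b: "b \<in> carrier X1" "d b = \<one>\<^bsub>X0\<^esub>" and b': "b' \<in> carrier X1" "d b' = \<one>\<^bsub>X0\<^esub>"
  shows "F_act E (c b) b' \<otimes>\<^bsub>X1\<^esub> b = b \<otimes>\<^bsub>X1\<^esub> b'"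
proof -
  let ?a = "F_act E (c b) b'"
  have cb: "c b \<in> carrier X0" using b by simp
  note A = F_act_spec(1-3)[OF cb b']
  have u: "m (\<one>\<^bsub>X1\<^esub>, b') = b'" "m (\<one>\<^bsub>X1\<^esub>, ?a) = ?a" "m (b, e (c b)) = b"
    using m_unit(1)[OF b'] m_unit(1)[OF A(1,2)] m_unit(2)[OF b(1) refl] by simp_all
  have "b \<otimes>\<^bsub>X1\<^esub> b' = m (b \<otimes>\<^bsub>X1\<^esub> \<one>\<^bsub>X1\<^esub>, e (c b) \<otimes>\<^bsub>X1\<^esub> b')"
    using m_mult[of b "e (c b)" "\<one>\<^bsub>X1\<^esub>" b'] b b' u by simp
  \<comment> \<open>By definition of the action e (c b) + b' = ?a + e (c b), so the same composable
    pair is also (0, ?a) + (b, e (c b)).\<close>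
  also have "\<dots> = m (\<one>\<^bsub>X1\<^esub> \<otimes>\<^bsub>X1\<^esub> b, ?a \<otimes>\<^bsub>X1\<^esub> e (c b))" using A b by simp
  also have "\<dots> = ?a \<otimes>\<^bsub>X1\<^esub> b"
    using m_mult[of "\<one>\<^bsub>X1\<^esub>" ?a b "e (c b)"] b A u by simp
  finally show ?thesis by simp
qed

text \<open>Apply \<open>c\<close> to the equation that defines the action; \<open>c\<close> undoes
  \<open>e\<close>.\<close>

lemma F_crossed: "x \<in> carrier X0 \<Longrightarrow> a \<in> carrier X1 \<Longrightarrow> d a = \<one>\<^bsub>X0\<^esub> \<Longrightarrow> c (F_act E x a) \<otimes>\<^bsub>X0\<^esub> x = x \<otimes>\<^bsub>X0\<^esub> c a"
  using arg_cong[OF F_act_eq, of x a c] F_act_closed(1)[of x a] by simp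

lemma F_delta_hom: "F_delta E \<in> mon_hom (F_B E) X0"
  by (rule mon_homI) (auto simp: F_delta_def)

lemma F_delta_image: "F_delta E ` carrier (F_B E) = {x \<in> carrier X0. f0 x = \<one>\<^bsub>M\<^esub>}"
proof
  show "F_delta E ` carrier (F_B E) \<subseteq> {x \<in> carrier X0. f0 x = \<one>\<^bsub>M\<^esub>}" by auto
  show "{x \<in> carrier X0. f0 x = \<one>\<^bsub>M\<^esub>} \<subseteq> F_delta E ` carrier (F_B E)"
  proof clarify
    fix x assume x: "x \<in> carrier X0" "f0 x = \<one>\<^bsub>M\<^esub>"
    then obtain u where u: "srep X1 (dc E) u" "d u = \<one>\<^bsub>X0\<^esub>" "c u = x" using dc_srep[of "\<one>\<^bsub>X0\<^esub>" x] by auto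
    then show "x \<in> F_delta E ` carrier (F_B E)"
      using srep_closed[OF u(1)] by (intro image_eqI[of _ _ u]) auto
  qed
qed

text \<open>Among arrows with domain 0 the fibres of \<open>\<delta>\<close> and of <d, c> coincide,
  and the kernel elements of both decompositions are the arrows from 0 to 0. So fullness provides
  representatives for \<open>\<delta>\<close>, and functors that preserve one kind preserve the
  other.\<close>

lemma F_delta_srep: "srep (F_B E) (F_delta E) u \<longleftrightarrow> srep X1 (dc E) u \<and> d u = \<one>\<^bsub>X0\<^esub>"
proof (cases "u \<in> carrier X1 \<and> d u = \<one>\<^bsub>X0\<^esub>")
  case True
  have 1: "b \<in> carrier (F_B E) \<and> F_delta E b = F_delta E \<one>\<^bsub>F_B E\<^esub> \<and> x = b \<otimes>\<^bsub>F_B E\<^esub> u \<longleftrightarrow>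
      b \<in> carrier X1 \<and> dc E b = dc E \<one>\<^bsub>X1\<^esub> \<and> x = b \<otimes>\<^bsub>X1\<^esub> u" for x b
    by auto
  have 2: "x \<in> carrier (F_B E) \<and> F_delta E x = F_delta E u \<longleftrightarrow> x \<in> carrier X1 \<and> dc E x = dc E u" for x
    using True by auto
  have "u \<in> carrier (F_B E)" using True by simp
  then show ?thesis unfolding srep_def 1 using 2 True by blast
next
  case False
  then have "u \<notin> carrier (F_B E)" by simp
  then show ?thesis using False unfolding srep_def by blast
qed

text \<open>With the image of \<open>\<delta>\<close> equal to the whole kernel, the right extension
  is \<open>ext0 E\<close> with its kernel replaced by the canonical one.\<close>

lemma F_N: "objN (F_obj E) = kernel_obj X0 f0 M"
proof -
  have "objN (F_obj E) = X0\<lparr>carrier := F_delta E ` carrier (F_B E)\<rparr>" by (simp add: objN_def F_obj_def)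
  also have "\<dots> = kernel_obj X0 f0 M" unfolding F_delta_image by (simp add: kernel_obj_def kernel_def)
  finally show ?thesis .
qed

lemma F_crossed_schreier: "crossed_schreier M (F_obj E)"
proof (rule crossed_schreier.intro)
  let ?X = "F_obj E"
  have s [simp]: "objA ?X = kernel_obj (F_B E) (F_delta E) X0" "mapk ?X = mon_id (kernel_obj (F_B E) (F_delta E) X0)"
    "objB ?X = F_B E" "delta ?X = F_delta E" "objC ?X = X0" "mappi ?X = f0" "act ?X = F_act E"
    by (simp_all add: F_obj_def)
  interpret B: comm_monoid "F_B E" by (rule F_B_comm_monoid)
  show "comm_monoid (objB ?X)" using F_B_comm_monoid by simp
  have N: "monoid (kernel_obj X0 f0 M)" by (rule monoid_kernel_obj[OF monoids(2,3) f0_hom])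
  note mB = B.monoid_axioms
  note A = monoid_kernel_obj[OF mB monoids(2) F_delta_hom]
    and k = mon_id_kernel_obj[OF mB monoids(2) F_delta_hom]
  have dN: "F_delta E \<in> mon_hom (F_B E) (kernel_obj X0 f0 M)"
    using F_delta_hom by (auto simp: mon_hom_iff)
  have rc: "right_cancellative (kernel_obj X0 f0 M)"
    unfolding right_cancellative_def
  proof (intro ballI impI)
    fix a b z assume "a \<in> carrier (kernel_obj X0 f0 M)" "b \<in> carrier (kernel_obj X0 f0 M)"
      "z \<in> carrier (kernel_obj X0 f0 M)" "a \<otimes>\<^bsub>kernel_obj X0 f0 M\<^esub> z = b \<otimes>\<^bsub>kernel_obj X0 f0 M\<^esub> z"
    then show "a = b" by (intro kernel_ext(2)[OF ext(2), of a b z]) simp_all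
  qed
  have ra: "right_cancellative (objA ?X)"
    unfolding right_cancellative_def
  proof (intro ballI impI)
    fix a b z assume "a \<in> carrier (objA ?X)" "b \<in> carrier (objA ?X)" "z \<in> carrier (objA ?X)"
      "a \<otimes>\<^bsub>objA ?X\<^esub> z = b \<otimes>\<^bsub>objA ?X\<^esub> z"
    then show "a = b" by (intro F_B_cancel[of a b z]) simp_all
  qed
  have r: "schreier_extension (right_extn M ?X)"
    unfolding schreier_extension_iff right_extn_def F_N
    using N monoids f0_hom mon_id_kernel_obj[OF monoids(2,3) f0_hom] f0_srep by simp
  have l: "schreier_extension (left_extn ?X)"
    unfolding schreier_extension_iff left_extn_def F_N
  proof (simp del: F_B_simps kernel_obj_simps(1), intro conjI ballI)
    fix n assume "n \<in> carrier (kernel_obj X0 f0 M)"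
    \<comment> \<open>An arrow from 0 to \<open>n\<close> that represents the pair (0, n) serves as
      representative of \<open>n\<close> for \<open>\<delta>\<close>.\<close>
    then obtain u where u: "srep X1 (dc E) u" "d u = \<one>\<^bsub>X0\<^esub>" "c u = n"
      using dc_srep[of "\<one>\<^bsub>X0\<^esub>" n] by auto
    then have "srep (F_B E) (F_delta E) u" unfolding F_delta_srep by simp
    then show "\<exists>u. srep (F_B E) (F_delta E) u \<and> F_delta E u = n" using u srep_closed[OF u(1)] by auto
  qed (use A k N mB dN in \<open>simp_all del: F_B_simps\<close>)
  \<comment> \<open>The criterion sees only the image of the first map, so \<open>\<delta>\<close>
    and the inclusion of its image are treated alike.\<close>
  have cok: "is_cokernel (F_B E) (F_delta E) X0 f0 M"
    by (rule is_cokernelI[OF monoids(2,3) f0_hom F_delta_image f0_srep])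
  have ker: "is_kernel (objA ?X) (mapk ?X) (F_B E) (F_delta E) X0"
    unfolding s by (rule is_kernelI[OF A mB k(1) F_delta_hom k(2)])
  have "crossed_semimodule (F_B E) X0 (F_delta E) (F_act E)"
    unfolding crossed_semimodule_def
    using mB monoids(2) F_delta_hom F_act_hom F_crossed F_peiffer F_act_closed by auto
  then show "crossed_schreier_extension M ?X"
    unfolding crossed_schreier_extension_def F_N
    using A monoids(3) ker cok rc ra r l by simp
qed

end

section \<open>The functor F on morphisms\<close>

lemma F_arr:
  assumes E: "full_schreier_cat M E" and L: "full_schreier_cat M L"
    and h: "(h1, h0) \<in> RSCat_hom E L"
  shows "(restrict h1 (carrier (F_B E)), h0) \<in> XSExt_hom M (F_obj E) (F_obj L)"
proof -
  interpret E: full_schreier_cat M E by fact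
  interpret L: full_schreier_cat M L by fact
  note h = h[unfolded RSCat_hom_iff[OF E L]]
  then have f: "functor_over E L h1 h0" by simp
  note F = functor_overD[OF f]
  note [simp] = mon_homD(1-3)[OF F(1)] mon_homD(1-3)[OF F(2)] F(3-5,7,8)
  have s: "objB (F_obj P) = F_B P" "delta (F_obj P) = F_delta P" "objC (F_obj P) = objs P"
    "mappi (F_obj P) = proj (ext0 P)" "act (F_obj P) = F_act P" for P :: "'a scat"
    by (simp_all add: F_obj_def)
  show ?thesis
    unfolding XSExt_hom_iff[OF E.F_crossed_schreier L.F_crossed_schreier] s
  proof (intro conjI ballI allI impI)
    show "restrict h1 (carrier (F_B E)) \<in> mon_hom (F_B E) (F_B L)"
      by (rule mon_homI) auto
  next
    fix x a assume x: "x \<in> carrier E.X0" and "a \<in> carrier (F_B E)"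
    then have a: "a \<in> carrier E.X1" "E.d a = \<one>\<^bsub>E.X0\<^esub>" by simp_all
    note A = E.F_act_spec(1-3)[OF x a]
    \<comment> \<open>Equivariance: \<open>h1\<close> carries the equation defining the action in
      \<open>E\<close> to the one that characterises the action in \<open>L\<close>.\<close>
    have "L.e (h0 x) \<otimes>\<^bsub>L.X1\<^esub> h1 a = h1 (F_act E x a) \<otimes>\<^bsub>L.X1\<^esub> L.e (h0 x)"
      using arg_cong[OF A(3), of h1] x a A(1,2) by simp
    then have "F_act L (h0 x) (h1 a) = h1 (F_act E x a)"
      by (intro L.F_act_unique) (use x a A(1,2) in simp_all)
    then show "restrict h1 (carrier (F_B E)) (F_act E x a) = F_act L (h0 x) (restrict h1 (carrier (F_B E)) a)"
      using x a A(1,2) by simp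
  next
    fix u assume "srep (F_B E) (F_delta E) u"
    then have u: "srep E.X1 (dc E) u" "E.d u = \<one>\<^bsub>E.X0\<^esub>" by (simp_all add: E.F_delta_srep)
    then have "srep L.X1 (dc L) (h1 u)" using h by simp
    then show "srep (F_B L) (F_delta L) (restrict h1 (carrier (F_B E)) u)"
      using u srep_closed[OF u(1)] by (simp add: L.F_delta_srep)
  next
    fix u assume "srep E.X0 E.f0 u"
    then show "srep L.X0 L.f0 (h0 u)" using h by simp
  qed (use F(2) in auto)
qed

lemma is_functor_F: "is_functor (RSCat M) (com_XSExt M) F_funct"
proof -
  have H: "fobj F_funct = F_obj" "Hom (RSCat M) = RSCat_hom" "Hom (com_XSExt M) = XSExt_hom M"
    "\<And>X Y h1 h0. farr F_funct X Y (h1, h0) = (restrict h1 (carrier (F_B X)), h0)"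
    by (simp_all add: F_funct_def RSCat_def com_XSExt_def)
  show ?thesis
    unfolding is_functor_def RSCat_Obj com_XSExt_Obj H
  proof (intro conjI ballI category_RSCat category_com_XSExt)
    fix E assume "E \<in> Obj (RSCat M)"
    then interpret E: full_schreier_cat M E by (simp add: RSCat_Obj)
    show "crossed_schreier M (F_obj E)" by (rule E.F_crossed_schreier)
    have "restrict (mon_id E.X1) (carrier (F_B E)) = mon_id (F_B E)"
      by (auto simp: fun_eq_iff mon_id_def)
    then show "farr F_funct E E (Id (RSCat M) E) = Id (com_XSExt M) (F_obj E)"
      by (simp add: F_funct_def RSCat_def com_XSExt_def F_obj_def)
    fix L h assume "L \<in> Obj (RSCat M)" and h: "h \<in> RSCat_hom E L"
    then have L: "full_schreier_cat M L" by (simp add: RSCat_Obj)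
    show "farr F_funct E L h \<in> XSExt_hom M (F_obj E) (F_obj L)"
      using F_arr[OF E.full_schreier_cat_axioms L] h by (cases h) (simp add: H)
    fix P g assume "P \<in> Obj (RSCat M)" and g: "g \<in> RSCat_hom L P"
    obtain h1 h0 g1 g0 where hg: "h = (h1, h0)" "g = (g1, g0)" by (cases h, cases g) auto
    interpret L: full_schreier_cat M L by fact
    have f: "functor_over E L h1 h0" using h hg RSCat_hom_iff[OF E.full_schreier_cat_axioms L] by auto
    note F = functor_overD[OF f]
    have "restrict (compose (carrier E.X1) g1 h1) (carrier (F_B E)) =
        compose (carrier (F_B E)) (restrict g1 (carrier (F_B L))) (restrict h1 (carrier (F_B E)))"
      by (auto simp: fun_eq_iff compose_def F(3) mon_homD[OF F(1)] mon_homD[OF F(2)])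
    then show "farr F_funct E P (Comp (RSCat M) E L P g h) =
        Comp (com_XSExt M) (F_obj E) (F_obj L) (F_obj P) (farr F_funct L P g) (farr F_funct E L h)"
      by (simp add: hg F_funct_def RSCat_def com_XSExt_def F_obj_def)
  qed
qed

section \<open>From crossed extensions to internal categories\<close>

locale crossed_schreier_pair = crossed_schreier M X for M :: "'u monoid" and X :: "'u xext" +
  fixes pr :: "'u \<times> 'u \<Rightarrow> 'u"
  assumes inj_pr: "inj pr"
begin

abbreviation "S \<equiv> G_arrs pr X"
abbreviation "s \<equiv> G_src pr X"
abbreviation "t \<equiv> G_tgt pr X"
abbreviation "i \<equiv> G_idn pr X"
abbreviation "m \<equiv> G_cmp pr X"
abbreviation "p1 \<equiv> proj (G_ext1 pr M X)"

lemma pr_eq [simp]: "pr x = pr y \<longleftrightarrow> x = y"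
  using inj_pr by (rule inj_eq)

lemma decode_pr [simp]: "decode pr (pr x) = x"
  using inj_pr by simp

lemma S_carrier [simp]: "pr (b, c) \<in> carrier S \<longleftrightarrow> b \<in> carrier B \<and> c \<in> carrier C"
  by (auto simp: G_arrs_def encode_def semidirect_def)

lemma S_mult [simp]: "pr (b, c) \<otimes>\<^bsub>S\<^esub> pr (b', c') = pr (b \<otimes>\<^bsub>B\<^esub> \<alpha> c b', c \<otimes>\<^bsub>C\<^esub> c')"
  by (simp add: G_arrs_def encode_def semidirect_def)

lemma S_one: "\<one>\<^bsub>S\<^esub> = pr (\<one>\<^bsub>B\<^esub>, \<one>\<^bsub>C\<^esub>)"
  by (simp add: G_arrs_def encode_def semidirect_def)

lemma S_E:
  assumes "x \<in> carrier S"
  obtains b c where "b \<in> carrier B" "c \<in> carrier C" "x = pr (b, c)"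
proof -
  have "x \<in> pr ` (carrier B \<times> carrier C)" using assms by (simp add: G_arrs_def encode_def semidirect_def)
  then show ?thesis using that by blast
qed

lemma S_ex: "x \<in> carrier S \<Longrightarrow> \<exists>b c. b \<in> carrier B \<and> c \<in> carrier C \<and> x = pr (b, c)"
  by (elim S_E) blast

text \<open>Moves unique existence from codes to pairs, so that a witness and its uniqueness can be
  treated by components.\<close>

lemma S_unique:
  "(\<exists>!x. x \<in> carrier S \<and> P x) \<longleftrightarrow> (\<exists>!(b, c). b \<in> carrier B \<and> c \<in> carrier C \<and> P (pr (b, c)))"
proof
  assume "\<exists>!x. x \<in> carrier S \<and> P x"
  then obtain x where x: "x \<in> carrier S" "P x" and u: "\<And>y. y \<in> carrier S \<Longrightarrow> P y \<Longrightarrow> y = x" by blast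
  obtain b c where bc: "b \<in> carrier B" "c \<in> carrier C" "x = pr (b, c)" using x(1) by (rule S_E)
  show "\<exists>!(b, c). b \<in> carrier B \<and> c \<in> carrier C \<and> P (pr (b, c))"
  proof (rule ex1I[of _ "(b, c)"])
    fix q assume "case q of (b, c) \<Rightarrow> b \<in> carrier B \<and> c \<in> carrier C \<and> P (pr (b, c))"
    then show "q = (b, c)" using u[of "pr q"] bc by (cases q) simp
  qed (use x bc in simp)
next
  assume "\<exists>!(b, c). b \<in> carrier B \<and> c \<in> carrier C \<and> P (pr (b, c))"
  then obtain b c where bc: "b \<in> carrier B" "c \<in> carrier C" "P (pr (b, c))"
    and u: "\<And>q. (case q of (b, c) \<Rightarrow> b \<in> carrier B \<and> c \<in> carrier C \<and> P (pr (b, c))) \<Longrightarrow> q = (b, c)"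
    by (auto simp: Ex1_def)
  show "\<exists>!x. x \<in> carrier S \<and> P x"
  proof (rule ex1I[of _ "pr (b, c)"])
    fix x assume x: "x \<in> carrier S \<and> P x"
    then obtain b' c' where b': "b' \<in> carrier B" "c' \<in> carrier C" "x = pr (b', c')" by (metis S_ex)
    then show "x = pr (b, c)" using u[of "(b', c')"] x by simp
  qed (use bc in simp)
qed

lemma s_apply [simp]: "b \<in> carrier B \<Longrightarrow> c \<in> carrier C \<Longrightarrow> s (pr (b, c)) = c"
  by (simp add: G_src_def)

lemma t_apply [simp]: "b \<in> carrier B \<Longrightarrow> c \<in> carrier C \<Longrightarrow> t (pr (b, c)) = \<delta> b \<otimes>\<^bsub>C\<^esub> c"
  by (simp add: G_tgt_def)

lemma i_apply [simp]: "c \<in> carrier C \<Longrightarrow> i c = pr (\<one>\<^bsub>B\<^esub>, c)"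
  by (simp add: G_idn_def)

text \<open>Composability is a premise about a free \<open>c'\<close>, so the rule applies in
  whatever form the second object appears.\<close>

lemma m_apply [simp]:
  "b1 \<in> carrier B \<Longrightarrow> b2 \<in> carrier B \<Longrightarrow> c \<in> carrier C \<Longrightarrow> c' = \<delta> b1 \<otimes>\<^bsub>C\<^esub> c \<Longrightarrow>
    m (pr (b1, c), pr (b2, c')) = pr (b2 \<otimes>\<^bsub>B\<^esub> b1, c)"
  by (simp add: G_cmp_def composables_def)

lemma p1_apply [simp]: "b \<in> carrier B \<Longrightarrow> c \<in> carrier C \<Longrightarrow> p1 (pr (b, c)) = \<pi> c"
  by (simp add: G_ext1_def compose_def)

lemma S_monoid: "monoid S"
proof (rule monoidI)
  fix x y assume "x \<in> carrier S" "y \<in> carrier S"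
  then show "x \<otimes>\<^bsub>S\<^esub> y \<in> carrier S" by (elim S_E) simp
next
  fix x y z assume "x \<in> carrier S" "y \<in> carrier S" "z \<in> carrier S"
  then show "x \<otimes>\<^bsub>S\<^esub> y \<otimes>\<^bsub>S\<^esub> z = x \<otimes>\<^bsub>S\<^esub> (y \<otimes>\<^bsub>S\<^esub> z)"
    by (elim S_E) (simp add: B.m_assoc C.m_assoc)
next
  fix x assume x: "x \<in> carrier S"
  show "\<one>\<^bsub>S\<^esub> \<otimes>\<^bsub>S\<^esub> x = x" "x \<otimes>\<^bsub>S\<^esub> \<one>\<^bsub>S\<^esub> = x" using x by (elim S_E; simp add: S_one)+
qed (simp add: S_one)

sublocale S: monoid S by (rule S_monoid)

lemma s_hom: "s \<in> mon_hom S C"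
proof (rule mon_homI)
  fix x y assume "x \<in> carrier S" "y \<in> carrier S"
  then show "s (x \<otimes>\<^bsub>S\<^esub> y) = s x \<otimes>\<^bsub>C\<^esub> s y" by (elim S_E) simp
qed (auto simp: S_one elim!: S_E, simp add: G_src_def)

text \<open>The first crossed semimodule law moves \<open>c\<close> past the
  \<open>\<delta>\<close>-value of the second summand.\<close>

lemma t_hom: "t \<in> mon_hom S C"
proof (rule mon_homI)
  fix x y assume "x \<in> carrier S" "y \<in> carrier S"
  then obtain b c b' c' where x: "b \<in> carrier B" "c \<in> carrier C" "x = pr (b, c)"
    and y: "b' \<in> carrier B" "c' \<in> carrier C" "y = pr (b', c')" using S_ex[of x] S_ex[of y] by blast
  have "\<delta> b \<otimes>\<^bsub>C\<^esub> \<delta> (\<alpha> c b') \<otimes>\<^bsub>C\<^esub> (c \<otimes>\<^bsub>C\<^esub> c') = \<delta> b \<otimes>\<^bsub>C\<^esub> (\<delta> (\<alpha> c b') \<otimes>\<^bsub>C\<^esub> c) \<otimes>\<^bsub>C\<^esub> c'"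
    using x y by (simp add: C.m_assoc)
  also have "\<dots> = \<delta> b \<otimes>\<^bsub>C\<^esub> c \<otimes>\<^bsub>C\<^esub> (\<delta> b' \<otimes>\<^bsub>C\<^esub> c')"
    using x y by (simp add: crossed C.m_assoc)
  finally show "t (x \<otimes>\<^bsub>S\<^esub> y) = t x \<otimes>\<^bsub>C\<^esub> t y" using x y by simp
qed (auto simp: S_one elim!: S_E, simp add: G_tgt_def)

lemma i_hom: "i \<in> mon_hom C S"
  by (rule mon_homI) (auto simp: S_one, simp add: G_idn_def)

lemma p1_hom: "p1 \<in> mon_hom S M"
proof (rule mon_homI)
  fix x y assume "x \<in> carrier S" "y \<in> carrier S"
  then show "p1 (x \<otimes>\<^bsub>S\<^esub> y) = p1 x \<otimes>\<^bsub>M\<^esub> p1 y" by (elim S_E) simp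
qed (auto simp: S_one elim!: S_E, simp add: G_ext1_def)

text \<open>The second arrow of the first pair starts at \<delta> b1 + c, yet acts as
  \<open>c\<close> does because values of \<open>\<delta>\<close> act trivially. The first
  components then differ only in the order of summands, which the commutative \<open>B\<close>
  allows.\<close>

lemma m_hom: "m \<in> mon_hom (composables S s t) S"
proof (rule mon_homI)
  fix x assume "x \<in> carrier (composables S s t)"
  then obtain b1 c b2 c' where "b1 \<in> carrier B" "c \<in> carrier C" "b2 \<in> carrier B" "c' \<in> carrier C"
    "x = (pr (b1, c), pr (b2, c'))" "c' = \<delta> b1 \<otimes>\<^bsub>C\<^esub> c"
    by (auto simp: composables_def elim!: S_E)
  then show "m x \<in> carrier S" by simp
next
  fix x y assume xy: "x \<in> carrier (composables S s t)" "y \<in> carrier (composables S s t)"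
  from xy(1) obtain b1 c b2 c2 where x: "b1 \<in> carrier B" "c \<in> carrier C" "b2 \<in> carrier B"
    "x = (pr (b1, c), pr (b2, c2))" "c2 = \<delta> b1 \<otimes>\<^bsub>C\<^esub> c"
    by (auto simp: composables_def elim!: S_E)
  from xy(2) obtain b1' c' b2' c2' where y: "b1' \<in> carrier B" "c' \<in> carrier C" "b2' \<in> carrier B"
    "y = (pr (b1', c'), pr (b2', c2'))" "c2' = \<delta> b1' \<otimes>\<^bsub>C\<^esub> c'"
    by (auto simp: composables_def elim!: S_E)
  \<comment> \<open>Composability of the two sums is the statement that \<open>t\<close> is a
    homomorphism.\<close>
  have "t (pr (b1, c) \<otimes>\<^bsub>S\<^esub> pr (b1', c')) = t (pr (b1, c)) \<otimes>\<^bsub>C\<^esub> t (pr (b1', c'))"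
    by (rule mon_homD(2)[OF t_hom]) (use x y in simp_all)
  then have T: "\<delta> b1 \<otimes>\<^bsub>C\<^esub> c \<otimes>\<^bsub>C\<^esub> (\<delta> b1' \<otimes>\<^bsub>C\<^esub> c') = \<delta> (b1 \<otimes>\<^bsub>B\<^esub> \<alpha> c b1') \<otimes>\<^bsub>C\<^esub> (c \<otimes>\<^bsub>C\<^esub> c')"
    using x y by simp
  have "m (x \<otimes>\<^bsub>composables S s t\<^esub> y) =
      m (pr (b1 \<otimes>\<^bsub>B\<^esub> \<alpha> c b1', c \<otimes>\<^bsub>C\<^esub> c'), pr (b2 \<otimes>\<^bsub>B\<^esub> \<alpha> c b2', c2 \<otimes>\<^bsub>C\<^esub> c2'))"
    using x y by (simp add: composables_def)
  also have "\<dots> = pr (b2 \<otimes>\<^bsub>B\<^esub> \<alpha> c b2' \<otimes>\<^bsub>B\<^esub> (b1 \<otimes>\<^bsub>B\<^esub> \<alpha> c b1'), c \<otimes>\<^bsub>C\<^esub> c')"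
    by (rule m_apply) (use x y T in simp_all)
  also have "\<dots> = m x \<otimes>\<^bsub>S\<^esub> m y"
    using x y by (simp add: B.m_ac)
  finally show "m (x \<otimes>\<^bsub>composables S s t\<^esub> y) = m x \<otimes>\<^bsub>S\<^esub> m y" .
next
  show "m \<one>\<^bsub>composables S s t\<^esub> = \<one>\<^bsub>S\<^esub>" by (simp add: composables_def S_one)
qed (simp add: G_cmp_def)

lemma G_internal: "schreier_internal_category S C s t i m"
proof -
  have 1: "s (m (x, y)) = s x \<and> t (m (x, y)) = t y" if "x \<in> carrier S" "y \<in> carrier S" "t x = s y" for x y
    using that by (elim S_E) (simp add: C.m_assoc)
  have 2: "m (i (s x), x) = x \<and> m (x, i (t x)) = x" if "x \<in> carrier S" for x
    using that by (elim S_E) simp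
  have 3: "m (m (x, y), z) = m (x, m (y, z))"
    if "x \<in> carrier S" "y \<in> carrier S" "z \<in> carrier S" "t x = s y" "t y = s z" for x y z
    using that by (elim S_E) (simp add: C.m_assoc B.m_assoc)
  have 4: "\<exists>!a. a \<in> carrier S \<and> s a = \<one>\<^bsub>C\<^esub> \<and> x = a \<otimes>\<^bsub>S\<^esub> i (s x)" if xS: "x \<in> carrier S" for x
  proof -
    obtain b c where x: "b \<in> carrier B" "c \<in> carrier C" "x = pr (b, c)" using S_ex[OF xS] by blast
    \<comment> \<open>The decomposition is (b, c) = (b, 0) + (0, c).\<close>
    show ?thesis unfolding S_unique
      by (rule ex1I[of _ "(b, \<one>\<^bsub>C\<^esub>)"]) (use x in auto)
  qed
  show ?thesis
    unfolding schreier_internal_category_def internal_category_def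
    using 1 2 3 4 S_monoid monoids s_hom t_hom i_hom m_hom by (auto simp: composables_def)
qed

section \<open>Representatives and fullness for the semidirect product\<close>

lemma G_ext1_simps:
  "base (G_ext1 pr M X) = M" "total (G_ext1 pr M X) = S"
  by (simp_all add: G_ext1_def)

lemma right_extn_simps:
  "base (right_extn M X) = M" "total (right_extn M X) = C" "proj (right_extn M X) = \<pi>"
  "kern (right_extn M X) = N" "kmap (right_extn M X) = mon_id N"
  by (simp_all add: right_extn_def)

text \<open>Every action fixes 0, so (b, n) + (0, u) = (b, n + u): the first component is untouched
  and the decomposition happens in \<open>C\<close>.\<close>

lemma p1_srep:
  assumes "srep C \<pi> u" shows "srep S p1 (pr (\<one>\<^bsub>B\<^esub>, u))"
  unfolding srep_def
proof (intro conjI ballI impI)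
  have u: "u \<in> carrier C" using assms by (rule srep_closed)
  then show "pr (\<one>\<^bsub>B\<^esub>, u) \<in> carrier S" by simp
  fix x assume "x \<in> carrier S" and p: "p1 x = p1 (pr (\<one>\<^bsub>B\<^esub>, u))"
  then obtain b c where x: "b \<in> carrier B" "c \<in> carrier C" "x = pr (b, c)" using S_ex by blast
  then have "\<pi> c = \<pi> u" using p u by simp
  then obtain n where n: "n \<in> carrier C" "\<pi> n = \<pi> \<one>\<^bsub>C\<^esub>" "c = n \<otimes>\<^bsub>C\<^esub> u"
    and n': "\<And>n'. n' \<in> carrier C \<Longrightarrow> \<pi> n' = \<pi> \<one>\<^bsub>C\<^esub> \<Longrightarrow> c = n' \<otimes>\<^bsub>C\<^esub> u \<Longrightarrow> n' = n"
    using assms x(2) unfolding srep_def by blast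
  show "\<exists>!b. b \<in> carrier S \<and> p1 b = p1 \<one>\<^bsub>S\<^esub> \<and> x = b \<otimes>\<^bsub>S\<^esub> pr (\<one>\<^bsub>B\<^esub>, u)"
    unfolding S_unique
  proof (rule ex1I[of _ "(b, n)"])
    fix q assume q: "case q of (b, c) \<Rightarrow> b \<in> carrier B \<and> c \<in> carrier C \<and>
      p1 (pr (b, c)) = p1 \<one>\<^bsub>S\<^esub> \<and> x = pr (b, c) \<otimes>\<^bsub>S\<^esub> pr (\<one>\<^bsub>B\<^esub>, u)"
    obtain b1 c1 where bc: "q = (b1, c1)" by (cases q)
    with q x u have "b1 = b" "c1 \<in> carrier C" "\<pi> c1 = \<pi> \<one>\<^bsub>C\<^esub>" "c = c1 \<otimes>\<^bsub>C\<^esub> u"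
      by (auto simp: S_one)
    then show "q = (b, n)" using n' bc by simp
  qed (use x n u in \<open>simp add: S_one\<close>)
qed

text \<open>The decomposition (b, c) = (a, 0) + (u, c) comes from b = a + u in \<open>B\<close>.
  This needs b and u in one fibre of \<open>\<delta>\<close>, whereas equal endpoints give only
  \<delta> b + c = \<delta> u + c.\<close>

lemma dc_srep:
  assumes u: "srep B \<delta> u" and c: "c \<in> carrier C"
  shows "srep S (\<lambda>x. (s x, t x)) (pr (u, c))"
  unfolding srep_def
proof (intro conjI ballI impI)
  have uB: "u \<in> carrier B" using u by (rule srep_closed)
  then show "pr (u, c) \<in> carrier S" using c by simp
  fix x assume "x \<in> carrier S" and p: "(s x, t x) = (s (pr (u, c)), t (pr (u, c)))"
  then obtain b where x: "b \<in> carrier B" "x = pr (b, c)" and eq: "\<delta> b \<otimes>\<^bsub>C\<^esub> c = \<delta> u \<otimes>\<^bsub>C\<^esub> c"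
    using uB c by (auto elim!: S_E)
  \<comment> \<open>To cancel the arbitrary element \<open>c\<close>, write it as n + r with
    \<open>r\<close> a representative for \<open>\<pi>\<close> and n = \<delta> b'. Uniqueness at
    \<open>r\<close> removes \<open>r\<close>, and cancellation in \<open>N\<close> removes
    n.\<close>
  have d: "\<delta> b = \<delta> u"
  proof -
    obtain r where r: "srep C \<pi> r" "\<pi> r = \<pi> c" using pi_srep[of "\<pi> c"] c by auto
    then have rC: "r \<in> carrier C" by (simp add: srep_closed)
    obtain n where n: "n \<in> carrier C" "\<pi> n = \<pi> \<one>\<^bsub>C\<^esub>" "c = n \<otimes>\<^bsub>C\<^esub> r"
      using r c unfolding srep_def by metis
    then obtain b' where b': "b' \<in> carrier B" "n = \<delta> b'" using pi_kernel[of n] by auto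
    have e: "\<delta> (b \<otimes>\<^bsub>B\<^esub> b') \<otimes>\<^bsub>C\<^esub> r = \<delta> (u \<otimes>\<^bsub>B\<^esub> b') \<otimes>\<^bsub>C\<^esub> r"
      using eq n b' x uB rC by (simp add: C.m_assoc)
    have "\<exists>!a. a \<in> carrier C \<and> \<pi> a = \<pi> \<one>\<^bsub>C\<^esub> \<and> \<delta> (b \<otimes>\<^bsub>B\<^esub> b') \<otimes>\<^bsub>C\<^esub> r = a \<otimes>\<^bsub>C\<^esub> r"
      using r(1)[unfolded srep_def, THEN conjunct2, THEN bspec, of "\<delta> (b \<otimes>\<^bsub>B\<^esub> b') \<otimes>\<^bsub>C\<^esub> r"]
      using x(1) b'(1) rC by (simp del: delta_simps(2))
    moreover have "\<delta> (b \<otimes>\<^bsub>B\<^esub> b') \<in> carrier C" "\<pi> (\<delta> (b \<otimes>\<^bsub>B\<^esub> b')) = \<pi> \<one>\<^bsub>C\<^esub>"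
        "\<delta> (u \<otimes>\<^bsub>B\<^esub> b') \<in> carrier C" "\<pi> (\<delta> (u \<otimes>\<^bsub>B\<^esub> b')) = \<pi> \<one>\<^bsub>C\<^esub>"
      using x(1) b'(1) uB by (simp_all del: delta_simps(2))
    ultimately have "\<delta> (b \<otimes>\<^bsub>B\<^esub> b') = \<delta> (u \<otimes>\<^bsub>B\<^esub> b')" using e by blast
    then show ?thesis using delta_cancel[OF x(1) uB b'(1)] x(1) uB b'(1) by simp
  qed
  obtain a where a: "a \<in> carrier B" "\<delta> a = \<delta> \<one>\<^bsub>B\<^esub>" "b = a \<otimes>\<^bsub>B\<^esub> u"
    and a': "\<And>a'. a' \<in> carrier B \<Longrightarrow> \<delta> a' = \<delta> \<one>\<^bsub>B\<^esub> \<Longrightarrow> b = a' \<otimes>\<^bsub>B\<^esub> u \<Longrightarrow> a' = a"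
    using u x(1) d unfolding srep_def by blast
  show "\<exists>!b. b \<in> carrier S \<and> (s b, t b) = (s \<one>\<^bsub>S\<^esub>, t \<one>\<^bsub>S\<^esub>) \<and> x = b \<otimes>\<^bsub>S\<^esub> pr (u, c)"
    unfolding S_unique
  proof (rule ex1I[of _ "(a, \<one>\<^bsub>C\<^esub>)"])
    fix q assume q: "case q of (b', c') \<Rightarrow> b' \<in> carrier B \<and> c' \<in> carrier C \<and>
      (s (pr (b', c')), t (pr (b', c'))) = (s \<one>\<^bsub>S\<^esub>, t \<one>\<^bsub>S\<^esub>) \<and> x = pr (b', c') \<otimes>\<^bsub>S\<^esub> pr (u, c)"
    obtain a1 c1 where "q = (a1, c1)" by (cases q)
    with q x uB c have "a1 \<in> carrier B" "c1 = \<one>\<^bsub>C\<^esub>" "\<delta> a1 = \<delta> \<one>\<^bsub>B\<^esub>" "b = a1 \<otimes>\<^bsub>B\<^esub> u"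
      by (auto simp: S_one)
    then show "q = (a, \<one>\<^bsub>C\<^esub>)" using a' \<open>q = (a1, c1)\<close> by simp
  qed (use x a uB c in \<open>simp add: S_one\<close>)
qed

lemma p1_kernel: "{x \<in> carrier S. p1 x = \<one>\<^bsub>M\<^esub>} = pr ` (carrier B \<times> carrier N)"
  by (auto simp: pi_kernel elim!: S_E)

lemma G_ext1_cc: "G_ext1 pr M X \<in> cc_SExt M"
proof -
  define K where "K = encode pr (B \<times>\<times> N)"
  have carrier_K: "carrier K = pr ` (carrier B \<times> carrier N)" by (simp add: K_def encode_def)
  have one_K: "\<one>\<^bsub>K\<^esub> = pr (\<one>\<^bsub>B\<^esub>, \<one>\<^bsub>C\<^esub>)" by (simp add: K_def encode_def)
  have mult_K: "pr (b, n) \<otimes>\<^bsub>K\<^esub> pr (b', n') = pr (b \<otimes>\<^bsub>B\<^esub> b', n \<otimes>\<^bsub>C\<^esub> n')" for b n b' n'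
    by (simp add: K_def encode_def)
  \<comment> \<open>Elements of \<open>N\<close> are written as values of \<open>\<delta>\<close>,
    so that associativity and commutativity of \<open>K\<close> become those of \<open>B\<close>;
    the sums inside \<open>\<delta>\<close> are kept folded for this reason.\<close>
  have KE: "\<exists>b b'. b \<in> carrier B \<and> b' \<in> carrier B \<and> x = pr (b, \<delta> b')" if "x \<in> carrier K" for x
    using that by (auto simp: carrier_K)
  have KI: "pr (b, \<delta> b') \<in> carrier K" if "b \<in> carrier B" "b' \<in> carrier B" for b b'
    using that by (auto simp: carrier_K)
  have mult: "pr (b, \<delta> n) \<otimes>\<^bsub>K\<^esub> pr (b', \<delta> n') = pr (b \<otimes>\<^bsub>B\<^esub> b', \<delta> (n \<otimes>\<^bsub>B\<^esub> n'))"
    if "n \<in> carrier B" "n' \<in> carrier B" for b n b' n'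
    using that by (simp add: mult_K)
  have one: "\<one>\<^bsub>K\<^esub> = pr (\<one>\<^bsub>B\<^esub>, \<delta> \<one>\<^bsub>B\<^esub>)" by (simp add: one_K)
  have "comm_monoid K"
  proof (rule comm_monoidI)
    fix x y assume "x \<in> carrier K" "y \<in> carrier K"
    then obtain b n b' n' where "b \<in> carrier B" "n \<in> carrier B" "x = pr (b, \<delta> n)"
      "b' \<in> carrier B" "n' \<in> carrier B" "y = pr (b', \<delta> n')"
      using KE[of x] KE[of y] by blast
    then show "x \<otimes>\<^bsub>K\<^esub> y \<in> carrier K" "x \<otimes>\<^bsub>K\<^esub> y = y \<otimes>\<^bsub>K\<^esub> x"
      by (simp_all add: mult KI B.m_comm del: delta_simps(2))
  next
    fix x y z assume "x \<in> carrier K" "y \<in> carrier K" "z \<in> carrier K"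
    then obtain b n b' n' b'' n'' where "b \<in> carrier B" "n \<in> carrier B" "x = pr (b, \<delta> n)"
      "b' \<in> carrier B" "n' \<in> carrier B" "y = pr (b', \<delta> n')"
      "b'' \<in> carrier B" "n'' \<in> carrier B" "z = pr (b'', \<delta> n'')"
      using KE[of x] KE[of y] KE[of z] by blast
    then show "x \<otimes>\<^bsub>K\<^esub> y \<otimes>\<^bsub>K\<^esub> z = x \<otimes>\<^bsub>K\<^esub> (y \<otimes>\<^bsub>K\<^esub> z)"
      by (simp add: mult B.m_assoc del: delta_simps(2))
  next
    fix x assume "x \<in> carrier K"
    then obtain b n where "b \<in> carrier B" "n \<in> carrier B" "x = pr (b, \<delta> n)" using KE by blast
    then show "\<one>\<^bsub>K\<^esub> \<otimes>\<^bsub>K\<^esub> x = x" by (simp add: one mult del: delta_simps(2,3))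
  qed (simp add: one KI del: delta_simps(3))
  then interpret K: comm_monoid K .
  have cc: "comm_monoid_cancel K"
  proof (rule comm_monoid_cancelI[OF K.comm_monoid_axioms])
    fix x y z assume xyz: "x \<in> carrier K" "y \<in> carrier K" "z \<in> carrier K" and eq: "x \<otimes>\<^bsub>K\<^esub> z = y \<otimes>\<^bsub>K\<^esub> z"
    then obtain b n b' n' b'' n'' where x: "b \<in> carrier B" "n \<in> carrier B" "x = pr (b, \<delta> n)"
      and y: "b' \<in> carrier B" "n' \<in> carrier B" "y = pr (b', \<delta> n')"
      and z: "b'' \<in> carrier B" "n'' \<in> carrier B" "z = pr (b'', \<delta> n'')"
      using KE[of x] KE[of y] KE[of z] by blast
    then show "x = y" using eq B_cancel[of b b' b''] delta_cancel[of n n' n''] by (simp add: mult_K)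
  qed
  have kern: "kern (G_ext1 pr M X) = K" by (simp add: G_ext1_def K_def)
  have kmap: "kmap (G_ext1 pr M X) x = x" if x: "x \<in> carrier K" for x
  proof -
    obtain b n where "b \<in> carrier B" "n \<in> carrier B" "x = pr (b, \<delta> n)" using KE[OF x] by blast
    then show ?thesis using x by (simp add: G_ext1_def K_def)
  qed
  \<comment> \<open>The componentwise addition of \<open>K\<close> agrees with the semidirect one
    because \<open>N\<close> acts trivially on \<open>B\<close>.\<close>
  have k: "kmap (G_ext1 pr M X) \<in> mon_hom K S"
  proof (rule mon_homI)
    fix x assume x: "x \<in> carrier K"
    then obtain b n where "b \<in> carrier B" "n \<in> carrier B" "x = pr (b, \<delta> n)" using KE by blast
    then show "kmap (G_ext1 pr M X) x \<in> carrier S" using kmap[OF x] by simp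
    fix y assume y: "y \<in> carrier K"
    then obtain b' n' where "b' \<in> carrier B" "n' \<in> carrier B" "y = pr (b', \<delta> n')" using KE by blast
    then show "kmap (G_ext1 pr M X) (x \<otimes>\<^bsub>K\<^esub> y) = kmap (G_ext1 pr M X) x \<otimes>\<^bsub>S\<^esub> kmap (G_ext1 pr M X) y"
      using \<open>b \<in> carrier B\<close> \<open>n \<in> carrier B\<close> \<open>x = pr (b, \<delta> n)\<close> x y K.m_closed[OF x y]
      by (simp add: kmap mult_K)
  next
    show "kmap (G_ext1 pr M X) \<one>\<^bsub>K\<^esub> = \<one>\<^bsub>S\<^esub>" using kmap[OF K.one_closed] by (simp add: one_K S_one)
  qed (simp add: G_ext1_def K_def)
  have bij: "bij_betw (kmap (G_ext1 pr M X)) (carrier K) {x \<in> carrier S. p1 x = \<one>\<^bsub>M\<^esub>}"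
    unfolding p1_kernel carrier_K[symmetric]
    by (rule bij_betw_byWitness[where f' = id]) (auto simp: kmap)
  have "schreier_extension (G_ext1 pr M X)"
    unfolding schreier_extension_iff G_ext1_simps kern
  proof (intro conjI ballI K.monoid_axioms S_monoid monoids k p1_hom bij)
    fix x assume "x \<in> carrier M"
    then obtain u where u: "srep C \<pi> u" "\<pi> u = x" using pi_srep by blast
    then show "\<exists>u. srep S p1 u \<and> p1 u = x"
      using p1_srep[OF u(1)] srep_closed[OF u(1)] by (intro exI[of _ "pr (\<one>\<^bsub>B\<^esub>, u)"]) simp
  qed
  then show ?thesis using cc by (simp add: cc_SExt_iff G_ext1_simps kern)
qed

text \<open>\<open>N\<close> is commutative as an image of \<open>B\<close>, so its right
  cancellation is full cancellation.\<close>

lemma right_cc: "right_extn M X \<in> cc_SExt M"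
proof -
  have "comm_monoid N"
    by (rule monoid.monoid_comm_monoidI[OF monoids(5)]) (auto simp: delta_comm)
  then interpret N': comm_monoid N .
  have "comm_monoid_cancel N"
    by (rule comm_monoid_cancelI[OF N'.comm_monoid_axioms]) (auto dest: delta_cancel)
  then show ?thesis using right by (simp add: cc_SExt_iff right_extn_simps)
qed

text \<open>Each fibre over M contains a representative (0, r) with r a representative for
  \<open>\<pi>\<close>, so preservation has to be tested only there. It serves the domain, the
  codomain and the maps in the image of G.\<close>

lemma p1_srep_transfer:
  assumes h: "h \<in> mon_hom S Y" and Y: "monoid Y" and f: "f \<in> mon_hom Y M"
    and fh: "\<And>b c. b \<in> carrier B \<Longrightarrow> c \<in> carrier C \<Longrightarrow> f (h (pr (b, c))) = \<pi> c"
    and hr: "\<And>r. srep C \<pi> r \<Longrightarrow> srep Y f (h (pr (\<one>\<^bsub>B\<^esub>, r)))"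
    and u: "srep S p1 u"
  shows "srep Y f (h u)"
proof -
  have uS: "u \<in> carrier S" using u by (rule srep_closed)
  then have "p1 u \<in> carrier M" by (rule mon_homD(1)[OF p1_hom])
  then obtain r where r: "srep C \<pi> r" "\<pi> r = p1 u" using pi_srep by blast
  show ?thesis
  proof (rule srep_transfer[where X = S and f = p1 and l = "\<lambda>x. x", OF S_monoid Y mon_hom_imp_hom[OF f] h _ mon_hom_imp_hom[OF p1_hom] u p1_srep[OF r(1)] _ hr[OF r(1)]])
    show "f (h x) = p1 x" if "x \<in> carrier S" for x using that by (elim S_E) (simp add: fh)
    show "p1 (pr (\<one>\<^bsub>B\<^esub>, r)) = p1 u" using r srep_closed[OF r(1)] by simp
  qed
qed

lemma G_rel_simps:
  "carrier (rel_monoid (right_extn M X)) = {(x, y). x \<in> carrier C \<and> y \<in> carrier C \<and> (\<exists>b\<in>carrier B. y = \<delta> b \<otimes>\<^bsub>C\<^esub> x)}"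
  "\<one>\<^bsub>rel_monoid (right_extn M X)\<^esub> = (\<one>\<^bsub>C\<^esub>, \<one>\<^bsub>C\<^esub>)"
  "(x, y) \<otimes>\<^bsub>rel_monoid (right_extn M X)\<^esub> (x', y') = (x \<otimes>\<^bsub>C\<^esub> x', y \<otimes>\<^bsub>C\<^esub> y')"
  by (auto simp: rel_monoid_def right_extn_simps)

text \<open>Describing \<open>R_E\<close> as the set of endpoint pairs of arrows makes its closure
  under addition immediate, since \<open>s\<close> and \<open>t\<close> are homomorphisms.\<close>

lemma G_rel_image: "carrier (rel_monoid (right_extn M X)) = (\<lambda>x. (s x, t x)) ` carrier S"
proof (intro equalityI subsetI)
  fix p assume "p \<in> carrier (rel_monoid (right_extn M X))"
  then obtain c b where "c \<in> carrier C" "b \<in> carrier B" "p = (c, \<delta> b \<otimes>\<^bsub>C\<^esub> c)" by (auto simp: G_rel_simps)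
  then show "p \<in> (\<lambda>x. (s x, t x)) ` carrier S" by (intro image_eqI[of _ _ "pr (b, c)"]) simp_all
next
  fix p assume "p \<in> (\<lambda>x. (s x, t x)) ` carrier S"
  then show "p \<in> carrier (rel_monoid (right_extn M X))" by (auto simp: G_rel_simps elim!: S_E)
qed

lemma G_rel_monoid: "monoid (rel_monoid (right_extn M X))"
proof (rule monoidI)
  let ?R = "rel_monoid (right_extn M X)"
  fix p q assume "p \<in> carrier ?R" "q \<in> carrier ?R"
  then obtain x y where xy: "x \<in> carrier S" "y \<in> carrier S" "p = (s x, t x)" "q = (s y, t y)"
    unfolding G_rel_image by blast
  then have "p \<otimes>\<^bsub>?R\<^esub> q = (s (x \<otimes>\<^bsub>S\<^esub> y), t (x \<otimes>\<^bsub>S\<^esub> y))"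
    by (simp add: G_rel_simps mon_homD[OF s_hom] mon_homD[OF t_hom])
  then show "p \<otimes>\<^bsub>?R\<^esub> q \<in> carrier ?R" unfolding G_rel_image using xy by blast
qed (auto simp: G_rel_simps(1,2) G_rel_simps(3) C.m_assoc intro!: bexI[of _ "\<one>\<^bsub>B\<^esub>"])

lemma G_full_schreier_cat: "full_schreier_cat M (G_obj pr M X)"
proof (rule full_schreier_cat.intro)
  let ?R = "rel_monoid (right_extn M X)"
  let ?dc = "\<lambda>x\<in>carrier S. (s x, t x)"
  have g: "ext1 (G_obj pr M X) = G_ext1 pr M X" "ext0 (G_obj pr M X) = right_extn M X"
    "src (G_obj pr M X) = s" "tgt (G_obj pr M X) = t" "idn (G_obj pr M X) = i" "cmp (G_obj pr M X) = m"
    by (simp_all add: G_obj_def)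
  \<comment> \<open>Domain and codomain are treated together: both send (0, c) to c and are
    compatible with the projections to M.\<close>
  have a: "cc_morphism (G_ext1 pr M X) (right_extn M X) h"
    if h: "h \<in> mon_hom S C" "\<And>c. c \<in> carrier C \<Longrightarrow> h (pr (\<one>\<^bsub>B\<^esub>, c)) = c"
      "\<And>b c. b \<in> carrier B \<Longrightarrow> c \<in> carrier C \<Longrightarrow> \<pi> (h (pr (b, c))) = \<pi> c" for h
    unfolding cc_morphism_iff[OF G_ext1_cc right_cc] G_ext1_simps right_extn_simps
  proof (intro conjI ballI allI impI)
    fix u assume "srep S p1 u"
    then show "srep C \<pi> (h u)"
      by (rule p1_srep_transfer[OF h(1) monoids(3) pi_hom h(3), rotated 3]) (simp_all add: h srep_closed)
  next
    fix x assume "x \<in> carrier S"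
    then show "\<pi> (h x) = p1 x" by (elim S_E) (simp add: h)
  qed (rule h)
  have b: "cc_morphism (right_extn M X) (G_ext1 pr M X) i"
    unfolding cc_morphism_iff[OF right_cc G_ext1_cc] G_ext1_simps right_extn_simps
    using i_hom p1_srep by (auto simp: srep_closed)
  show "schreier_cat_in_cc M (G_obj pr M X)"
    unfolding schreier_cat_in_cc_def g G_ext1_simps right_extn_simps
    using G_ext1_cc right_cc G_internal a[OF s_hom] a[OF t_hom] b by simp
  have dch: "?dc \<in> mon_hom S ?R"
  proof (rule mon_homI)
    fix x assume "x \<in> carrier S"
    then show "?dc x \<in> carrier ?R" unfolding G_rel_image by simp
  qed (auto simp: G_rel_simps mon_homD[OF s_hom] mon_homD[OF t_hom])
  note k = mon_id_kernel_obj[OF S_monoid G_rel_monoid dch] monoid_kernel_obj[OF S_monoid G_rel_monoid dch]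
  show "R_full (G_obj pr M X)"
    unfolding R_full_def dc_extn_def hom_extn_def schreier_extension_iff g G_ext1_simps extn.simps
  proof (intro conjI ballI k S_monoid G_rel_monoid dch)
    fix p assume "p \<in> carrier ?R"
    then obtain c b where cb: "c \<in> carrier C" "b \<in> carrier B" "p = (c, \<delta> b \<otimes>\<^bsub>C\<^esub> c)"
      by (auto simp: G_rel_simps)
    \<comment> \<open>The pair (c, \<delta> b + c) is represented by (u, c), where \<open>u\<close>
      represents \<delta> b; \<open>b\<close> itself need not be a representative.\<close>
    obtain u where u: "srep B \<delta> u" "\<delta> u = \<delta> b" using delta_srep cb by blast
    have "srep S ?dc (pr (u, c))"
      using dc_srep[OF u(1) cb(1)] srep_cong[OF S_monoid, of ?dc "\<lambda>x. (s x, t x)" "pr (u, c)"] by simp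
    then show "\<exists>u. srep S ?dc u \<and> ?dc u = p"
      using cb u srep_closed[OF u(1)] by (intro exI[of _ "pr (u, c)"]) simp
  qed
qed

end

section \<open>The functor G on morphisms\<close>

lemma crossed_schreier_pairI: "crossed_schreier M X \<Longrightarrow> inj pr \<Longrightarrow> crossed_schreier_pair M X pr"
  by (simp add: crossed_schreier_pair_def crossed_schreier_pair_axioms_def)

lemma G_obj_simps:
  "ext1 (G_obj pr M X) = G_ext1 pr M X" "ext0 (G_obj pr M X) = right_extn M X"
  "src (G_obj pr M X) = G_src pr X" "tgt (G_obj pr M X) = G_tgt pr X"
  "idn (G_obj pr M X) = G_idn pr X" "cmp (G_obj pr M X) = G_cmp pr X"
  "total (G_ext1 pr M X) = G_arrs pr X" "total (right_extn M X) = objC X"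
  "proj (right_extn M X) = mappi X"
  by (simp_all add: G_obj_def G_ext1_def right_extn_def)

lemma F_obj_simps:
  "objB (F_obj E) = F_B E" "delta (F_obj E) = F_delta E" "objC (F_obj E) = objs E"
  "mappi (F_obj E) = proj (ext0 E)" "act (F_obj E) = F_act E"
  by (simp_all add: F_obj_def)

definition G_map :: "('u \<times> 'u \<Rightarrow> 'u) \<Rightarrow> 'u xext \<Rightarrow> ('u \<Rightarrow> 'u) \<Rightarrow> ('u \<Rightarrow> 'u) \<Rightarrow> 'u \<Rightarrow> 'u" where
  "G_map pr X \<phi> \<psi> = (\<lambda>x\<in>carrier (G_arrs pr X). case decode pr x of (b, c) \<Rightarrow> pr (\<phi> b, \<psi> c))"

lemma (in crossed_schreier_pair) G_map_apply:
  "b \<in> carrier B \<Longrightarrow> c \<in> carrier C \<Longrightarrow> G_map pr X \<phi> \<psi> (pr (b, c)) = pr (\<phi> b, \<psi> c)"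
  by (simp add: G_map_def)

text \<open>The functor equations are componentwise. Preservation of representatives reduces to the
  special elements (0, r) over M and (v, c) over pairs of endpoints, on which it is the hypothesis
  about \<open>\<psi>\<close> and \<open>\<phi>\<close> respectively.\<close>

lemma G_arr:
  assumes X: "crossed_schreier M X" and Y: "crossed_schreier M Y" and pr: "inj pr"
    and h: "(\<phi>, \<psi>) \<in> XSExt_hom M X Y"
  shows "(G_map pr X \<phi> \<psi>, \<psi>) \<in> RSCat_hom (G_obj pr M X) (G_obj pr M Y)"
proof -
  interpret X: crossed_schreier_pair M X pr by (rule crossed_schreier_pairI[OF X pr])
  interpret Y: crossed_schreier_pair M Y pr by (rule crossed_schreier_pairI[OF Y pr])
  note H = h[unfolded XSExt_hom_iff[OF X Y]]
  have \<phi>: "\<phi> \<in> mon_hom X.B Y.B" and \<psi>: "\<psi> \<in> mon_hom X.C Y.C"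
    and d: "\<And>b. b \<in> carrier X.B \<Longrightarrow> Y.\<delta> (\<phi> b) = \<psi> (X.\<delta> b)"
    and a: "\<And>c b. c \<in> carrier X.C \<Longrightarrow> b \<in> carrier X.B \<Longrightarrow> \<phi> (X.\<alpha> c b) = Y.\<alpha> (\<psi> c) (\<phi> b)"
    and p: "\<And>c. c \<in> carrier X.C \<Longrightarrow> Y.\<pi> (\<psi> c) = X.\<pi> c"
    and r\<phi>: "\<And>u. srep X.B X.\<delta> u \<Longrightarrow> srep Y.B Y.\<delta> (\<phi> u)"
    and r\<psi>: "\<And>u. srep X.C X.\<pi> u \<Longrightarrow> srep Y.C Y.\<pi> (\<psi> u)"
    using H by simp_all
  note [simp] = mon_homD(1-3)[OF \<phi>] mon_homD(1-3)[OF \<psi>] X.G_map_apply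
  let ?h = "G_map pr X \<phi> \<psi>"
  have hh: "?h \<in> mon_hom X.S Y.S"
  proof (rule mon_homI)
    fix x assume x: "x \<in> carrier X.S"
    then show "?h x \<in> carrier Y.S" by (elim X.S_E) simp
    fix y assume "y \<in> carrier X.S"
    with x show "?h (x \<otimes>\<^bsub>X.S\<^esub> y) = ?h x \<otimes>\<^bsub>Y.S\<^esub> ?h y" by (elim X.S_E) (simp add: a)
  next
    show "?h \<one>\<^bsub>X.S\<^esub> = \<one>\<^bsub>Y.S\<^esub>" by (simp add: X.S_one Y.S_one)
  qed (simp add: G_map_def)
  have f: "functor_over (G_obj pr M X) (G_obj pr M Y) ?h \<psi>"
  proof (rule functor_overI, unfold G_obj_simps)
    fix x y assume xy: "x \<in> carrier X.S" "y \<in> carrier X.S" "X.t x = X.s y"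
    obtain b1 c where x: "b1 \<in> carrier X.B" "c \<in> carrier X.C" "x = pr (b1, c)" using xy(1) by (rule X.S_E)
    obtain b2 c2 where y: "b2 \<in> carrier X.B" "c2 \<in> carrier X.C" "y = pr (b2, c2)" using xy(2) by (rule X.S_E)
    have c2: "c2 = X.\<delta> b1 \<otimes>\<^bsub>X.C\<^esub> c" using xy x y by simp
    then have "\<psi> c2 = Y.\<delta> (\<phi> b1) \<otimes>\<^bsub>Y.C\<^esub> \<psi> c" using x y by (simp add: d)
    then show "?h (X.m (x, y)) = Y.m (?h x, ?h y)" using x y c2 by simp
  qed (use hh \<psi> in \<open>auto simp: d p elim!: X.S_E\<close>)
  note F = functor_overD[OF f, unfolded G_obj_simps]
  have 1: "srep Y.S Y.p1 (?h u)" if "srep X.S X.p1 u" for u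
    by (rule X.p1_srep_transfer[OF hh Y.S_monoid Y.p1_hom _ _ that])
      (use r\<psi> Y.p1_srep srep_closed[of X.C X.\<pi>] in \<open>simp_all add: p\<close>)
  have 2: "srep Y.S (\<lambda>x. (Y.s x, Y.t x)) (?h u)" if u: "srep X.S (\<lambda>x. (X.s x, X.t x)) u" for u
  proof -
    obtain b c where b: "b \<in> carrier X.B" "c \<in> carrier X.C" "u = pr (b, c)"
      using srep_closed[OF u] by (rule X.S_E)
    \<comment> \<open>\<open>u\<close> and (v, c) have the same endpoints, so
      \<open>srep_transfer\<close> allows testing on the latter.\<close>
    obtain v where v: "srep X.B X.\<delta> v" "X.\<delta> v = X.\<delta> b" using X.delta_srep b(1) by blast
    have vB: "v \<in> carrier X.B" using v(1) by (rule srep_closed)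
    show ?thesis
    proof (rule srep_transfer[where X = X.S and f = "\<lambda>x. (X.s x, X.t x)" and l = "\<lambda>(x, y). (\<psi> x, \<psi> y)"
          and f' = "\<lambda>x. (Y.s x, Y.t x)" and h = ?h and u = u and v = "pr (v, c)" and M = "X.C \<times>\<times> X.C" and M' = "Y.C \<times>\<times> Y.C", OF X.S_monoid Y.S_monoid])
      \<comment> \<open>The pairing is regarded as a homomorphism into the full product of
        \<open>C\<close> with itself, which has the same fibres as the map into
        \<open>R_E\<close>.\<close>
      show "(\<lambda>x. (Y.s x, Y.t x)) \<in> hom Y.S (Y.C \<times>\<times> Y.C)"
        by (rule homI) (simp_all add: mon_homD[OF Y.s_hom] mon_homD[OF Y.t_hom])
      show "(\<lambda>x. (X.s x, X.t x)) \<in> hom X.S (X.C \<times>\<times> X.C)"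
        by (rule homI) (simp_all add: mon_homD[OF X.s_hom] mon_homD[OF X.t_hom])
      show "srep X.S (\<lambda>x. (X.s x, X.t x)) (pr (v, c))" by (rule X.dc_srep[OF v(1) b(2)])
      show "srep Y.S (\<lambda>x. (Y.s x, Y.t x)) (?h (pr (v, c)))"
        using Y.dc_srep[OF r\<phi>[OF v(1)], of "\<psi> c"] vB b by simp
    qed (use hh u F v vB b in simp_all)
  qed
  show ?thesis
    unfolding RSCat_hom_iff[OF X.G_full_schreier_cat Y.G_full_schreier_cat] G_obj_simps
    using f 1 2 r\<psi> by simp
qed

lemma is_functor_G:
  assumes pr: "inj pr"
  shows "is_functor (com_XSExt M) (RSCat M) (G_funct pr M)"
proof -
  have H: "fobj (G_funct pr M) = G_obj pr M" "Hom (RSCat M) = RSCat_hom" "Hom (com_XSExt M) = XSExt_hom M"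
    "\<And>X Y h1 h0. farr (G_funct pr M) X Y (h1, h0) = (G_map pr X h1 h0, h0)"
    by (simp_all add: G_funct_def RSCat_def com_XSExt_def G_map_def)
  show ?thesis
    unfolding is_functor_def RSCat_Obj com_XSExt_Obj H
  proof (intro conjI ballI category_RSCat category_com_XSExt)
    fix X assume "X \<in> Obj (com_XSExt M)"
    then interpret X: crossed_schreier_pair M X pr
      by (intro crossed_schreier_pairI pr) (simp add: com_XSExt_Obj)
    show "full_schreier_cat M (G_obj pr M X)" by (rule X.G_full_schreier_cat)
    have "G_map pr X (mon_id X.B) (mon_id X.C) = mon_id X.S"
      by (rule extensionalityI[where A = "carrier X.S"])
        (auto simp: G_map_def mon_id_def elim!: X.S_E)
    then show "farr (G_funct pr M) X X (Id (com_XSExt M) X) = Id (RSCat M) (G_obj pr M X)"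
      by (simp add: H RSCat_def com_XSExt_def G_obj_simps)
    fix Y h assume "Y \<in> Obj (com_XSExt M)" and h: "h \<in> XSExt_hom M X Y"
    then interpret Y: crossed_schreier_pair M Y pr
      by (intro crossed_schreier_pairI pr) (simp add: com_XSExt_Obj)
    show "farr (G_funct pr M) X Y h \<in> RSCat_hom (G_obj pr M X) (G_obj pr M Y)"
      using G_arr[OF X.crossed_schreier_axioms Y.crossed_schreier_axioms pr] h by (cases h) (simp add: H)
    fix Z g assume "Z \<in> Obj (com_XSExt M)" and g: "g \<in> XSExt_hom M Y Z"
    obtain \<phi> \<psi> \<phi>' \<psi>' where hg: "h = (\<phi>, \<psi>)" "g = (\<phi>', \<psi>')" by (cases h, cases g) auto
    have \<phi>: "\<phi> \<in> mon_hom X.B Y.B" "\<psi> \<in> mon_hom X.C Y.C"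
      using h hg by (simp_all add: XSExt_hom_def crossed_morphism_def)
    have "G_map pr X (compose (carrier X.B) \<phi>' \<phi>) (compose (carrier X.C) \<psi>' \<psi>) =
        compose (carrier X.S) (G_map pr Y \<phi>' \<psi>') (G_map pr X \<phi> \<psi>)"
    proof (rule extensionalityI[where A = "carrier X.S"])
      fix x assume "x \<in> carrier X.S"
      then show "G_map pr X (compose (carrier X.B) \<phi>' \<phi>) (compose (carrier X.C) \<psi>' \<psi>) x =
        compose (carrier X.S) (G_map pr Y \<phi>' \<psi>') (G_map pr X \<phi> \<psi>) x"
        by (elim X.S_E)
          (simp add: X.G_map_apply Y.G_map_apply compose_def mon_homD(1)[OF \<phi>(1)] mon_homD(1)[OF \<phi>(2)])
    qed (simp_all add: G_map_def)
    then show "farr (G_funct pr M) X Z (Comp (com_XSExt M) X Y Z g h) =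
        Comp (RSCat M) (G_obj pr M X) (G_obj pr M Y) (G_obj pr M Z)
          (farr (G_funct pr M) Y Z g) (farr (G_funct pr M) X Y h)"
      by (simp add: hg H RSCat_def com_XSExt_def G_obj_simps)
  qed
qed

section \<open>Unit and counit\<close>

definition kernel_part :: "'u scat \<Rightarrow> 'u \<Rightarrow> 'u" where
  "kernel_part E x = (THE a. a \<in> carrier (arrs E) \<and> src E a = \<one>\<^bsub>objs E\<^esub> \<and>
     x = a \<otimes>\<^bsub>arrs E\<^esub> idn E (src E x))"

context full_schreier_cat
begin

lemma kernel_part:
  assumes "x \<in> carrier X1"
  shows "kernel_part E x \<in> carrier X1" "d (kernel_part E x) = \<one>\<^bsub>X0\<^esub>"
    "x = kernel_part E x \<otimes>\<^bsub>X1\<^esub> e (d x)"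
  using theI'[OF decompose[OF assms]] unfolding kernel_part_def by blast+

lemma kernel_part_eq:
  assumes "a \<in> carrier X1" "d a = \<one>\<^bsub>X0\<^esub>" "y \<in> carrier X0"
  shows "kernel_part E (a \<otimes>\<^bsub>X1\<^esub> e y) = a"
proof -
  let ?x = "a \<otimes>\<^bsub>X1\<^esub> e y"
  have x: "?x \<in> carrier X1" "d ?x = y" using assms by simp_all
  show ?thesis
    by (rule decompose_unique[where x = y]) (use kernel_part[OF x(1)] x(2) assms in simp_all)
qed

end

definition unit_arr :: "('u \<times> 'u \<Rightarrow> 'u) \<Rightarrow> 'u scat \<Rightarrow> 'u \<Rightarrow> 'u" where
  "unit_arr pr E = (\<lambda>x\<in>carrier (arrs E). pr (kernel_part E x, src E x))"

text \<open>The decompositions a + e y are coordinates on arrows. In these coordinates the equation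
  e y + a' = \<open>F_act E y a'\<close> + e y turns addition into the semidirect one, and the
  interchange law turns composition into a' + a.\<close>

lemma iso_arr_unit:
  assumes E: "full_schreier_cat M E" and pr: "inj pr"
  shows "iso_arr (RSCat M) E (G_obj pr M (F_obj E)) (unit_arr pr E, mon_id (objs E))"
proof -
  interpret E: full_schreier_cat M E by fact
  interpret Y: crossed_schreier_pair M "F_obj E" pr
    by (rule crossed_schreier_pairI[OF E.F_crossed_schreier pr])
  note Y = Y.S_carrier[unfolded F_obj_simps] Y.S_mult[unfolded F_obj_simps] Y.s_apply[unfolded F_obj_simps]
    Y.t_apply[unfolded F_obj_simps] Y.i_apply[unfolded F_obj_simps] Y.m_apply[unfolded F_obj_simps]
    Y.p1_apply[unfolded F_obj_simps] Y.S_one[unfolded F_obj_simps]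
  note [simp] = F_obj_simps Y
  let ?h = "unit_arr pr E"
  have h [simp]: "?h (a \<otimes>\<^bsub>E.X1\<^esub> E.e y) = pr (a, y)"
    if "a \<in> carrier E.X1" "E.d a = \<one>\<^bsub>E.X0\<^esub>" "y \<in> carrier E.X0" for a y
    using that by (simp add: unit_arr_def E.kernel_part_eq)
  have dec: "\<exists>a y. a \<in> carrier E.X1 \<and> E.d a = \<one>\<^bsub>E.X0\<^esub> \<and> y \<in> carrier E.X0 \<and> x = a \<otimes>\<^bsub>E.X1\<^esub> E.e y"
    if "x \<in> carrier E.X1" for x
    using E.kernel_part[OF that] E.d_simps(1)[OF that] by metis
  have hh: "?h \<in> mon_hom E.X1 Y.S"
  proof (rule mon_homI)
    fix x assume "x \<in> carrier E.X1"
    then obtain a y where x: "a \<in> carrier E.X1" "E.d a = \<one>\<^bsub>E.X0\<^esub>" "y \<in> carrier E.X0"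
      "x = a \<otimes>\<^bsub>E.X1\<^esub> E.e y" using dec by blast
    then show "?h x \<in> carrier Y.S" by simp
    fix x' assume "x' \<in> carrier E.X1"
    then obtain a' y' where x': "a' \<in> carrier E.X1" "E.d a' = \<one>\<^bsub>E.X0\<^esub>" "y' \<in> carrier E.X0"
      "x' = a' \<otimes>\<^bsub>E.X1\<^esub> E.e y'" using dec by blast
    note A = E.F_act_spec(1-3)[OF x(3) x'(1,2)]
    have "x \<otimes>\<^bsub>E.X1\<^esub> x' = a \<otimes>\<^bsub>E.X1\<^esub> (E.e y \<otimes>\<^bsub>E.X1\<^esub> a') \<otimes>\<^bsub>E.X1\<^esub> E.e y'"
      using x x' by (simp add: E.X1.m_assoc)
    also have "\<dots> = (a \<otimes>\<^bsub>E.X1\<^esub> F_act E y a') \<otimes>\<^bsub>E.X1\<^esub> E.e (y \<otimes>\<^bsub>E.X0\<^esub> y')"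
      using x x' A(1,2) unfolding A(3) by (simp add: E.X1.m_assoc)
    \<comment> \<open>The identity arrow of y + y' must stay folded: once it is split into a sum,
      the coordinates can no longer be read off.\<close>
    finally have "?h (x \<otimes>\<^bsub>E.X1\<^esub> x') = pr (a \<otimes>\<^bsub>E.X1\<^esub> F_act E y a', y \<otimes>\<^bsub>E.X0\<^esub> y')"
      using x x' A(1,2) by (simp del: E.e_simps(2))
    then show "?h (x \<otimes>\<^bsub>E.X1\<^esub> x') = ?h x \<otimes>\<^bsub>Y.S\<^esub> ?h x'" using x x' by simp
  next
    show "?h \<one>\<^bsub>E.X1\<^esub> = \<one>\<^bsub>Y.S\<^esub>" using h[of "\<one>\<^bsub>E.X1\<^esub>" "\<one>\<^bsub>E.X0\<^esub>"] by simp
  qed (simp add: unit_arr_def)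
  have f: "functor_over E (G_obj pr M (F_obj E)) ?h (mon_id (objs E))"
  proof (rule functor_overI, unfold G_obj_simps F_obj_simps)
    fix x assume "x \<in> carrier E.X1"
    then obtain a y where x: "a \<in> carrier E.X1" "E.d a = \<one>\<^bsub>E.X0\<^esub>" "y \<in> carrier E.X0"
      "x = a \<otimes>\<^bsub>E.X1\<^esub> E.e y" using dec by blast
    then show "Y.s (?h x) = mon_id E.X0 (E.d x)" "Y.t (?h x) = mon_id E.X0 (E.c x)"
      "Y.p1 (?h x) = E.f1 x" by simp_all
  next
    fix x assume "x \<in> carrier E.X0"
    then show "?h (E.e x) = Y.i (mon_id E.X0 x)" using h[of "\<one>\<^bsub>E.X1\<^esub>" x] by simp
  next
    fix x x' assume "x \<in> carrier E.X1" "x' \<in> carrier E.X1" and c: "E.c x = E.d x'"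
    then obtain a y a' y' where x: "a \<in> carrier E.X1" "E.d a = \<one>\<^bsub>E.X0\<^esub>" "y \<in> carrier E.X0"
        "x = a \<otimes>\<^bsub>E.X1\<^esub> E.e y"
      and x': "a' \<in> carrier E.X1" "E.d a' = \<one>\<^bsub>E.X0\<^esub>" "y' \<in> carrier E.X0"
      "x' = a' \<otimes>\<^bsub>E.X1\<^esub> E.e y'" using dec by metis
    have y': "y' = E.c x" using c x x' by simp
    have xX: "x \<in> carrier E.X1" using x by simp
    \<comment> \<open>Writing x as 0 + x and x' as a' + e (c x), the interchange law separates the
      composite into (0 followed by a') plus (x followed by an identity).\<close>
    have "E.m (x, x') = E.m (\<one>\<^bsub>E.X1\<^esub> \<otimes>\<^bsub>E.X1\<^esub> x, a' \<otimes>\<^bsub>E.X1\<^esub> E.e (E.c x))"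
      using xX x'(4) y' by simp
    also have "\<dots> = E.m (\<one>\<^bsub>E.X1\<^esub>, a') \<otimes>\<^bsub>E.X1\<^esub> E.m (x, E.e (E.c x))"
      by (rule E.m_mult) (use xX x' in simp_all)
    also have "\<dots> = a' \<otimes>\<^bsub>E.X1\<^esub> x" using E.m_unit(1)[OF x'(1,2)] xX by simp
    also have "\<dots> = (a' \<otimes>\<^bsub>E.X1\<^esub> a) \<otimes>\<^bsub>E.X1\<^esub> E.e y" using x x' by (simp add: E.X1.m_assoc)
    finally have "?h (E.m (x, x')) = pr (a' \<otimes>\<^bsub>E.X1\<^esub> a, y)" using x x' by simp
    moreover have "?h x = pr (a, y)" "?h x' = pr (a', y')" using x x' by simp_all
    moreover have "y' = E.c a \<otimes>\<^bsub>E.X0\<^esub> y" using y' x by simp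
    ultimately show "?h (E.m (x, x')) = Y.m (?h x, ?h x')" using x(1-3) x'(1-3) by simp
  qed (use hh mon_id_hom E.monoids in auto)
  have b: "bij_betw ?h (carrier E.X1) (carrier Y.S)"
  proof (rule bij_betw_byWitness[where f' = "\<lambda>q. case decode pr q of (a, y) \<Rightarrow> a \<otimes>\<^bsub>E.X1\<^esub> E.e y"])
    show "\<forall>x\<in>carrier E.X1. (case decode pr (?h x) of (a, y) \<Rightarrow> a \<otimes>\<^bsub>E.X1\<^esub> E.e y) = x"
    proof
      fix x assume "x \<in> carrier E.X1"
      then obtain a y where "a \<in> carrier E.X1" "E.d a = \<one>\<^bsub>E.X0\<^esub>" "y \<in> carrier E.X0"
        "x = a \<otimes>\<^bsub>E.X1\<^esub> E.e y" using dec by blast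
      then show "(case decode pr (?h x) of (a, y) \<Rightarrow> a \<otimes>\<^bsub>E.X1\<^esub> E.e y) = x" by simp
    qed
    show "?h ` carrier E.X1 \<subseteq> carrier Y.S" using mon_homD(1)[OF hh] by blast
    show "\<forall>q\<in>carrier Y.S. ?h (case decode pr q of (a, y) \<Rightarrow> a \<otimes>\<^bsub>E.X1\<^esub> E.e y) = q"
      by (auto elim!: Y.S_E)
    show "(\<lambda>q. case decode pr q of (a, y) \<Rightarrow> a \<otimes>\<^bsub>E.X1\<^esub> E.e y) ` carrier Y.S \<subseteq> carrier E.X1"
      by (auto elim!: Y.S_E)
  qed
  show ?thesis
    by (rule iso_arr_RSCat[OF E Y.G_full_schreier_cat f])
      (use b in \<open>simp_all add: G_obj_simps bij_betw_def mon_id_def inj_on_def\<close>)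
qed

text \<open>\<open>h1\<close> maps the decomposition of x to one of \<open>h1 x\<close>, so by
  uniqueness it commutes with taking kernel parts.\<close>

lemma unit_natural:
  assumes E: "full_schreier_cat M E" and L: "full_schreier_cat M L" and pr: "inj pr"
    and h: "(h1, h0) \<in> RSCat_hom E L"
  shows "compose (carrier (arrs E)) (unit_arr pr L) h1 =
    compose (carrier (arrs E)) (G_map pr (F_obj E) (restrict h1 (carrier (F_B E))) h0) (unit_arr pr E)"
proof (rule extensionalityI[where A = "carrier (arrs E)"])
  interpret E: full_schreier_cat M E by fact
  interpret L: full_schreier_cat M L by fact
  interpret Y: crossed_schreier_pair M "F_obj E" pr
    by (rule crossed_schreier_pairI[OF E.F_crossed_schreier pr])
  have "functor_over E L h1 h0" using h by (simp add: RSCat_hom_iff[OF E L])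
  note F = functor_overD[OF this]
  note [simp] = mon_homD(1-3)[OF F(1)] mon_homD(1)[OF F(2)] F(3,5)
  fix x assume x: "x \<in> carrier E.X1"
  let ?a = "kernel_part E x"
  note a = E.kernel_part[OF x]
  have "h1 x = h1 ?a \<otimes>\<^bsub>L.X1\<^esub> L.e (h0 (E.d x))" using arg_cong[OF a(3), of h1] a(1,2) x by simp
  then have "kernel_part L (h1 x) = h1 ?a"
    using L.kernel_part_eq[of "h1 ?a" "h0 (E.d x)"] a(1,2) x by (simp add: mon_homD(3)[OF F(2)])
  moreover have "G_map pr (F_obj E) (restrict h1 (carrier (F_B E))) h0 (pr (?a, E.d x)) = pr (h1 ?a, h0 (E.d x))"
    using a(1,2) x by (subst Y.G_map_apply) (simp_all add: F_obj_simps)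
  ultimately show "compose (carrier E.X1) (unit_arr pr L) h1 x =
    compose (carrier E.X1) (G_map pr (F_obj E) (restrict h1 (carrier (F_B E))) h0) (unit_arr pr E) x"
    using x by (simp add: compose_def unit_arr_def)
qed (simp_all)

section \<open>The counit: recovering B from arrows with domain 0\<close>

definition counit_arr :: "('u \<times> 'u \<Rightarrow> 'u) \<Rightarrow> 'u monoid \<Rightarrow> 'u xext \<Rightarrow> 'u \<Rightarrow> 'u" where
  "counit_arr pr M X = (\<lambda>x\<in>carrier (F_B (G_obj pr M X)). fst (decode pr x))"

context crossed_schreier_pair
begin

lemma FG_carrier: "x \<in> carrier (F_B (G_obj pr M X)) \<longleftrightarrow> (\<exists>b\<in>carrier B. x = pr (b, \<one>\<^bsub>C\<^esub>))"
proof -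
  interpret G: full_schreier_cat M "G_obj pr M X" by (rule G_full_schreier_cat)
  show ?thesis by (auto simp: G_obj_simps elim!: S_E)
qed

lemma counit_apply: "b \<in> carrier B \<Longrightarrow> counit_arr pr M X (pr (b, \<one>\<^bsub>C\<^esub>)) = b"
  using FG_carrier by (simp add: counit_arr_def)

lemma iso_arr_counit:
  "iso_arr (com_XSExt M) (F_obj (G_obj pr M X)) X (counit_arr pr M X, mon_id C)"
proof -
  interpret G: full_schreier_cat M "G_obj pr M X" by (rule G_full_schreier_cat)
  let ?\<phi> = "counit_arr pr M X" and ?B = "F_B (G_obj pr M X)"
  have hom: "?\<phi> \<in> mon_hom ?B B"
  proof (rule mon_homI)
    fix x assume "x \<in> carrier ?B"
    then obtain b where b: "b \<in> carrier B" "x = pr (b, \<one>\<^bsub>C\<^esub>)" unfolding FG_carrier by blast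
    then show "?\<phi> x \<in> carrier B" by (simp add: counit_apply)
    fix y assume "y \<in> carrier ?B"
    then obtain b' where b': "b' \<in> carrier B" "y = pr (b', \<one>\<^bsub>C\<^esub>)" unfolding FG_carrier by blast
    show "?\<phi> (x \<otimes>\<^bsub>?B\<^esub> y) = ?\<phi> x \<otimes>\<^bsub>B\<^esub> ?\<phi> y"
      using b b' by (simp add: G_obj_simps counit_apply)
  next
    show "?\<phi> \<one>\<^bsub>?B\<^esub> = \<one>\<^bsub>B\<^esub>" by (simp add: G_obj_simps S_one counit_apply)
  qed (simp add: counit_arr_def)
  have bij: "bij_betw ?\<phi> (carrier ?B) (carrier B)"
    by (rule bij_betw_byWitness[where f' = "\<lambda>b. pr (b, \<one>\<^bsub>C\<^esub>)"])
      (auto simp: FG_carrier counit_apply simp del: G.F_B_simps)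
  show ?thesis
  proof (rule iso_arr_com_XSExt[OF G.F_crossed_schreier crossed_schreier_axioms],
      unfold F_obj_simps G_obj_simps)
    show "mon_id C \<in> mon_hom C C" by (rule mon_id_hom[OF monoids(3)])
    show "bij_betw (mon_id C) (carrier C) (carrier C)" by (auto simp: bij_betw_def mon_id_def inj_on_def)
    show "\<pi> (mon_id C c) = \<pi> c" if "c \<in> carrier C" for c using that by simp
    fix x assume "x \<in> carrier ?B"
    then obtain b where b: "b \<in> carrier B" "x = pr (b, \<one>\<^bsub>C\<^esub>)" unfolding FG_carrier by blast
    have x: "x \<in> carrier S" "s x = \<one>\<^bsub>C\<^esub>" using b by simp_all
    have "F_delta (G_obj pr M X) x = \<delta> b" using G.F_delta_apply[of x] b x by (simp add: G_obj_simps)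
    then show "\<delta> (?\<phi> x) = mon_id C (F_delta (G_obj pr M X) x)" using b by (simp add: counit_apply)
    fix c assume c: "c \<in> carrier C"
    \<comment> \<open>In the semidirect product (0, c) + (b, 0) and (\<alpha> c b, 0) + (0, c) are
      both (\<alpha> c b, c), so the action recovered by F is the original one.\<close>
    have "F_act (G_obj pr M X) c x = pr (\<alpha> c b, \<one>\<^bsub>C\<^esub>)"
      by (rule G.F_act_unique) (use b c in \<open>simp_all add: G_obj_simps\<close>)
    then show "?\<phi> (F_act (G_obj pr M X) c x) = \<alpha> (mon_id C c) (?\<phi> x)"
      using b c by (simp add: counit_apply)
  qed (rule hom bij)+
qed

lemma counit_natural:
  assumes Y: "crossed_schreier M Y" and h: "(\<phi>, \<psi>) \<in> XSExt_hom M X Y"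
  shows "compose (carrier (F_B (G_obj pr M X))) (counit_arr pr M Y)
      (restrict (G_map pr X \<phi> \<psi>) (carrier (F_B (G_obj pr M X)))) =
    compose (carrier (F_B (G_obj pr M X))) \<phi> (counit_arr pr M X)"
proof (rule extensionalityI[where A = "carrier (F_B (G_obj pr M X))"])
  interpret Y: crossed_schreier_pair M Y pr by (rule crossed_schreier_pairI[OF Y inj_pr])
  have \<phi>: "\<phi> \<in> mon_hom B Y.B" "\<psi> \<in> mon_hom C Y.C"
    using h by (simp_all add: XSExt_hom_def crossed_morphism_def)
  fix x assume x: "x \<in> carrier (F_B (G_obj pr M X))"
  then obtain b where b: "b \<in> carrier B" "x = pr (b, \<one>\<^bsub>C\<^esub>)" unfolding FG_carrier by blast
  then have "G_map pr X \<phi> \<psi> x = pr (\<phi> b, \<one>\<^bsub>Y.C\<^esub>)" by (simp add: G_map_apply mon_homD(3)[OF \<phi>(2)])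
  then show "compose (carrier (F_B (G_obj pr M X))) (counit_arr pr M Y)
      (restrict (G_map pr X \<phi> \<psi>) (carrier (F_B (G_obj pr M X)))) x =
    compose (carrier (F_B (G_obj pr M X))) \<phi> (counit_arr pr M X) x"
    using x b by (simp add: compose_def Y.counit_apply counit_apply mon_homD(1)[OF \<phi>(1)])
qed simp_all

end

theorem theorem3p8:
  fixes M :: "'u monoid"
    and pr :: "'u \<times> 'u \<Rightarrow> 'u"
  assumes "monoid M"
    and "inj pr"
  shows "equivalence_of_categories (RSCat M) (com_XSExt M) F_funct (G_funct pr M)"
proof -
  have FG: "fobj F_funct = F_obj" "fobj (G_funct pr M) = G_obj pr M"
    "\<And>X Y h1 h0. farr F_funct X Y (h1, h0) = (restrict h1 (carrier (F_B X)), h0)"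
    "\<And>X Y h1 h0. farr (G_funct pr M) X Y (h1, h0) = (G_map pr X h1 h0, h0)"
    by (simp_all add: F_funct_def G_funct_def G_map_def)
  have hom: "Hom (RSCat M) = RSCat_hom" "Hom (com_XSExt M) = XSExt_hom M"
    by (simp_all add: RSCat_def com_XSExt_def)
  \<comment> \<open>On objects the unit is an identity, so the second component of naturality is a
    unit law and only the first requires \<open>unit_natural\<close>. The counit has the same
    shape.\<close>
  have \<eta>: "natural_iso (RSCat M) (RSCat M) id_funct (comp_funct (G_funct pr M) F_funct)
      (\<lambda>E. (unit_arr pr E, mon_id (objs E)))"
    unfolding natural_iso_def hom
  proof (intro conjI ballI)
    fix E assume "E \<in> Obj (RSCat M)"
    then have E: "full_schreier_cat M E" by (simp add: RSCat_Obj)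
    show "iso_arr (RSCat M) (fobj id_funct E) (fobj (comp_funct (G_funct pr M) F_funct) E)
        (unit_arr pr E, mon_id (objs E))"
      using iso_arr_unit[OF E assms(2)] by (simp add: id_funct_def comp_funct_def FG)
    fix L h assume "L \<in> Obj (RSCat M)" and h: "h \<in> RSCat_hom E L"
    then have L: "full_schreier_cat M L" by (simp add: RSCat_Obj)
    obtain h1 h0 where h10: "h = (h1, h0)" by (cases h)
    have h0: "h0 \<in> mon_hom (objs E) (objs L)"
      using h h10 by (simp add: RSCat_hom_def internal_functor_def)
    show "Comp (RSCat M) (fobj id_funct E) (fobj id_funct L) (fobj (comp_funct (G_funct pr M) F_funct) L)
        (unit_arr pr L, mon_id (objs L)) (farr id_funct E L h) =
      Comp (RSCat M) (fobj id_funct E) (fobj (comp_funct (G_funct pr M) F_funct) E)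
        (fobj (comp_funct (G_funct pr M) F_funct) L)
        (farr (comp_funct (G_funct pr M) F_funct) E L h) (unit_arr pr E, mon_id (objs E))"
      using unit_natural[OF E L assms(2)] h
      by (simp add: h10 id_funct_def comp_funct_def FG RSCat_def
          compose_mon_id_left[OF h0] compose_mon_id_right[OF h0])
  qed
  have \<epsilon>: "natural_iso (com_XSExt M) (com_XSExt M) (comp_funct F_funct (G_funct pr M)) id_funct
      (\<lambda>X. (counit_arr pr M X, mon_id (objC X)))"
    unfolding natural_iso_def hom
  proof (intro conjI ballI)
    fix X assume "X \<in> Obj (com_XSExt M)"
    then interpret X: crossed_schreier_pair M X pr
      by (intro crossed_schreier_pairI assms) (simp add: com_XSExt_Obj)
    show "iso_arr (com_XSExt M) (fobj (comp_funct F_funct (G_funct pr M)) X) (fobj id_funct X)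
        (counit_arr pr M X, mon_id X.C)"
      using X.iso_arr_counit by (simp add: id_funct_def comp_funct_def FG)
    fix Y h assume "Y \<in> Obj (com_XSExt M)" and h: "h \<in> XSExt_hom M X Y"
    then have Y: "crossed_schreier M Y" by (simp add: com_XSExt_Obj)
    obtain \<phi> \<psi> where hp: "h = (\<phi>, \<psi>)" by (cases h)
    have \<psi>: "\<psi> \<in> mon_hom X.C (objC Y)"
      using h hp by (simp add: XSExt_hom_def crossed_morphism_def)
    show "Comp (com_XSExt M) (fobj (comp_funct F_funct (G_funct pr M)) X)
        (fobj (comp_funct F_funct (G_funct pr M)) Y) (fobj id_funct Y)
        (counit_arr pr M Y, mon_id (objC Y)) (farr (comp_funct F_funct (G_funct pr M)) X Y h) =
      Comp (com_XSExt M) (fobj (comp_funct F_funct (G_funct pr M)) X) (fobj id_funct X) (fobj id_funct Y)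
        (farr id_funct X Y h) (counit_arr pr M X, mon_id X.C)"
      using X.counit_natural[OF Y] h
      by (simp add: hp id_funct_def comp_funct_def FG com_XSExt_def F_obj_simps G_obj_simps
          compose_mon_id_left[OF \<psi>] compose_mon_id_right[OF \<psi>])
  qed
  show ?thesis
    unfolding equivalence_of_categories_def
    using is_functor_F is_functor_G[OF assms(2)] \<eta> \<epsilon> by blast
qed

end
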